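(* Let $\phi:(M^m,g)\to (N^n,h)$, $m>n$, be a Riemannian submersion between Riemannian manifolds. Let $\{e_1,\dots,e_n,e_{n+1},\dots,e_m\}$ be a local orthonormal frame on $M$ with $e_i$ horizontal for $1\le i\le n$ and $e_s$ vertical for $n+1\le s\le m$, and let $\mu=\frac{1}{m-n}\sum_{s=n+1}^{m}(\nabla^M_{e_s}e_s)^{\mathcal H}$ be the mean curvature vector field of the fibers. Then the bitension field of $\phi$ is given, on the domain of the frame, by $$\tau_2(\phi)=-(m-n)\,\mathrm d\phi\Big(\sum_{i=1}^n\big\{\nabla^M_{e_i}(\nabla^M_{e_i}\mu)^{\mathcal H}-\nabla^M_{(\nabla^M_{e_i}e_i)^{\mathcal H}}\mu+[\mu,(\nabla^M_{e_i}e_i)^{\mathcal V}]\big\}+\sum_{s=n+1}^m\big\{[[\mu,e_s],e_s]+[\mu,(\nabla^M_{e_s}e_s)^{\mathcal V}]\big\}-(m-n)\nabla^M_\mu\mu\Big)-(m-n)\,\mathrm{Ricci}^N(\mathrm d\phi(\mu)).$$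
   Context: For a map $\phi:(M,g)\to(N,h)$ between Riemannian manifolds, the tension field is $\tau(\phi)=\mathrm{Trace}_g\nabla \mathrm d\phi$, a section of $\phi^{-1}TN$. The bitension field is $\tau_2(\phi)=-\Delta^\phi(\tau(\phi))-\mathrm{Trace}_g R^N(\mathrm d\phi,\tau(\phi))\mathrm d\phi$, where $\Delta^\phi=-\mathrm{Trace}_g(\nabla^\phi\nabla^\phi-\nabla^\phi_{\nabla^M})$ is the Laplacian on sections of $\phi^{-1}TN$, $\nabla^\phi$ is the pull-back connection, and $R^N(X,Y)Z=[\nabla^N_X,\nabla^N_Y]Z-\nabla^N_{[X,Y]}Z$. $\nabla^M,\nabla^N$ are the Levi-Civita connections. For a Riemannian submersion, $(\cdot)^{\mathcal V}$ and $(\cdot)^{\mathcal H}$ denote the projections of $TM$ onto the vertical distribution $\ker \mathrm d\phi$ and the horizontal distribution $(\ker \mathrm d\phi)^\perp$. $\mathrm{Ricci}^N$ is the Ricci operator, $\mathrm{Ricci}^N(X)=\sum_i R^N(X,\varepsilon_i)\varepsilon_i$ for an orthonormal frame $\{\varepsilon_i\}$ on $N$, so that $h(\mathrm{Ricci}^N(X),Y)$ is the Ricci tensor; here it is applied pointwise along $\phi$. *)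

theory Defs
  imports "HOL-Analysis.Analysis" "HOL-Library.Function_Algebras"
begin

text \<open>
  The pointwise real vector space structure on functions; addition and zero come from
  \<^theory>\<open>HOL-Library.Function_Algebras\<close>.  It is used for tangent vectors (functionals)
  and for vector fields (functions into tangent vectors).
\<close>

instantiation "fun" :: (type, scaleR) scaleR
begin

definition scaleR_fun_def: "r *\<^sub>R f = (\<lambda>x. r *\<^sub>R f x)"

instance ..

end

instance "fun" :: (type, real_vector) real_vector
  by standard
    (simp_all add: fun_eq_iff scaleR_fun_def plus_fun_def scaleR_add_right scaleR_add_left)


section \<open>Smooth manifolds\<close>

text \<open>
  Only used for open \<open>S\<close>: \<open>Ck_on k S f\<close> says that all iterated directional derivatives of
  \<open>f\<close> up to order \<open>k\<close> exist and are continuous on \<open>S\<close>.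
\<close>

primrec Ck_on ::
  "nat \<Rightarrow> 'a::euclidean_space set \<Rightarrow> ('a \<Rightarrow> 'b::euclidean_space) \<Rightarrow> bool" where
  "Ck_on 0 S f \<longleftrightarrow> continuous_on S f"
| "Ck_on (Suc k) S f \<longleftrightarrow> (\<forall>x\<in>S. f differentiable (at x)) \<and>
     (\<forall>v. Ck_on k S (\<lambda>x. frechet_derivative f (at x) v))"

definition smooth_euclidean ::
  "'a::euclidean_space set \<Rightarrow> ('a \<Rightarrow> 'b::euclidean_space) \<Rightarrow> bool" where
  "smooth_euclidean S f \<longleftrightarrow> (\<forall>k. Ck_on k S f)"

type_synonym ('p, 'a) chart = "'p set \<times> ('p \<Rightarrow> 'a)"

abbreviation chart_inv :: "('p, 'a) chart \<Rightarrow> 'a \<Rightarrow> 'p" where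
  "chart_inv c \<equiv> inv_into (fst c) (snd c)"

definition is_chart :: "('p::topological_space, 'a::euclidean_space) chart \<Rightarrow> bool" where
  "is_chart c \<longleftrightarrow> open (fst c) \<and> open (snd c ` fst c) \<and>
     homeomorphism (fst c) (snd c ` fst c) (snd c) (chart_inv c)"

text \<open>
  A smooth manifold of dimension \<open>DIM('a)\<close> is given by a smooth atlas; its set of points is the
  open set covered by the chart domains.  The Hausdorff property and second countability are
  inherited from the type \<open>'p\<close> of points.
\<close>

definition smooth_atlas ::
  "('p::{t2_space,second_countable_topology}, 'a::euclidean_space) chart set \<Rightarrow> bool" where
  "smooth_atlas A \<longleftrightarrow> (\<forall>c\<in>A. is_chart c) \<and>
     (\<forall>c\<in>A. \<forall>d\<in>A. smooth_euclidean (snd c ` (fst c \<inter> fst d)) (snd d \<circ> chart_inv c))"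

definition points :: "('p, 'a) chart set \<Rightarrow> 'p set" where
  "points A = \<Union> (fst ` A)"

definition smooth_fun ::
  "('p::topological_space, 'a::euclidean_space) chart set \<Rightarrow> 'p set \<Rightarrow> ('p \<Rightarrow> real) \<Rightarrow> bool" where
  "smooth_fun A W f \<longleftrightarrow> open W \<and> W \<subseteq> points A \<and>
     (\<forall>c\<in>A. smooth_euclidean (snd c ` (fst c \<inter> W)) (f \<circ> chart_inv c))"

definition smooth_fun_at ::
  "('p::topological_space, 'a::euclidean_space) chart set \<Rightarrow> 'p \<Rightarrow> ('p \<Rightarrow> real) \<Rightarrow> bool" where
  "smooth_fun_at A p f \<longleftrightarrow> (\<exists>W. p \<in> W \<and> smooth_fun A W f)"

definition smooth_map ::
  "('p::topological_space, 'a::euclidean_space) chart set \<Rightarrow>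
   ('q::topological_space, 'b::euclidean_space) chart set \<Rightarrow> ('p \<Rightarrow> 'q) \<Rightarrow> bool" where
  "smooth_map A B \<phi> \<longleftrightarrow> continuous_on (points A) \<phi> \<and> \<phi> ` points A \<subseteq> points B \<and>
     (\<forall>c\<in>A. \<forall>d\<in>B. smooth_euclidean (snd c ` (fst c \<inter> \<phi> -` fst d)) (snd d \<circ> \<phi> \<circ> chart_inv c))"


section \<open>Tangent vectors, differentials, sections along a map\<close>

text \<open>
  A tangent vector at \<open>p\<close> is a derivation on the functions that are smooth near \<open>p\<close>, extended
  by \<open>0\<close> to all other functions so that equality of tangent vectors is equality of functions.
  It automatically depends only on germs: if \<open>f\<close> vanishes near \<open>p\<close>, then \<open>f = \<chi> f\<close> where \<open>\<chi>\<close> is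
  \<open>0\<close> near \<open>p\<close> and \<open>1\<close> elsewhere, and the Leibniz rule gives \<open>v f = 0\<close>.  The same argument
  shows that the connections introduced below are local operators.
\<close>

type_synonym 'p tvec = "('p \<Rightarrow> real) \<Rightarrow> real"

definition tangent_space ::
  "('p::topological_space, 'a::euclidean_space) chart set \<Rightarrow> 'p \<Rightarrow> 'p tvec set" where
  "tangent_space A p = {v.
     (\<forall>f f'. smooth_fun_at A p f \<and> smooth_fun_at A p f' \<longrightarrow>
        v (\<lambda>q. f q + f' q) = v f + v f' \<and>
        v (\<lambda>q. f q * f' q) = v f * f' p + f p * v f') \<and>
     (\<forall>f c. smooth_fun_at A p f \<longrightarrow> v (\<lambda>q. c * f q) = c * v f) \<and>
     (\<forall>f. \<not> smooth_fun_at A p f \<longrightarrow> v f = 0)}"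

text \<open>The differential of \<open>\<phi>\<close> at \<open>p\<close>; \<open>B\<close> is the atlas of the target.\<close>

definition differential ::
  "('q::topological_space, 'b::euclidean_space) chart set \<Rightarrow> ('p \<Rightarrow> 'q) \<Rightarrow>
   'p \<Rightarrow> 'p tvec \<Rightarrow> 'q tvec" where
  "differential B \<phi> p v = (\<lambda>f. if smooth_fun_at B (\<phi> p) f then v (f \<circ> \<phi>) else 0)"

text \<open>
  Smooth sections over \<open>W\<close> of the pull-back bundle of the tangent bundle of the target along
  \<open>\<phi>\<close>.  Vector fields are the sections along the identity.
\<close>

definition smooth_section ::
  "('p::topological_space, 'a::euclidean_space) chart set \<Rightarrow>
   ('q::topological_space, 'b::euclidean_space) chart set \<Rightarrow> ('p \<Rightarrow> 'q) \<Rightarrow>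
   'p set \<Rightarrow> ('p \<Rightarrow> 'q tvec) \<Rightarrow> bool" where
  "smooth_section A B \<phi> W V \<longleftrightarrow> open W \<and> W \<subseteq> points A \<and>
     (\<forall>p\<in>W. V p \<in> tangent_space B (\<phi> p)) \<and>
     (\<forall>Q f. smooth_fun B Q f \<longrightarrow> smooth_fun A (W \<inter> \<phi> -` Q) (\<lambda>p. V p f))"

definition smooth_section_at ::
  "('p::topological_space, 'a::euclidean_space) chart set \<Rightarrow>
   ('q::topological_space, 'b::euclidean_space) chart set \<Rightarrow> ('p \<Rightarrow> 'q) \<Rightarrow>
   'p \<Rightarrow> ('p \<Rightarrow> 'q tvec) \<Rightarrow> bool" where
  "smooth_section_at A B \<phi> p V \<longleftrightarrow> (\<exists>W. p \<in> W \<and> smooth_section A B \<phi> W V)"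

abbreviation smooth_field ::
  "('p::topological_space, 'a::euclidean_space) chart set \<Rightarrow> 'p set \<Rightarrow> ('p \<Rightarrow> 'p tvec) \<Rightarrow> bool" where
  "smooth_field A \<equiv> smooth_section A A (\<lambda>p. p)"

abbreviation smooth_field_at ::
  "('p::topological_space, 'a::euclidean_space) chart set \<Rightarrow> 'p \<Rightarrow> ('p \<Rightarrow> 'p tvec) \<Rightarrow> bool" where
  "smooth_field_at A \<equiv> smooth_section_at A A (\<lambda>p. p)"

definition lie_bracket ::
  "('p::topological_space, 'a::euclidean_space) chart set \<Rightarrow>
   ('p \<Rightarrow> 'p tvec) \<Rightarrow> ('p \<Rightarrow> 'p tvec) \<Rightarrow> 'p \<Rightarrow> 'p tvec" where
  "lie_bracket A X Y p =
     (\<lambda>f. if smooth_fun_at A p f then X p (\<lambda>q. Y q f) - Y p (\<lambda>q. X q f) else 0)"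


section \<open>Riemannian metrics, orthonormal bases and traces\<close>

type_synonym 'p metric = "'p \<Rightarrow> 'p tvec \<Rightarrow> 'p tvec \<Rightarrow> real"

definition riemannian_manifold ::
  "('p::{t2_space,second_countable_topology}, 'a::euclidean_space) chart set \<Rightarrow>
   'p metric \<Rightarrow> bool" where
  "riemannian_manifold A g \<longleftrightarrow> smooth_atlas A \<and>
     (\<forall>p\<in>points A. \<forall>u\<in>tangent_space A p. \<forall>v\<in>tangent_space A p.
        g p u v = g p v u \<and> (u \<noteq> 0 \<longrightarrow> g p u u > 0) \<and>
        (\<forall>w\<in>tangent_space A p. \<forall>a b. g p (a *\<^sub>R u + b *\<^sub>R v) w = a * g p u w + b * g p v w)) \<and>
     (\<forall>W X Y. smooth_field A W X \<and> smooth_field A W Y \<longrightarrow>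
        smooth_fun A W (\<lambda>p. g p (X p) (Y p)))"

definition orthonormal_basis ::
  "('p::topological_space, 'a::euclidean_space) chart set \<Rightarrow> 'p metric \<Rightarrow>
   'p \<Rightarrow> (nat \<Rightarrow> 'p tvec) \<Rightarrow> bool" where
  "orthonormal_basis A g p b \<longleftrightarrow>
     (\<forall>i\<in>{1..DIM('a)}. b i \<in> tangent_space A p) \<and>
     (\<forall>i\<in>{1..DIM('a)}. \<forall>j\<in>{1..DIM('a)}. g p (b i) (b j) = (if i = j then 1 else 0)) \<and>
     tangent_space A p \<subseteq> span (b ` {1..DIM('a)})"

definition orthonormal_frame ::
  "('p::topological_space, 'a::euclidean_space) chart set \<Rightarrow> 'p metric \<Rightarrow>
   'p set \<Rightarrow> (nat \<Rightarrow> 'p \<Rightarrow> 'p tvec) \<Rightarrow> bool" where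
  "orthonormal_frame A g U e \<longleftrightarrow> open U \<and> U \<subseteq> points A \<and>
     (\<forall>i\<in>{1..DIM('a)}. smooth_field A U (e i)) \<and>
     (\<forall>p\<in>U. orthonormal_basis A g p (\<lambda>i. e i p))"

text \<open>The trace of a bilinear map on the tangent space at \<open>p\<close>: the value common to all bases.\<close>

definition metric_trace ::
  "('p::topological_space, 'a::euclidean_space) chart set \<Rightarrow> 'p metric \<Rightarrow>
   'p \<Rightarrow> ('p tvec \<Rightarrow> 'p tvec \<Rightarrow> 'v::real_vector) \<Rightarrow> 'v" where
  "metric_trace A g p \<beta> =
     (THE z. \<forall>b. orthonormal_basis A g p b \<longrightarrow> z = (\<Sum>i = 1..DIM('a). \<beta> (b i) (b i)))"


section \<open>Connections\<close>

text \<open>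
  \<open>D p v V\<close> is the covariant derivative of the section \<open>V\<close> in the direction of the tangent
  vector \<open>v\<close> at \<open>p\<close>.  The values of \<open>D\<close> when \<open>v\<close> is not tangent at \<open>p\<close>, or \<open>V\<close> is not smooth
  near \<open>p\<close>, are irrelevant.
\<close>

type_synonym ('p, 'q) connection = "'p \<Rightarrow> 'p tvec \<Rightarrow> ('p \<Rightarrow> 'q tvec) \<Rightarrow> 'q tvec"

definition connection_along ::
  "('p::topological_space, 'a::euclidean_space) chart set \<Rightarrow>
   ('q::topological_space, 'b::euclidean_space) chart set \<Rightarrow> ('p \<Rightarrow> 'q) \<Rightarrow>
   ('p, 'q) connection \<Rightarrow> bool" where
  "connection_along A B \<phi> D \<longleftrightarrow>
     (\<forall>p\<in>points A. \<forall>v\<in>tangent_space A p. \<forall>V. smooth_section_at A B \<phi> p V \<longrightarrow>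
        D p v V \<in> tangent_space B (\<phi> p) \<and>
        (\<forall>w\<in>tangent_space A p. \<forall>a b. D p (a *\<^sub>R v + b *\<^sub>R w) V = a *\<^sub>R D p v V + b *\<^sub>R D p w V) \<and>
        (\<forall>V'. smooth_section_at A B \<phi> p V' \<longrightarrow> D p v (\<lambda>q. V q + V' q) = D p v V + D p v V') \<and>
        (\<forall>f. smooth_fun_at A p f \<longrightarrow>
           D p v (\<lambda>q. f q *\<^sub>R V q) = v f *\<^sub>R V p + f p *\<^sub>R D p v V)) \<and>
     (\<forall>W X V. smooth_field A W X \<and> smooth_section A B \<phi> W V \<longrightarrow>
        smooth_section A B \<phi> W (\<lambda>p. D p (X p) V))"

definition levi_civita ::
  "('p::topological_space, 'a::euclidean_space) chart set \<Rightarrow> 'p metric \<Rightarrow>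
   ('p, 'p) connection \<Rightarrow> bool" where
  "levi_civita A g nab \<longleftrightarrow> connection_along A A (\<lambda>p. p) nab \<and>
     (\<forall>p\<in>points A. \<forall>X Y. smooth_field_at A p X \<and> smooth_field_at A p Y \<longrightarrow>
        nab p (X p) Y - nab p (Y p) X = lie_bracket A X Y p \<and>
        (\<forall>v\<in>tangent_space A p.
           v (\<lambda>q. g q (X q) (Y q)) = g p (nab p v X) (Y p) + g p (X p) (nab p v Y)))"

definition pullback_connection ::
  "('p::topological_space, 'a::euclidean_space) chart set \<Rightarrow>
   ('q::topological_space, 'b::euclidean_space) chart set \<Rightarrow> ('p \<Rightarrow> 'q) \<Rightarrow>
   ('q, 'q) connection \<Rightarrow> ('p, 'q) connection \<Rightarrow> bool" where
  "pullback_connection A B \<phi> nabN D \<longleftrightarrow> connection_along A B \<phi> D \<and>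
     (\<forall>p\<in>points A. \<forall>v\<in>tangent_space A p. \<forall>Z. smooth_field_at B (\<phi> p) Z \<longrightarrow>
        D p v (\<lambda>q. Z (\<phi> q)) = nabN (\<phi> p) (differential B \<phi> p v) Z)"

definition cov ::
  "('p, 'q) connection \<Rightarrow> ('p \<Rightarrow> 'p tvec) \<Rightarrow> ('p \<Rightarrow> 'q tvec) \<Rightarrow> 'p \<Rightarrow> 'q tvec" where
  "cov D X V = (\<lambda>p. D p (X p) V)"

text \<open>
  Tensors are evaluated on tangent vectors by extending these to smooth vector fields near the
  point; the description operator picks the value common to all extensions.
\<close>

definition curvature ::
  "('q::topological_space, 'b::euclidean_space) chart set \<Rightarrow> ('q, 'q) connection \<Rightarrow>
   'q \<Rightarrow> 'q tvec \<Rightarrow> 'q tvec \<Rightarrow> 'q tvec \<Rightarrow> 'q tvec" where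
  "curvature B nab q x y w = (THE z. \<forall>X Y Z.
     smooth_field_at B q X \<and> smooth_field_at B q Y \<and> smooth_field_at B q Z \<and>
     X q = x \<and> Y q = y \<and> Z q = w \<longrightarrow>
       z = cov nab X (cov nab Y Z) q - cov nab Y (cov nab X Z) q - cov nab (lie_bracket B X Y) Z q)"

definition ricci_operator ::
  "('q::topological_space, 'b::euclidean_space) chart set \<Rightarrow> 'q metric \<Rightarrow> ('q, 'q) connection \<Rightarrow>
   'q \<Rightarrow> 'q tvec \<Rightarrow> 'q tvec" where
  "ricci_operator B h nab q x = metric_trace B h q (\<lambda>u w. curvature B nab q x u w)"


section \<open>Tension and bitension field\<close>

text \<open>
  In the following \<open>nabM\<close>, \<open>nabN\<close> and \<open>D\<close> stand for the Levi-Civita connections of the source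
  and of the target and for the pull-back connection along \<open>\<phi>\<close>.
\<close>

definition second_fundamental_form ::
  "('p::topological_space, 'a::euclidean_space) chart set \<Rightarrow>
   ('q::topological_space, 'b::euclidean_space) chart set \<Rightarrow> ('p \<Rightarrow> 'q) \<Rightarrow>
   ('p, 'p) connection \<Rightarrow> ('p, 'q) connection \<Rightarrow> 'p \<Rightarrow> 'p tvec \<Rightarrow> 'p tvec \<Rightarrow> 'q tvec" where
  "second_fundamental_form A B \<phi> nabM D p v w = (THE z. \<forall>Y.
     smooth_field_at A p Y \<and> Y p = w \<longrightarrow>
       z = D p v (\<lambda>q. differential B \<phi> q (Y q)) - differential B \<phi> p (nabM p v Y))"

definition tension_field ::
  "('p::topological_space, 'a::euclidean_space) chart set \<Rightarrow> 'p metric \<Rightarrow>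
   ('q::topological_space, 'b::euclidean_space) chart set \<Rightarrow> ('p \<Rightarrow> 'q) \<Rightarrow>
   ('p, 'p) connection \<Rightarrow> ('p, 'q) connection \<Rightarrow> 'p \<Rightarrow> 'q tvec" where
  "tension_field A g B \<phi> nabM D p =
     metric_trace A g p (second_fundamental_form A B \<phi> nabM D p)"

definition second_covariant_derivative ::
  "('p::topological_space, 'a::euclidean_space) chart set \<Rightarrow>
   ('p, 'p) connection \<Rightarrow> ('p, 'q) connection \<Rightarrow>
   ('p \<Rightarrow> 'q tvec) \<Rightarrow> 'p \<Rightarrow> 'p tvec \<Rightarrow> 'p tvec \<Rightarrow> 'q tvec" where
  "second_covariant_derivative A nabM D V p v w = (THE z. \<forall>Y.
     smooth_field_at A p Y \<and> Y p = w \<longrightarrow> z = D p v (cov D Y V) - D p (nabM p v Y) V)"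

definition rough_laplacian ::
  "('p::topological_space, 'a::euclidean_space) chart set \<Rightarrow> 'p metric \<Rightarrow>
   ('p, 'p) connection \<Rightarrow> ('p, 'q) connection \<Rightarrow> ('p \<Rightarrow> 'q tvec) \<Rightarrow> 'p \<Rightarrow> 'q tvec" where
  "rough_laplacian A g nabM D V p =
     - metric_trace A g p (second_covariant_derivative A nabM D V p)"

definition bitension_field ::
  "('p::topological_space, 'a::euclidean_space) chart set \<Rightarrow> 'p metric \<Rightarrow>
   ('q::topological_space, 'b::euclidean_space) chart set \<Rightarrow> ('p \<Rightarrow> 'q) \<Rightarrow>
   ('p, 'p) connection \<Rightarrow> ('q, 'q) connection \<Rightarrow> ('p, 'q) connection \<Rightarrow> 'p \<Rightarrow> 'q tvec" where
  "bitension_field A g B \<phi> nabM nabN D p =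
     - rough_laplacian A g nabM D (tension_field A g B \<phi> nabM D) p
     - metric_trace A g p (\<lambda>v w. curvature B nabN (\<phi> p)
         (differential B \<phi> p v) (tension_field A g B \<phi> nabM D p) (differential B \<phi> p w))"


section \<open>Riemannian submersions\<close>

definition vertical_space ::
  "('p::topological_space, 'a::euclidean_space) chart set \<Rightarrow>
   ('q::topological_space, 'b::euclidean_space) chart set \<Rightarrow> ('p \<Rightarrow> 'q) \<Rightarrow> 'p \<Rightarrow> 'p tvec set" where
  "vertical_space A B \<phi> p = {v \<in> tangent_space A p. differential B \<phi> p v = 0}"

definition horizontal_space ::
  "('p::topological_space, 'a::euclidean_space) chart set \<Rightarrow> 'p metric \<Rightarrow>
   ('q::topological_space, 'b::euclidean_space) chart set \<Rightarrow> ('p \<Rightarrow> 'q) \<Rightarrow> 'p \<Rightarrow> 'p tvec set" where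
  "horizontal_space A g B \<phi> p =
     {v \<in> tangent_space A p. \<forall>u\<in>vertical_space A B \<phi> p. g p u v = 0}"

definition horizontal_part ::
  "('p::topological_space, 'a::euclidean_space) chart set \<Rightarrow> 'p metric \<Rightarrow>
   ('q::topological_space, 'b::euclidean_space) chart set \<Rightarrow> ('p \<Rightarrow> 'q) \<Rightarrow>
   ('p \<Rightarrow> 'p tvec) \<Rightarrow> 'p \<Rightarrow> 'p tvec" where
  "horizontal_part A g B \<phi> X p =
     (THE v. v \<in> horizontal_space A g B \<phi> p \<and> X p - v \<in> vertical_space A B \<phi> p)"

definition vertical_part ::
  "('p::topological_space, 'a::euclidean_space) chart set \<Rightarrow> 'p metric \<Rightarrow>
   ('q::topological_space, 'b::euclidean_space) chart set \<Rightarrow> ('p \<Rightarrow> 'q) \<Rightarrow>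
   ('p \<Rightarrow> 'p tvec) \<Rightarrow> 'p \<Rightarrow> 'p tvec" where
  "vertical_part A g B \<phi> X p =
     (THE v. v \<in> vertical_space A B \<phi> p \<and> X p - v \<in> horizontal_space A g B \<phi> p)"

definition riemannian_submersion ::
  "('p::topological_space, 'a::euclidean_space) chart set \<Rightarrow> 'p metric \<Rightarrow>
   ('q::topological_space, 'b::euclidean_space) chart set \<Rightarrow> 'q metric \<Rightarrow>
   ('p \<Rightarrow> 'q) \<Rightarrow> bool" where
  "riemannian_submersion A g B h \<phi> \<longleftrightarrow> smooth_map A B \<phi> \<and>
     (\<forall>p\<in>points A. differential B \<phi> p ` tangent_space A p = tangent_space B (\<phi> p) \<and>
        (\<forall>u\<in>horizontal_space A g B \<phi> p. \<forall>v\<in>horizontal_space A g B \<phi> p.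
           h (\<phi> p) (differential B \<phi> p u) (differential B \<phi> p v) = g p u v))"

end

theory Submission
  imports Defs
begin

text \<open>
  Let \<open>D\<close> be the pull-back connection.  It is torsion free, \<open>D\<^bsub>X\<^esub> d\<phi>(Y) - D\<^bsub>Y\<^esub> d\<phi>(X) = d\<phi>[X,Y]\<close>, and
  compatible with the metric.  For horizontal \<open>X\<close> and \<open>Y\<close> this yields \<open>D\<^bsub>X\<^esub> d\<phi>(Y) = d\<phi>(\<nabla>\<^bsub>X\<^esub> Y)\<close>, and for
  vertical \<open>V\<close> it yields \<open>D\<^bsub>V\<^esub> d\<phi>(Y) = d\<phi>[V,Y]\<close>.  Hence the tension field is \<open>-(m-n) d\<phi>(\<mu>)\<close>, and all
  covariant derivatives of it in the rough Laplacian can be moved to \<open>M\<close>: the horizontal frame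
  fields contribute \<open>\<nabla>(\<nabla>\<mu>)\<^sup>H\<close>, the vertical ones iterated brackets, and the horizontal parts of
  \<open>\<nabla>\<^bsub>e\<^esub> e\<close> over the vertical \<open>e\<close> add up to \<open>(m-n) \<mu>\<close>.  The curvature term is a Ricci curvature since
  the images of the horizontal frame fields form an orthonormal basis.
\<close>

section \<open>Calculus of smooth functions on open sets\<close>

text \<open>Of \<open>D\<close> only the connection axioms and its values on sections of the form Z
  o \<phi> are given. A section \<open>d\<phi>(Y)\<close> need not have that form, so
  torsion-freeness and metric compatibility are proved by expanding it in coordinate fields of a
  target chart, composed with \<phi>. That coordinate fields span is a dimension count, and the
  bound comes from the images of the n horizontal frame fields, which span because the differential
  is surjective. A second obstacle: curvature, traces and second derivatives are given by
  description operators, so each must first be shown to depend only on values at the point. On the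
  source the frame settles this; on the target no frame of fields is given, and the symmetries of
  the curvature take its place. The shape of the formula reflects two rules. Passing from
  \<open>D\<close> to the connection of M requires a horizontal field, so the derivative of \<mu>
  along e_i is projected before it is differentiated again. The rule for vertical directions holds
  for every field, which leaves plain iterated brackets.\<close>

lemma frechet_derivative_cong_open:
  assumes "open S" "x \<in> S" "\<And>y. y \<in> S \<Longrightarrow> f y = g y"
  shows "frechet_derivative f (at x) = frechet_derivative g (at x)"
proof -
  have "(f has_derivative f') (at x) \<longleftrightarrow> (g has_derivative f') (at x)" for f'
    using assms by (metis has_derivative_transform_within_open)
  then show ?thesis by (simp add: frechet_derivative_def)
qed

lemma differentiable_cong_open:
  assumes "open S" "x \<in> S" "\<And>y. y \<in> S \<Longrightarrow> f y = g y" "f differentiable (at x)"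
  shows "g differentiable (at x)"
  using assms unfolding differentiable_def by (metis has_derivative_transform_within_open)

lemma Ck_on_cong:
  assumes "open S" "\<And>y. y \<in> S \<Longrightarrow> f y = g y" "Ck_on k S f"
  shows "Ck_on k S g"
  using assms(2,3)
proof (induction k arbitrary: f g)
  case 0
  then show ?case by (simp cong: continuous_on_cong)
next
  case (Suc k)
  have "Ck_on k S (\<lambda>x. frechet_derivative g (at x) v)" for v
  proof (rule Suc.IH)
    show "Ck_on k S (\<lambda>x. frechet_derivative f (at x) v)" using Suc.prems by simp
    show "frechet_derivative f (at y) v = frechet_derivative g (at y) v" if "y \<in> S" for y
      using frechet_derivative_cong_open[OF assms(1) that Suc.prems(1)] by simp
  qed
  moreover have "g differentiable (at x)" if "x \<in> S" for x
    by (rule differentiable_cong_open[OF assms(1) that Suc.prems(1)]) (use Suc.prems that in auto)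
  ultimately show ?case by simp
qed

lemma Ck_on_subset: "Ck_on k S f \<Longrightarrow> T \<subseteq> S \<Longrightarrow> Ck_on k T f"
  by (induction k arbitrary: f) (auto intro: continuous_on_subset)

text \<open>The successor clause does not list continuity of \<open>f\<close> itself. It follows
  from differentiability, and higher orders reduce to this case by induction.\<close>

lemma Ck_on_Suc_imp: "Ck_on (Suc k) S f \<Longrightarrow> Ck_on k S f"
proof (induction k arbitrary: f)
  case 0
  then show ?case
    by (auto intro!: continuous_at_imp_continuous_on differentiable_imp_continuous_within)
next
  case (Suc k)
  then show ?case by (metis Ck_on.simps(2))
qed

lemma Ck_on_const: "Ck_on k S (\<lambda>x. c)"
proof (induction k arbitrary: c)
  case (Suc k)
  then show ?case by (simp add: frechet_derivative_const)
qed simp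

lemma Ck_on_bounded_linear_compose:
  assumes "bounded_linear L" "open S" "Ck_on k S f"
  shows "Ck_on k S (\<lambda>x. L (f x))"
  using assms(3)
proof (induction k arbitrary: f)
  case 0
  then show ?case using assms(1) by (simp add: bounded_linear.continuous_on)
next
  case (Suc k)
  have d: "((\<lambda>x. L (f x)) has_derivative (\<lambda>v. L (frechet_derivative f (at x) v))) (at x)"
    if "x \<in> S" for x
    by (rule bounded_linear.has_derivative[OF assms(1)])
      (use Suc.prems that in \<open>auto simp: frechet_derivative_works\<close>)
  have "Ck_on k S (\<lambda>x. frechet_derivative (\<lambda>x. L (f x)) (at x) v)" for v
    by (rule Ck_on_cong[OF assms(2) _ Suc.IH[of "\<lambda>x. frechet_derivative f (at x) v"]])
      (use Suc.prems in \<open>auto simp: frechet_derivative_at[OF d, symmetric]\<close>)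
  then show ?case using d by (auto simp: differentiable_def)
qed

lemma Ck_on_add:
  assumes "open S" "Ck_on k S f" "Ck_on k S g"
  shows "Ck_on k S (\<lambda>x. f x + g x)"
  using assms(2,3)
proof (induction k arbitrary: f g)
  case 0
  then show ?case by (simp add: continuous_on_add)
next
  case (Suc k)
  have d: "((\<lambda>x. f x + g x) has_derivative
      (\<lambda>v. frechet_derivative f (at x) v + frechet_derivative g (at x) v)) (at x)"
    if "x \<in> S" for x
    using Suc.prems that by (auto intro!: has_derivative_add simp: frechet_derivative_works)
  have "Ck_on k S (\<lambda>x. frechet_derivative (\<lambda>x. f x + g x) (at x) v)" for v
    by (rule Ck_on_cong[OF assms(1) _ Suc.IH[of "\<lambda>x. frechet_derivative f (at x) v"
          "\<lambda>x. frechet_derivative g (at x) v"]])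
      (use Suc.prems in \<open>auto simp: frechet_derivative_at[OF d, symmetric]\<close>)
  then show ?case using d by (auto simp: differentiable_def)
qed

lemma Ck_on_sum:
  assumes "open S" "\<And>i. i \<in> I \<Longrightarrow> Ck_on k S (f i)"
  shows "Ck_on k S (\<lambda>x. \<Sum>i\<in>I. f i x)"
  using assms(2)
proof (induction I rule: infinite_finite_induct)
  case (insert i I)
  then show ?case by (simp add: Ck_on_add[OF assms(1)])
qed (simp_all add: Ck_on_const)

lemma Ck_on_scaleR:
  assumes "open S" "Ck_on k S f" "Ck_on k S g"
  shows "Ck_on k S (\<lambda>x. f x *\<^sub>R g x)"
  using assms(2,3)
proof (induction k arbitrary: f g)
  case 0
  then show ?case by (simp add: continuous_on_scaleR)
next
  case (Suc k)
  have d: "((\<lambda>x. f x *\<^sub>R g x) has_derivative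
      (\<lambda>v. f x *\<^sub>R frechet_derivative g (at x) v + frechet_derivative f (at x) v *\<^sub>R g x)) (at x)"
    if "x \<in> S" for x
    using Suc.prems that by (auto intro!: has_derivative_scaleR simp: frechet_derivative_works)
  have "Ck_on k S (\<lambda>x. frechet_derivative (\<lambda>x. f x *\<^sub>R g x) (at x) v)" for v
  proof (rule Ck_on_cong[OF assms(1)])
    \<comment> \<open>The product rule leaves one factor undifferentiated, so the order of that
      factor is lowered by one before the induction hypothesis applies.\<close>
    show "Ck_on k S (\<lambda>x. f x *\<^sub>R frechet_derivative g (at x) v
        + frechet_derivative f (at x) v *\<^sub>R g x)"
      using Suc.prems by (intro Ck_on_add[OF assms(1)] Suc.IH) (auto intro: Ck_on_Suc_imp)
  qed (auto simp: frechet_derivative_at[OF d, symmetric])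
  then show ?case using d by (auto simp: differentiable_def)
qed

lemma Ck_on_compose:
  fixes f :: "'a::euclidean_space \<Rightarrow> 'b::euclidean_space" and g :: "'b \<Rightarrow> 'c::euclidean_space"
  assumes "open S" "Ck_on k S f" "Ck_on k T g" "f ` S \<subseteq> T"
  shows "Ck_on k S (\<lambda>x. g (f x))"
  using assms(2,3)
proof (induction k arbitrary: g)
  case 0
  then show ?case using assms(4) by (auto intro: continuous_on_compose2)
next
  case (Suc k)
  let ?f' = "\<lambda>x. frechet_derivative f (at x)" and ?g' = "\<lambda>y. frechet_derivative g (at y)"
  have d: "((\<lambda>x. g (f x)) has_derivative (\<lambda>v. ?g' (f x) (?f' x v))) (at x)"
    and lin: "linear (?g' (f x))" if "x \<in> S" for x
  proof -
    have "(g has_derivative ?g' (f x)) (at (f x))"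
      using Suc.prems that assms(4) by (auto simp: frechet_derivative_works)
    moreover have "(f has_derivative ?f' x) (at x)"
      using Suc.prems that by (auto simp: frechet_derivative_works)
    ultimately show "((\<lambda>x. g (f x)) has_derivative (\<lambda>v. ?g' (f x) (?f' x v))) (at x)"
      using diff_chain_at by (auto simp: o_def)
    show "linear (?g' (f x))"
      using \<open>(g has_derivative ?g' (f x)) (at (f x))\<close> has_derivative_linear by blast
  qed
  \<comment> \<open>In the chain rule the direction \<open>?f' x v\<close> varies with
    \<open>x\<close>, while \<open>Ck_on\<close> controls derivatives in fixed directions only.
    Expanding the direction in \<open>Basis\<close> separates the two dependences.\<close>
  have exp: "(\<Sum>b\<in>Basis. (?f' x v \<bullet> b) *\<^sub>R ?g' (f x) b) = ?g' (f x) (?f' x v)" if "x \<in> S" for x v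
  proof -
    have "?g' (f x) (?f' x v) = ?g' (f x) (\<Sum>b\<in>Basis. (?f' x v \<bullet> b) *\<^sub>R b)"
      by (simp add: euclidean_representation)
    then show ?thesis using lin[OF that] by (simp add: linear_sum linear_scale)
  qed
  have "Ck_on k S (\<lambda>x. frechet_derivative (\<lambda>x. g (f x)) (at x) v)" for v
  proof (rule Ck_on_cong[OF assms(1)])
    show "Ck_on k S (\<lambda>x. \<Sum>b\<in>Basis. (?f' x v \<bullet> b) *\<^sub>R ?g' (f x) b)"
    proof (intro Ck_on_sum Ck_on_scaleR assms(1))
      fix b :: 'b
      show "Ck_on k S (\<lambda>x. ?f' x v \<bullet> b)"
        using Suc.prems by (intro Ck_on_bounded_linear_compose[OF bounded_linear_inner_left assms(1)]) auto
      show "Ck_on k S (\<lambda>x. ?g' (f x) b)"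
        using Suc.prems by (intro Suc.IH) (auto intro: Ck_on_Suc_imp)
    qed
  qed (auto simp: frechet_derivative_at[OF d, symmetric] exp)
  then show ?case using d by (auto simp: differentiable_def)
qed

text \<open>Allows smoothness over one source chart to be checked with a target chart that changes
  from point to point.\<close>

lemma Ck_on_local:
  assumes "\<And>x. x \<in> S \<Longrightarrow> \<exists>T. open T \<and> x \<in> T \<and> Ck_on k T f"
  shows "Ck_on k S f"
  using assms
proof (induction k arbitrary: f)
  case 0
  then show ?case
    by (metis Ck_on.simps(1) continuous_at_imp_continuous_on continuous_on_eq_continuous_at)
next
  case (Suc k)
  have "f differentiable at x" if "x \<in> S" for x
    using Suc.prems[OF that] by auto
  moreover have "Ck_on k S (\<lambda>x. frechet_derivative f (at x) v)" for v
    by (rule Suc.IH) (use Suc.prems in fastforce)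
  ultimately show ?case by simp
qed

lemma smooth_euclidean_cong:
  "open S \<Longrightarrow> smooth_euclidean S f \<Longrightarrow> (\<And>x. x \<in> S \<Longrightarrow> f x = g x) \<Longrightarrow> smooth_euclidean S g"
  unfolding smooth_euclidean_def using Ck_on_cong by metis

lemma smooth_euclidean_subset: "smooth_euclidean S f \<Longrightarrow> T \<subseteq> S \<Longrightarrow> smooth_euclidean T f"
  unfolding smooth_euclidean_def using Ck_on_subset by metis

lemma smooth_euclidean_const: "smooth_euclidean S (\<lambda>x. c)"
  unfolding smooth_euclidean_def by (simp add: Ck_on_const)

lemma smooth_euclidean_add:
  "open S \<Longrightarrow> smooth_euclidean S f \<Longrightarrow> smooth_euclidean S g \<Longrightarrow> smooth_euclidean S (\<lambda>x. f x + g x)"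
  unfolding smooth_euclidean_def by (simp add: Ck_on_add)

lemma smooth_euclidean_mult:
  fixes f g :: "'a::euclidean_space \<Rightarrow> real"
  shows "open S \<Longrightarrow> smooth_euclidean S f \<Longrightarrow> smooth_euclidean S g \<Longrightarrow>
    smooth_euclidean S (\<lambda>x. f x * g x)"
  unfolding smooth_euclidean_def using Ck_on_scaleR[of S _ f g] by simp

lemma smooth_euclidean_inner:
  "open S \<Longrightarrow> smooth_euclidean S f \<Longrightarrow> smooth_euclidean S (\<lambda>x. f x \<bullet> b)"
  unfolding smooth_euclidean_def
  using Ck_on_bounded_linear_compose[OF bounded_linear_inner_left, of S] by blast

lemma smooth_euclidean_compose:
  "open S \<Longrightarrow> smooth_euclidean S f \<Longrightarrow> smooth_euclidean T g \<Longrightarrow> f ` S \<subseteq> T \<Longrightarrow>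
    smooth_euclidean S (\<lambda>x. g (f x))"
  unfolding smooth_euclidean_def using Ck_on_compose[of S _ f T g] by blast

lemma smooth_euclidean_local:
  "(\<And>x. x \<in> S \<Longrightarrow> \<exists>T. open T \<and> x \<in> T \<and> smooth_euclidean T f) \<Longrightarrow> smooth_euclidean S f"
  unfolding smooth_euclidean_def using Ck_on_local[of S _ f] by metis

lemma smooth_euclidean_derivative:
  "smooth_euclidean S f \<Longrightarrow> smooth_euclidean S (\<lambda>x. frechet_derivative f (at x) v)"
  unfolding smooth_euclidean_def by (metis Ck_on.simps(2))

lemma smooth_euclidean_differentiable:
  "smooth_euclidean S f \<Longrightarrow> x \<in> S \<Longrightarrow> f differentiable (at x)"
  unfolding smooth_euclidean_def by (metis Ck_on.simps(2))

section \<open>Smooth functions and tangent vectors\<close>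

lemma eventually_nhds_mem: "open W \<Longrightarrow> p \<in> W \<Longrightarrow> \<forall>\<^sub>F q in nhds p. q \<in> W"
  by (auto simp: eventually_nhds)

lemma chart_open: "smooth_atlas A \<Longrightarrow> c \<in> A \<Longrightarrow> open (fst c)"
  by (auto simp: smooth_atlas_def is_chart_def)

lemma chart_subset_points: "c \<in> A \<Longrightarrow> fst c \<subseteq> points A"
  by (auto simp: points_def)

lemma open_points: "smooth_atlas A \<Longrightarrow> open (points A)"
  by (auto simp: points_def smooth_atlas_def is_chart_def)

lemma chart_inv_apply:
  assumes "smooth_atlas A" "c \<in> A" "p \<in> fst c"
  shows "chart_inv c (snd c p) = p"
  using assms by (auto simp: smooth_atlas_def is_chart_def homeomorphism_def)

lemma chart_image_open:
  assumes "smooth_atlas A" "c \<in> A" "open W"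
  shows "open (snd c ` (fst c \<inter> W))"
proof -
  have c: "open (snd c ` fst c)" "homeomorphism (fst c) (snd c ` fst c) (snd c) (chart_inv c)"
    using assms by (auto simp: smooth_atlas_def is_chart_def)
  have "openin (top_of_set (snd c ` fst c)) (snd c ` (fst c \<inter> W))"
    by (rule homeomorphism_imp_open_map[OF c(2)]) (simp add: assms(3) openin_open_Int)
  then show ?thesis using c(1) openin_open_trans by blast
qed

lemma smooth_fun_cong:
  assumes A: "smooth_atlas A" and f: "smooth_fun A W f" and eq: "\<And>q. q \<in> W \<Longrightarrow> f q = f' q"
  shows "smooth_fun A W f'"
  unfolding smooth_fun_def
proof (intro conjI ballI)
  show W: "open W" "W \<subseteq> points A" using f by (auto simp: smooth_fun_def)
  fix c assume c: "c \<in> A"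
  show "smooth_euclidean (snd c ` (fst c \<inter> W)) (f' \<circ> chart_inv c)"
  proof (rule smooth_euclidean_cong[OF chart_image_open[OF A c W(1)]])
    show "smooth_euclidean (snd c ` (fst c \<inter> W)) (f \<circ> chart_inv c)"
      using f c by (auto simp: smooth_fun_def)
  qed (auto simp: chart_inv_apply[OF A c] eq)
qed

lemma smooth_fun_subset:
  assumes "smooth_fun A W f" "open W'" "W' \<subseteq> W"
  shows "smooth_fun A W' f"
  using assms unfolding smooth_fun_def
  by (blast intro: smooth_euclidean_subset)

lemma smooth_fun_const: "open W \<Longrightarrow> W \<subseteq> points A \<Longrightarrow> smooth_fun A W (\<lambda>q. c)"
  by (simp add: smooth_fun_def o_def smooth_euclidean_const)

lemma smooth_fun_add:
  "smooth_atlas A \<Longrightarrow> smooth_fun A W f \<Longrightarrow> smooth_fun A W f' \<Longrightarrow> smooth_fun A W (\<lambda>q. f q + f' q)"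
  unfolding smooth_fun_def o_def by (auto intro: smooth_euclidean_add chart_image_open)

lemma smooth_fun_mult:
  "smooth_atlas A \<Longrightarrow> smooth_fun A W f \<Longrightarrow> smooth_fun A W f' \<Longrightarrow> smooth_fun A W (\<lambda>q. f q * f' q)"
  unfolding smooth_fun_def o_def by (auto intro: smooth_euclidean_mult chart_image_open)

lemma smooth_fun_coordinate:
  assumes A: "smooth_atlas A" and c: "c \<in> A"
  shows "smooth_fun A (fst c) (\<lambda>q. snd c q \<bullet> b)"
  unfolding smooth_fun_def
proof (intro conjI ballI)
  show "open (fst c)" "fst c \<subseteq> points A" using chart_open[OF A c] chart_subset_points[OF c] by simp_all
  fix d assume d: "d \<in> A"
  have "smooth_euclidean (snd d ` (fst d \<inter> fst c)) (snd c \<circ> chart_inv d)"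
    using A c d by (auto simp: smooth_atlas_def)
  then show "smooth_euclidean (snd d ` (fst d \<inter> fst c)) ((\<lambda>q. snd c q \<bullet> b) \<circ> chart_inv d)"
    using smooth_euclidean_inner[OF chart_image_open[OF A d chart_open[OF A c]]]
    by (auto simp: o_def)
qed

lemma smooth_map_open_vimage:
  assumes "smooth_atlas A" "smooth_map A B \<phi>" "open Q"
  shows "open (points A \<inter> \<phi> -` Q)"
  using assms open_points[OF assms(1)] continuous_open_preimage
  by (auto simp: smooth_map_def)

text \<open>Near a point, f o \<phi> read in a source chart is f read in a target chart, after
  \<phi> read in both charts.\<close>

lemma smooth_fun_compose:
  assumes A: "smooth_atlas A" and B: "smooth_atlas B" and \<phi>: "smooth_map A B \<phi>"
    and f: "smooth_fun B Q f"
  shows "smooth_fun A (points A \<inter> \<phi> -` Q) (f \<circ> \<phi>)"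
  unfolding smooth_fun_def
proof (intro conjI ballI)
  have Q: "open Q" "Q \<subseteq> points B" using f by (auto simp: smooth_fun_def)
  show "open (points A \<inter> \<phi> -` Q)" by (rule smooth_map_open_vimage[OF A \<phi> Q(1)])
  show "points A \<inter> \<phi> -` Q \<subseteq> points A" by simp
  fix c assume c: "c \<in> A"
  show "smooth_euclidean (snd c ` (fst c \<inter> (points A \<inter> \<phi> -` Q))) (f \<circ> \<phi> \<circ> chart_inv c)"
  proof (rule smooth_euclidean_local)
    fix x assume "x \<in> snd c ` (fst c \<inter> (points A \<inter> \<phi> -` Q))"
    then obtain p where p: "p \<in> fst c" "\<phi> p \<in> Q" "x = snd c p" "p \<in> points A" by auto
    then obtain d where d: "d \<in> B" "\<phi> p \<in> fst d" using Q by (auto simp: points_def)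
    let ?T = "snd c ` (fst c \<inter> (points A \<inter> \<phi> -` (fst d \<inter> Q)))"
    have T: "open ?T"
      by (intro chart_image_open[OF A c] smooth_map_open_vimage[OF A \<phi>] open_Int Q(1)
          chart_open[OF B d(1)])
    have "smooth_euclidean (snd c ` (fst c \<inter> \<phi> -` fst d)) (snd d \<circ> \<phi> \<circ> chart_inv c)"
      using \<phi> c d(1) by (auto simp: smooth_map_def)
    then have 1: "smooth_euclidean ?T (snd d \<circ> \<phi> \<circ> chart_inv c)"
      by (rule smooth_euclidean_subset) auto
    have 2: "smooth_euclidean (snd d ` (fst d \<inter> Q)) (f \<circ> chart_inv d)"
      using f d(1) by (auto simp: smooth_fun_def)
    have "smooth_euclidean ?T (\<lambda>x. (f \<circ> chart_inv d) ((snd d \<circ> \<phi> \<circ> chart_inv c) x))"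
      by (rule smooth_euclidean_compose[OF T 1 2]) (auto simp: chart_inv_apply[OF A c])
    then have "smooth_euclidean ?T (f \<circ> \<phi> \<circ> chart_inv c)"
      by (rule smooth_euclidean_cong[OF T])
        (auto simp: chart_inv_apply[OF A c] chart_inv_apply[OF B d(1)])
    then show "\<exists>T. open T \<and> x \<in> T \<and> smooth_euclidean T (f \<circ> \<phi> \<circ> chart_inv c)"
      using T p d by blast
  qed
qed

lemma smooth_fun_atI: "smooth_fun A W f \<Longrightarrow> p \<in> W \<Longrightarrow> smooth_fun_at A p f"
  by (auto simp: smooth_fun_at_def)

lemma smooth_fun_at_points: "smooth_fun_at A p f \<Longrightarrow> p \<in> points A"
  by (auto simp: smooth_fun_at_def smooth_fun_def)

lemma smooth_fun_at_cong:
  assumes "smooth_atlas A" "smooth_fun_at A p f" "\<forall>\<^sub>F q in nhds p. f q = f' q"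
  shows "smooth_fun_at A p f'"
proof -
  obtain W where W: "p \<in> W" "smooth_fun A W f" using assms by (auto simp: smooth_fun_at_def)
  obtain S where S: "open S" "p \<in> S" "\<And>q. q \<in> S \<Longrightarrow> f q = f' q"
    using assms(3) by (auto simp: eventually_nhds)
  have "smooth_fun A (W \<inter> S) f"
    using smooth_fun_subset[OF W(2), of "W \<inter> S"] W S by (auto simp: smooth_fun_def)
  then have "smooth_fun A (W \<inter> S) f'" by (rule smooth_fun_cong[OF assms(1)]) (use S in auto)
  then show ?thesis using W S by (auto intro: smooth_fun_atI)
qed

lemma smooth_fun_at_cong_iff:
  assumes "smooth_atlas A" "\<forall>\<^sub>F q in nhds p. f q = f' q"
  shows "smooth_fun_at A p f \<longleftrightarrow> smooth_fun_at A p f'"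
  using smooth_fun_at_cong[OF assms(1) _ assms(2)] smooth_fun_at_cong[OF assms(1), of p f' f] assms(2)
  by (auto simp: eq_commute)

lemma smooth_fun_at_eventually:
  assumes "smooth_fun_at A p f"
  shows "\<forall>\<^sub>F q in nhds p. smooth_fun_at A q f"
  using assms by (auto simp: smooth_fun_at_def eventually_nhds smooth_fun_def)

lemma smooth_fun_at_common:
  assumes "smooth_fun_at A p f" "smooth_fun_at A p f'"
  obtains W where "p \<in> W" "smooth_fun A W f" "smooth_fun A W f'"
proof -
  obtain W W' where W: "p \<in> W" "smooth_fun A W f" "p \<in> W'" "smooth_fun A W' f'"
    using assms by (auto simp: smooth_fun_at_def)
  then have o: "open (W \<inter> W')" by (auto simp: smooth_fun_def)
  show ?thesis
    by (rule that[of "W \<inter> W'"])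
      (use W smooth_fun_subset[OF W(2) o] smooth_fun_subset[OF W(4) o] in auto)
qed

lemma smooth_fun_at_const: "smooth_atlas A \<Longrightarrow> p \<in> points A \<Longrightarrow> smooth_fun_at A p (\<lambda>q. c)"
  using smooth_fun_const[OF open_points, of A A] by (auto intro: smooth_fun_atI)

lemma smooth_fun_at_add:
  "smooth_atlas A \<Longrightarrow> smooth_fun_at A p f \<Longrightarrow> smooth_fun_at A p f' \<Longrightarrow>
    smooth_fun_at A p (\<lambda>q. f q + f' q)"
  by (erule (1) smooth_fun_at_common) (rule smooth_fun_atI[OF smooth_fun_add])

lemma smooth_fun_at_mult:
  "smooth_atlas A \<Longrightarrow> smooth_fun_at A p f \<Longrightarrow> smooth_fun_at A p f' \<Longrightarrow>
    smooth_fun_at A p (\<lambda>q. f q * f' q)"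
  by (erule (1) smooth_fun_at_common) (rule smooth_fun_atI[OF smooth_fun_mult])

lemma smooth_fun_at_cmult:
  "smooth_atlas A \<Longrightarrow> smooth_fun_at A p f \<Longrightarrow> smooth_fun_at A p (\<lambda>q. c * f q)"
  by (simp add: smooth_fun_at_mult smooth_fun_at_const smooth_fun_at_points)

lemma smooth_fun_at_sum:
  assumes "smooth_atlas A" "p \<in> points A" "\<And>i. i \<in> I \<Longrightarrow> smooth_fun_at A p (f i)"
  shows "smooth_fun_at A p (\<lambda>q. \<Sum>i\<in>I. f i q)"
  using assms(3)
  by (induction I rule: infinite_finite_induct)
    (simp_all add: smooth_fun_at_add smooth_fun_at_const assms(1,2))

lemma smooth_fun_at_compose:
  assumes "smooth_atlas A" "smooth_atlas B" "smooth_map A B \<phi>" "p \<in> points A"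
    "smooth_fun_at B (\<phi> p) f"
  shows "smooth_fun_at A p (\<lambda>q. f (\<phi> q))"
proof -
  obtain Q where Q: "\<phi> p \<in> Q" "smooth_fun B Q f" using assms(5) by (auto simp: smooth_fun_at_def)
  show ?thesis
    by (rule smooth_fun_atI[OF smooth_fun_compose[OF assms(1-3) Q(2), unfolded o_def]])
      (use assms(4) Q(1) in simp)
qed

section \<open>Tangent vectors as derivations, and the differential\<close>

lemma
  assumes "v \<in> tangent_space A p" "smooth_fun_at A p f"
  shows tangent_add: "smooth_fun_at A p f' \<Longrightarrow> v (\<lambda>q. f q + f' q) = v f + v f'"
    and tangent_mult: "smooth_fun_at A p f' \<Longrightarrow> v (\<lambda>q. f q * f' q) = v f * f' p + f p * v f'"
    and tangent_cmult: "v (\<lambda>q. c * f q) = c * v f"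
  using assms by (auto simp: tangent_space_def)

lemma tangent_not_smooth: "v \<in> tangent_space A p \<Longrightarrow> \<not> smooth_fun_at A p f \<Longrightarrow> v f = 0"
  by (auto simp: tangent_space_def)

lemma tangent_const:
  assumes "smooth_atlas A" "p \<in> points A" "v \<in> tangent_space A p"
  shows "v (\<lambda>q. c) = 0"
proof -
  \<comment> \<open>The Leibniz rule for 1 = 1 * 1 gives v 1 = 2 v 1.\<close>
  have "v (\<lambda>q. 1 * 1) = v (\<lambda>q. 1) * 1 + 1 * v (\<lambda>q. 1)"
    by (rule tangent_mult) (use assms smooth_fun_at_const in auto)
  then have 0: "v (\<lambda>q. 1) = 0" by simp
  have "v (\<lambda>q. c * 1) = c * v (\<lambda>q. 1)"
    by (rule tangent_cmult) (use assms smooth_fun_at_const in auto)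
  then show ?thesis using 0 by simp
qed

text \<open>
  The indicator function of the set where two functions differ is smooth near \<open>p\<close> as soon as
  they agree near \<open>p\<close>, since smoothness near \<open>p\<close> says nothing about distant points; no bump
  function is needed.
\<close>

lemma tangent_cong:
  assumes A: "smooth_atlas A" and v: "v \<in> tangent_space A p" and eq: "\<forall>\<^sub>F q in nhds p. f q = f' q"
  shows "v f = v f'"
proof (cases "smooth_fun_at A p f")
  case True
  then have p: "p \<in> points A" by (rule smooth_fun_at_points)
  have f': "smooth_fun_at A p f'" by (rule smooth_fun_at_cong[OF A True eq])
  define ch :: "'a \<Rightarrow> real" where "ch = (\<lambda>q. if f q = f' q then 0 else 1)"
  define d where "d = (\<lambda>q. f q + (-1) * f' q)"
  have ch: "smooth_fun_at A p ch"
    by (rule smooth_fun_at_cong[OF A smooth_fun_at_const[OF A p, of 0]])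
      (use eq in \<open>auto simp: ch_def elim: eventually_mono\<close>)
  have d: "smooth_fun_at A p d" unfolding d_def
    by (intro smooth_fun_at_add smooth_fun_at_cmult A True f')
  have p0: "f p = f' p" using eq by (rule eventually_nhds_x_imp_x)
  have "v d = v (\<lambda>q. ch q * d q)" by (rule arg_cong[of _ _ v]) (auto simp: ch_def d_def)
  also have "\<dots> = 0" by (subst tangent_mult[OF v ch d]) (simp add: d_def ch_def p0)
  finally have "v d = 0" .
  moreover have "v d = v f + -1 * v f'"
    unfolding d_def
    by (subst tangent_add[OF v True smooth_fun_at_cmult[OF A f']])
      (simp only: tangent_cmult[OF v f'])
  ultimately show ?thesis by simp
next
  case False
  then show ?thesis
    using smooth_fun_at_cong_iff[OF A eq] tangent_not_smooth[OF v] by metis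
qed

lemma tangent_sum:
  assumes "smooth_atlas A" "p \<in> points A" "v \<in> tangent_space A p"
    "\<And>i. i \<in> I \<Longrightarrow> smooth_fun_at A p (f i)"
  shows "v (\<lambda>q. \<Sum>i\<in>I. f i q) = (\<Sum>i\<in>I. v (f i))"
  using assms(4)
proof (induction I rule: infinite_finite_induct)
  case (insert i I)
  then show ?case
    by (simp add: tangent_add[OF assms(3)] smooth_fun_at_sum[OF assms(1,2)])
qed (use tangent_const[OF assms(1-3), of 0] in auto)

lemma subspace_tangent_space: "subspace (tangent_space A p)"
  by (rule subspaceI) (auto simp: tangent_space_def scaleR_fun_def algebra_simps)

text \<open>The cut-off in \<open>differential\<close> depends on \<open>\<phi> p\<close> and
  \<open>f\<close> but not on \<open>v\<close>, so linearity holds on all functionals and needs no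
  tangency side conditions.\<close>

lemma linear_differential: "linear (differential B \<phi> p)"
  by (rule linearI) (auto simp: differential_def scaleR_fun_def fun_eq_iff)

lemma differential_tangent:
  assumes "smooth_atlas A" "smooth_atlas B" "smooth_map A B \<phi>" "p \<in> points A"
    and v: "v \<in> tangent_space A p"
  shows "differential B \<phi> p v \<in> tangent_space B (\<phi> p)"
proof -
  note c = smooth_fun_at_compose[OF assms(1-4)]
  have "smooth_fun_at B (\<phi> p) (\<lambda>q. f q + f' q)" "smooth_fun_at B (\<phi> p) (\<lambda>q. f q * f' q)"
    "smooth_fun_at B (\<phi> p) (\<lambda>q. a * f q)"
    if "smooth_fun_at B (\<phi> p) f" "smooth_fun_at B (\<phi> p) f'" for f f' a
    using that by (auto intro: smooth_fun_at_add smooth_fun_at_mult smooth_fun_at_cmult assms(2))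
  moreover have "v (\<lambda>q. f (\<phi> q) + f' (\<phi> q)) = v (\<lambda>q. f (\<phi> q)) + v (\<lambda>q. f' (\<phi> q))"
    "v (\<lambda>q. f (\<phi> q) * f' (\<phi> q)) = v (\<lambda>q. f (\<phi> q)) * f' (\<phi> p) + f (\<phi> p) * v (\<lambda>q. f' (\<phi> q))"
    "v (\<lambda>q. a * f (\<phi> q)) = a * v (\<lambda>q. f (\<phi> q))"
    if "smooth_fun_at B (\<phi> p) f" "smooth_fun_at B (\<phi> p) f'" for f f' a
    using tangent_add[OF v c[OF that(1)] c[OF that(2)]]
      tangent_mult[OF v c[OF that(1)] c[OF that(2)]] tangent_cmult[OF v c[OF that(1)]]
    by simp_all
  ultimately show ?thesis by (simp add: tangent_space_def differential_def o_def)
qed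

lemma differential_apply:
  "smooth_fun_at B (\<phi> p) f \<Longrightarrow> differential B \<phi> p v f = v (\<lambda>q. f (\<phi> q))"
  by (simp add: differential_def o_def)

section \<open>Sections along a map and connections\<close>

text \<open>Tangent vectors are treated as vectors, not as functions that are to be applied.\<close>

lemmas tangent_space_diff = subspace_diff[OF subspace_tangent_space]
  and tangent_space_add = subspace_add[OF subspace_tangent_space]
  and tangent_space_scale = subspace_scale[OF subspace_tangent_space]
  and tangent_space_zero = subspace_0[OF subspace_tangent_space]
  and tangent_space_sum = subspace_sum[OF subspace_tangent_space]

declare plus_fun_apply [simp del] minus_apply [simp del] uminus_apply [simp del]

lemma smooth_section_subset:
  assumes "smooth_section A B \<phi> W V" "open W'" "W' \<subseteq> W"
  shows "smooth_section A B \<phi> W' V"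
  unfolding smooth_section_def
proof (intro conjI ballI allI impI)
  show "open W'" "W' \<subseteq> points A" using assms by (auto simp: smooth_section_def)
  show "V p \<in> tangent_space B (\<phi> p)" if "p \<in> W'" for p
    using assms that by (auto simp: smooth_section_def)
  fix Q f assume "smooth_fun B Q f"
  then have *: "smooth_fun A (W \<inter> \<phi> -` Q) (\<lambda>p. V p f)"
    using assms by (auto simp: smooth_section_def)
  then have "open (W' \<inter> (W \<inter> \<phi> -` Q))" using assms(2) by (auto simp: smooth_fun_def)
  moreover have "W' \<inter> (W \<inter> \<phi> -` Q) = W' \<inter> \<phi> -` Q" using assms(3) by auto
  ultimately show "smooth_fun A (W' \<inter> \<phi> -` Q) (\<lambda>p. V p f)"
    using assms(3) by (auto intro: smooth_fun_subset[OF *])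
qed

lemma smooth_section_cong:
  assumes "smooth_atlas A" "smooth_section A B \<phi> W V" "\<And>q. q \<in> W \<Longrightarrow> V q = V' q"
  shows "smooth_section A B \<phi> W V'"
  unfolding smooth_section_def
proof (intro conjI ballI allI impI)
  show "open W" "W \<subseteq> points A" using assms by (auto simp: smooth_section_def)
  show "V' p \<in> tangent_space B (\<phi> p)" if "p \<in> W" for p
    using assms that by (auto simp: smooth_section_def)
  fix Q f assume "smooth_fun B Q f"
  then have "smooth_fun A (W \<inter> \<phi> -` Q) (\<lambda>p. V p f)"
    using assms by (auto simp: smooth_section_def)
  then show "smooth_fun A (W \<inter> \<phi> -` Q) (\<lambda>p. V' p f)"
    by (rule smooth_fun_cong[OF assms(1)]) (simp add: assms(3))
qed

lemma smooth_section_add: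
  assumes "smooth_atlas A" "smooth_section A B \<phi> W V" "smooth_section A B \<phi> W V'"
  shows "smooth_section A B \<phi> W (\<lambda>q. V q + V' q)"
  using assms subspace_add[OF subspace_tangent_space, of _ B "\<phi> _"]
  by (auto simp: smooth_section_def smooth_fun_add plus_fun_apply)

lemma smooth_section_scale:
  assumes "smooth_atlas A" "smooth_fun A W f" "smooth_section A B \<phi> W V"
  shows "smooth_section A B \<phi> W (\<lambda>q. f q *\<^sub>R V q)"
  unfolding smooth_section_def
proof (intro conjI ballI allI impI)
  show "open W" "W \<subseteq> points A" using assms by (auto simp: smooth_section_def)
  show "f p *\<^sub>R V p \<in> tangent_space B (\<phi> p)" if "p \<in> W" for p
    using assms that subspace_scale[OF subspace_tangent_space, of _ B "\<phi> p"]
    by (auto simp: smooth_section_def)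
  fix Q f' assume "smooth_fun B Q f'"
  then have *: "smooth_fun A (W \<inter> \<phi> -` Q) (\<lambda>p. V p f')"
    using assms by (auto simp: smooth_section_def)
  then have "smooth_fun A (W \<inter> \<phi> -` Q) f"
    by (intro smooth_fun_subset[OF assms(2)]) (auto simp: smooth_fun_def)
  then show "smooth_fun A (W \<inter> \<phi> -` Q) (\<lambda>p. (f p *\<^sub>R V p) f')"
    using smooth_fun_mult[OF assms(1) _ *] by (simp add: scaleR_fun_def)
qed

lemma smooth_section_atI: "smooth_section A B \<phi> W V \<Longrightarrow> p \<in> W \<Longrightarrow> smooth_section_at A B \<phi> p V"
  by (auto simp: smooth_section_at_def)

lemma smooth_section_at_points: "smooth_section_at A B \<phi> p V \<Longrightarrow> p \<in> points A"
  by (auto simp: smooth_section_at_def smooth_section_def)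

lemma smooth_section_at_tangent: "smooth_section_at A B \<phi> p V \<Longrightarrow> V p \<in> tangent_space B (\<phi> p)"
  by (auto simp: smooth_section_at_def smooth_section_def)

lemma smooth_section_at_eventually:
  assumes "smooth_section_at A B \<phi> p V"
  shows "\<forall>\<^sub>F q in nhds p. smooth_section_at A B \<phi> q V"
  using assms by (auto simp: smooth_section_at_def eventually_nhds smooth_section_def)

lemma smooth_section_at_common:
  assumes "smooth_section_at A B \<phi> p V" "smooth_section_at A B' \<psi> p V'"
  obtains W where "p \<in> W" "smooth_section A B \<phi> W V" "smooth_section A B' \<psi> W V'"
proof -
  obtain W W' where W: "p \<in> W" "smooth_section A B \<phi> W V" "p \<in> W'" "smooth_section A B' \<psi> W' V'"
    using assms by (auto simp: smooth_section_at_def)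
  then have o: "open (W \<inter> W')" by (auto simp: smooth_section_def)
  show ?thesis
    by (rule that[of "W \<inter> W'"])
      (use W smooth_section_subset[OF W(2) o] smooth_section_subset[OF W(4) o] in auto)
qed

lemma smooth_section_at_cong:
  assumes "smooth_atlas A" "smooth_section_at A B \<phi> p V" "\<forall>\<^sub>F q in nhds p. V q = V' q"
  shows "smooth_section_at A B \<phi> p V'"
proof -
  obtain W where W: "p \<in> W" "smooth_section A B \<phi> W V"
    using assms by (auto simp: smooth_section_at_def)
  obtain S where S: "open S" "p \<in> S" "\<And>q. q \<in> S \<Longrightarrow> V q = V' q"
    using assms(3) by (auto simp: eventually_nhds)
  have "smooth_section A B \<phi> (W \<inter> S) V"
    using smooth_section_subset[OF W(2), of "W \<inter> S"] W S by (auto simp: smooth_section_def)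
  then have "smooth_section A B \<phi> (W \<inter> S) V'"
    by (rule smooth_section_cong[OF assms(1)]) (use S in auto)
  then show ?thesis using W S by (auto intro: smooth_section_atI)
qed

lemma smooth_section_at_add:
  assumes "smooth_atlas A" "smooth_section_at A B \<phi> p V" "smooth_section_at A B \<phi> p V'"
  shows "smooth_section_at A B \<phi> p (\<lambda>q. V q + V' q)"
  using assms(2,3) by (rule smooth_section_at_common)
    (auto intro: smooth_section_atI smooth_section_add assms(1))

lemma smooth_section_at_scale:
  assumes "smooth_atlas A" "smooth_fun_at A p f" "smooth_section_at A B \<phi> p V"
  shows "smooth_section_at A B \<phi> p (\<lambda>q. f q *\<^sub>R V q)"
proof -
  obtain W W' where W: "p \<in> W" "smooth_fun A W f" "p \<in> W'" "smooth_section A B \<phi> W' V"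
    using assms by (auto simp: smooth_section_at_def smooth_fun_at_def)
  then have o: "open (W \<inter> W')" by (auto simp: smooth_section_def smooth_fun_def)
  have "smooth_section A B \<phi> (W \<inter> W') (\<lambda>q. f q *\<^sub>R V q)"
    by (rule smooth_section_scale[OF assms(1)])
      (use smooth_fun_subset[OF W(2) o] smooth_section_subset[OF W(4) o] in auto)
  then show ?thesis using W by (auto intro: smooth_section_atI)
qed

lemma smooth_section_at_scale_const:
  "smooth_atlas A \<Longrightarrow> smooth_section_at A B \<phi> p V \<Longrightarrow> smooth_section_at A B \<phi> p (\<lambda>q. a *\<^sub>R V q)"
  by (rule smooth_section_at_scale) (auto intro: smooth_fun_at_const smooth_section_at_points)

lemma smooth_section_at_diff:
  assumes "smooth_atlas A" "smooth_section_at A B \<phi> p V" "smooth_section_at A B \<phi> p V'"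
  shows "smooth_section_at A B \<phi> p (\<lambda>q. V q - V' q)"
  using smooth_section_at_add[OF assms(1,2) smooth_section_at_scale_const[OF assms(1,3), of "-1"]]
  by simp

text \<open>Nothing is assumed about \<phi> here. That the relevant preimages are open is contained
  in the smoothness of some section \<open>V\<close>, so the zero section is obtained as 0 times
  \<open>V\<close>. In the sum rule below, \<open>V0\<close> serves the same purpose for empty
  sums.\<close>

lemma smooth_section_at_zero:
  assumes "smooth_atlas A" "smooth_section_at A B \<phi> p V"
  shows "smooth_section_at A B \<phi> p (\<lambda>q. 0)"
  using smooth_section_at_scale_const[OF assms, of 0] by simp

lemma smooth_section_at_sum:
  assumes "smooth_atlas A" "smooth_section_at A B \<phi> p V0"
    "\<And>i. i \<in> I \<Longrightarrow> smooth_section_at A B \<phi> p (V i)"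
  shows "smooth_section_at A B \<phi> p (\<lambda>q. \<Sum>i\<in>I. V i q)"
  using assms(3)
  by (induction I rule: infinite_finite_induct)
    (simp_all add: smooth_section_at_add smooth_section_at_zero[OF assms(1,2)] assms(1))

lemma smooth_section_at_apply:
  assumes "smooth_section_at A B \<phi> p V" "smooth_fun_at B (\<phi> p) f"
  shows "smooth_fun_at A p (\<lambda>q. V q f)"
proof -
  obtain W Q where W: "p \<in> W" "smooth_section A B \<phi> W V" and Q: "\<phi> p \<in> Q" "smooth_fun B Q f"
    using assms by (auto simp: smooth_section_at_def smooth_fun_at_def)
  then have "smooth_fun A (W \<inter> \<phi> -` Q) (\<lambda>q. V q f)" by (auto simp: smooth_section_def)
  then show ?thesis using W Q by (auto intro: smooth_fun_atI)
qed

lemma smooth_field_at_apply: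
  "smooth_field_at A p X \<Longrightarrow> smooth_fun_at A p f \<Longrightarrow> smooth_fun_at A p (\<lambda>q. X q f)"
  by (rule smooth_section_at_apply)

lemma smooth_section_at_field_compose:
  assumes A: "smooth_atlas A" and B: "smooth_atlas B" and \<phi>: "smooth_map A B \<phi>"
    and p: "p \<in> points A" and Z: "smooth_field_at B (\<phi> p) Z"
  shows "smooth_section_at A B \<phi> p (\<lambda>q. Z (\<phi> q))"
proof -
  obtain Q where Q: "\<phi> p \<in> Q" "smooth_field B Q Z" using Z by (auto simp: smooth_section_at_def)
  have "smooth_section A B \<phi> (points A \<inter> \<phi> -` Q) (\<lambda>q. Z (\<phi> q))"
    unfolding smooth_section_def
  proof (intro conjI ballI allI impI)
    show "open (points A \<inter> \<phi> -` Q)"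
      by (rule smooth_map_open_vimage[OF A \<phi>]) (use Q in \<open>simp add: smooth_section_def\<close>)
    show "Z (\<phi> q) \<in> tangent_space B (\<phi> q)" if "q \<in> points A \<inter> \<phi> -` Q" for q
      using that Q by (auto simp: smooth_section_def)
    fix Q' f assume "smooth_fun B Q' f"
    then have "smooth_fun B (Q \<inter> Q') (\<lambda>q. Z q f)"
      using Q by (auto simp: smooth_section_def vimage_def)
    then have "smooth_fun A (points A \<inter> \<phi> -` (Q \<inter> Q')) ((\<lambda>q. Z q f) \<circ> \<phi>)"
      by (rule smooth_fun_compose[OF A B \<phi>])
    then show "smooth_fun A (points A \<inter> \<phi> -` Q \<inter> \<phi> -` Q') (\<lambda>p. Z (\<phi> p) f)"
      by (simp add: o_def Int_assoc)
  qed simp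
  then show ?thesis using Q p by (auto intro: smooth_section_atI)
qed

lemma smooth_section_at_differential:
  assumes A: "smooth_atlas A" and B: "smooth_atlas B" and \<phi>: "smooth_map A B \<phi>"
    and Y: "smooth_field_at A p Y"
  shows "smooth_section_at A B \<phi> p (\<lambda>q. differential B \<phi> q (Y q))"
proof -
  obtain W where W: "p \<in> W" "smooth_field A W Y" using Y by (auto simp: smooth_section_at_def)
  have "smooth_section A B \<phi> W (\<lambda>q. differential B \<phi> q (Y q))"
    unfolding smooth_section_def
  proof (intro conjI ballI allI impI)
    show "open W" and WA: "W \<subseteq> points A" using W by (auto simp: smooth_section_def)
    show "differential B \<phi> q (Y q) \<in> tangent_space B (\<phi> q)" if "q \<in> W" for q
      by (rule differential_tangent[OF A B \<phi>]) (use W that in \<open>auto simp: smooth_section_def\<close>)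
    fix Q f assume f: "smooth_fun B Q f"
    then have "smooth_fun A (W \<inter> (points A \<inter> \<phi> -` Q)) (\<lambda>q. Y q (f \<circ> \<phi>))"
      using W smooth_fun_compose[OF A B \<phi> f] by (auto simp: smooth_section_def vimage_def)
    then have "smooth_fun A (W \<inter> \<phi> -` Q) (\<lambda>q. Y q (f \<circ> \<phi>))"
      using WA by (simp add: Int_assoc[symmetric] Int_absorb2)
    then show "smooth_fun A (W \<inter> \<phi> -` Q) (\<lambda>p. differential B \<phi> p (Y p) f)"
      by (rule smooth_fun_cong[OF A]) (use f in \<open>auto simp: differential_def intro: smooth_fun_atI\<close>)
  qed
  then show ?thesis using W by (auto intro: smooth_section_atI)
qed

text \<open>Connections, metrics and curvature are specified on tangent vectors only and may be
  arbitrary elsewhere, so \<open>linear\<close> on the whole type of functionals cannot be expected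
  of them.\<close>

definition linear_on :: "'a::real_vector set \<Rightarrow> ('a \<Rightarrow> 'b::real_vector) \<Rightarrow> bool" where
  "linear_on S f \<longleftrightarrow>
     (\<forall>u\<in>S. \<forall>v\<in>S. \<forall>a b. f (a *\<^sub>R u + b *\<^sub>R v) = a *\<^sub>R f u + b *\<^sub>R f v)"

lemma
  assumes "linear_on S f" "u \<in> S"
  shows linear_on_add: "v \<in> S \<Longrightarrow> f (u + v) = f u + f v"
    and linear_on_diff: "v \<in> S \<Longrightarrow> f (u - v) = f u - f v"
    and linear_on_scale: "f (a *\<^sub>R u) = a *\<^sub>R f u"
    and linear_on_0: "f 0 = 0"
proof -
  have f: "f (a *\<^sub>R u + b *\<^sub>R v) = a *\<^sub>R f u + b *\<^sub>R f v" if "v \<in> S" for v a b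
    using assms that by (simp add: linear_on_def)
  show "v \<in> S \<Longrightarrow> f (u + v) = f u + f v" using f[of v 1 1] by simp
  show "v \<in> S \<Longrightarrow> f (u - v) = f u - f v" using f[of v 1 "-1"] by simp
  show "f (a *\<^sub>R u) = a *\<^sub>R f u" using f[of u a 0] assms(2) by simp
  show "f 0 = 0" using f[of u 0 0] assms(2) by simp
qed

lemma linear_on_sum:
  assumes "subspace S" "linear_on S f" "\<And>i. i \<in> I \<Longrightarrow> x i \<in> S"
  shows "f (\<Sum>i\<in>I. c i *\<^sub>R x i) = (\<Sum>i\<in>I. c i *\<^sub>R f (x i))"
  using assms(3)
proof (induction I rule: infinite_finite_induct)
  case (insert i I)
  have "(\<Sum>i\<in>I. c i *\<^sub>R x i) \<in> S"
    using insert.prems by (intro subspace_sum subspace_scale assms(1)) auto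
  then show ?case
    using insert linear_on_add[OF assms(2) subspace_scale[OF assms(1)], of "x i" _ "c i"]
      linear_on_scale[OF assms(2)] by simp
qed (use linear_on_0[OF assms(2) subspace_0[OF assms(1)]] in auto)

section \<open>Connections along a map; the Levi-Civita connections are the case of the identity
  map\<close>

locale connection =
  fixes A :: "('p::{t2_space,second_countable_topology}, 'a::euclidean_space) chart set"
    and B :: "('q::{t2_space,second_countable_topology}, 'b::euclidean_space) chart set"
    and \<phi> :: "'p \<Rightarrow> 'q" and D :: "('p, 'q) connection"
  assumes atlas: "smooth_atlas A" and atlas': "smooth_atlas B"
    and connection: "connection_along A B \<phi> D"
begin

lemma D_linear_on: "smooth_section_at A B \<phi> p V \<Longrightarrow> linear_on (tangent_space A p) (\<lambda>v. D p v V)"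
  using connection smooth_section_at_points[of A B \<phi> p V]
  by (auto simp: connection_along_def linear_on_def)

lemma
  assumes "smooth_section_at A B \<phi> p V" "v \<in> tangent_space A p"
  shows D_tangent: "D p v V \<in> tangent_space B (\<phi> p)"
    and D_add: "smooth_section_at A B \<phi> p V' \<Longrightarrow> D p v (\<lambda>q. V q + V' q) = D p v V + D p v V'"
    and D_scale: "smooth_fun_at A p f \<Longrightarrow>
      D p v (\<lambda>q. f q *\<^sub>R V q) = v f *\<^sub>R V p + f p *\<^sub>R D p v V"
  using connection assms smooth_section_at_points[of A B \<phi> p V]
  by (auto simp: connection_along_def)

lemma D_scale_const:
  assumes "smooth_section_at A B \<phi> p V" "v \<in> tangent_space A p"
  shows "D p v (\<lambda>q. a *\<^sub>R V q) = a *\<^sub>R D p v V"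
proof -
  have p: "p \<in> points A" using assms(1) by (rule smooth_section_at_points)
  show ?thesis
    using D_scale[OF assms smooth_fun_at_const[OF atlas p, of a]] tangent_const[OF atlas p assms(2)]
    by simp
qed

lemma D_zero:
  assumes "smooth_section_at A B \<phi> p V" "v \<in> tangent_space A p"
  shows "D p v (\<lambda>q. 0) = 0"
  using D_scale_const[OF assms, of 0] by simp

lemma D_diff:
  assumes "smooth_section_at A B \<phi> p V" "v \<in> tangent_space A p" "smooth_section_at A B \<phi> p V'"
  shows "D p v (\<lambda>q. V q - V' q) = D p v V - D p v V'"
  using D_add[OF assms(1,2) smooth_section_at_scale_const[OF atlas assms(3), of "-1"]]
    D_scale_const[OF assms(3,2), of "-1"] by simp

lemma D_sum:
  assumes "v \<in> tangent_space A p" "smooth_section_at A B \<phi> p V0"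
    "\<And>i. i \<in> I \<Longrightarrow> smooth_section_at A B \<phi> p (V i)"
  shows "D p v (\<lambda>q. \<Sum>i\<in>I. V i q) = (\<Sum>i\<in>I. D p v (V i))"
  using assms(3)
proof (induction I rule: infinite_finite_induct)
  case (insert i I)
  then show ?case
    by (simp add: D_add[OF _ assms(1)] smooth_section_at_sum[OF atlas assms(2)])
qed (use D_zero[OF assms(2,1)] in auto)

text \<open>Locality by the indicator device used for tangent vectors. \<open>ch\<close> is smooth
  near \<open>p\<close>, V - V' = ch (V - V') holds everywhere, and both terms of the product rule
  vanish because \<open>ch p = 0\<close> and \<open>V p = V' p\<close>.\<close>

lemma D_cong:
  assumes V: "smooth_section_at A B \<phi> p V" and v: "v \<in> tangent_space A p"
    and eq: "\<forall>\<^sub>F q in nhds p. V q = V' q"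
  shows "D p v V = D p v V'"
proof -
  have p: "p \<in> points A" using V by (rule smooth_section_at_points)
  have V': "smooth_section_at A B \<phi> p V'" by (rule smooth_section_at_cong[OF atlas V eq])
  define ch :: "'p \<Rightarrow> real" where "ch = (\<lambda>q. if V q = V' q then 0 else 1)"
  have ch: "smooth_fun_at A p ch"
    by (rule smooth_fun_at_cong[OF atlas smooth_fun_at_const[OF atlas p, of 0]])
      (use eq in \<open>auto simp: ch_def elim: eventually_mono\<close>)
  have p0: "V p = V' p" using eq by (rule eventually_nhds_x_imp_x)
  have "D p v V - D p v V' = D p v (\<lambda>q. V q - V' q)" by (simp add: D_diff V V' v)
  also have "(\<lambda>q. V q - V' q) = (\<lambda>q. ch q *\<^sub>R (V q - V' q))" by (auto simp: ch_def)
  also have "D p v \<dots> = 0"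
    by (subst D_scale[OF smooth_section_at_diff[OF atlas V V'] v ch]) (simp add: ch_def p0)
  finally show ?thesis by simp
qed

lemma cov_section:
  assumes "smooth_field_at A p X" "smooth_section_at A B \<phi> p V"
  shows "smooth_section_at A B \<phi> p (cov D X V)"
  using assms
proof (rule smooth_section_at_common)
  fix W assume "p \<in> W" "smooth_field A W X" "smooth_section A B \<phi> W V"
  then show ?thesis
    using connection by (auto simp: connection_along_def cov_def intro!: smooth_section_atI)
qed

end

section \<open>Riemannian manifolds\<close>

lemma lie_bracket_apply:
  "smooth_fun_at A p f \<Longrightarrow> lie_bracket A X Y p f = X p (\<lambda>q. Y q f) - Y p (\<lambda>q. X q f)"
  by (simp add: lie_bracket_def)

lemma lie_bracket_skew: "lie_bracket A X Y p = - lie_bracket A Y X p"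
  by (auto simp: lie_bracket_def fun_eq_iff uminus_apply)

lemma lie_bracket_jacobi:
  assumes A: "smooth_atlas A" and X: "smooth_field_at A p X" and Y: "smooth_field_at A p Y"
    and Z: "smooth_field_at A p Z"
  shows "lie_bracket A X (lie_bracket A Y Z) p + lie_bracket A Y (lie_bracket A Z X) p
    + lie_bracket A Z (lie_bracket A X Y) p = 0"
proof
  fix f
  show "(lie_bracket A X (lie_bracket A Y Z) p + lie_bracket A Y (lie_bracket A Z X) p
    + lie_bracket A Z (lie_bracket A X Y) p) f = 0 f"
  proof (cases "smooth_fun_at A p f")
    case f: True
    \<comment> \<open>Each nested bracket is a sum of four third-order terms; the twelve terms of
      the cyclic sum cancel in pairs.\<close>
    have expand: "lie_bracket A X (lie_bracket A Y Z) p f =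
        X p (\<lambda>q. Y q (\<lambda>r. Z r f)) - X p (\<lambda>q. Z q (\<lambda>r. Y r f))
        - (Y p (\<lambda>q. Z q (\<lambda>r. X r f)) - Z p (\<lambda>q. Y q (\<lambda>r. X r f)))"
      if X: "smooth_field_at A p X" and Y: "smooth_field_at A p Y" and Z: "smooth_field_at A p Z"
      for X Y Z
    proof -
      have v: "X p \<in> tangent_space A p" using smooth_section_at_tangent[OF X] .
      have Zf: "smooth_fun_at A p (\<lambda>q. Y q (\<lambda>r. Z r f))" "smooth_fun_at A p (\<lambda>q. Z q (\<lambda>r. Y r f))"
        "smooth_fun_at A p (\<lambda>r. X r f)"
        using X Y Z f by (auto intro: smooth_field_at_apply)
      \<comment> \<open>The bracket is the commutator on \<open>f\<close> only at points near which
        \<open>f\<close> is smooth, so the equality under \<open>X p\<close> holds near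
        \<open>p\<close> and is used through locality.\<close>
      have "X p (\<lambda>q. lie_bracket A Y Z q f) =
          X p (\<lambda>q. Y q (\<lambda>r. Z r f) + (-1) * Z q (\<lambda>r. Y r f))"
        by (rule tangent_cong[OF A v])
          (use smooth_fun_at_eventually[OF f] in \<open>auto simp: lie_bracket_apply elim: eventually_mono\<close>)
      also have "\<dots> = X p (\<lambda>q. Y q (\<lambda>r. Z r f)) + (-1) * X p (\<lambda>q. Z q (\<lambda>r. Y r f))"
        by (subst tangent_add[OF v Zf(1) smooth_fun_at_cmult[OF A Zf(2)]])
          (simp only: tangent_cmult[OF v Zf(2)])
      finally show ?thesis using f Zf(3) by (simp add: lie_bracket_apply)
    qed
    show ?thesis
      by (simp add: expand X Y Z plus_fun_apply)
  next
    case False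
    then show ?thesis by (simp add: lie_bracket_def plus_fun_apply)
  qed
qed

text \<open>The expression under the description operator of \<open>curvature\<close>, still
  evaluated on fields. Its symmetries are proved at this level and are then used to show that only
  the values of the fields at the point matter.\<close>

definition curvature_field ::
  "('p::topological_space, 'a::euclidean_space) chart set \<Rightarrow> ('p, 'p) connection \<Rightarrow>
    ('p \<Rightarrow> 'p tvec) \<Rightarrow> ('p \<Rightarrow> 'p tvec) \<Rightarrow> ('p \<Rightarrow> 'p tvec) \<Rightarrow> 'p \<Rightarrow> 'p tvec" where
  "curvature_field A nab X Y Z p =
     cov nab X (cov nab Y Z) p - cov nab Y (cov nab X Z) p - cov nab (lie_bracket A X Y) Z p"

section \<open>Levi-Civita connections: metric, bracket, orthonormal expansion and trace\<close>

locale riemannian =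
  fixes A :: "('p::{t2_space,second_countable_topology}, 'a::euclidean_space) chart set"
    and g :: "'p metric" and nab :: "('p, 'p) connection"
  assumes riemannian: "riemannian_manifold A g"
    and levi_civita: "levi_civita A g nab"

sublocale riemannian \<subseteq> connection A A "\<lambda>p. p" nab
  using riemannian levi_civita
  by unfold_locales (auto simp: riemannian_manifold_def levi_civita_def)

context riemannian
begin

lemma metric_commute:
  "p \<in> points A \<Longrightarrow> u \<in> tangent_space A p \<Longrightarrow> v \<in> tangent_space A p \<Longrightarrow> g p u v = g p v u"
  using riemannian by (auto simp: riemannian_manifold_def)

lemma metric_linear_left:
  "p \<in> points A \<Longrightarrow> w \<in> tangent_space A p \<Longrightarrow> linear_on (tangent_space A p) (\<lambda>u. g p u w)"
  using riemannian by (auto simp: riemannian_manifold_def linear_on_def)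

lemma metric_linear_right:
  assumes "p \<in> points A" "u \<in> tangent_space A p"
  shows "linear_on (tangent_space A p) (g p u)"
proof -
  have "g p u (a *\<^sub>R v + b *\<^sub>R w) = a *\<^sub>R g p u v + b *\<^sub>R g p u w"
    if "v \<in> tangent_space A p" "w \<in> tangent_space A p" for v w a b
  proof -
    have "a *\<^sub>R v + b *\<^sub>R w \<in> tangent_space A p"
      using that by (intro subspace_add subspace_scale subspace_tangent_space)
    then show ?thesis
      using metric_linear_left[OF assms] that metric_commute[OF assms(1) assms(2)]
      by (simp add: linear_on_def)
  qed
  then show ?thesis by (simp add: linear_on_def)
qed

lemma metric_nondegenerate:
  assumes "p \<in> points A" "u \<in> tangent_space A p" "\<And>w. w \<in> tangent_space A p \<Longrightarrow> g p u w = 0"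
  shows "u = 0"
  using assms riemannian by (force simp: riemannian_manifold_def)

lemma metric_eqI:
  assumes "p \<in> points A" "u \<in> tangent_space A p" "v \<in> tangent_space A p"
    "\<And>w. w \<in> tangent_space A p \<Longrightarrow> g p u w = g p v w"
  shows "u = v"
proof -
  have "u - v = 0"
    by (rule metric_nondegenerate[OF assms(1)])
      (use assms in \<open>auto intro: subspace_diff subspace_tangent_space
        simp: linear_on_diff[OF metric_linear_left[OF assms(1)]]\<close>)
  then show ?thesis by simp
qed

lemma metric_smooth_at:
  assumes "smooth_field_at A p X" "smooth_field_at A p Y"
  shows "smooth_fun_at A p (\<lambda>q. g q (X q) (Y q))"
  using assms
proof (rule smooth_section_at_common)
  fix W assume "p \<in> W" "smooth_field A W X" "smooth_field A W Y"
  then show ?thesis using riemannian by (auto simp: riemannian_manifold_def intro!: smooth_fun_atI)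
qed

lemma lie_bracket_eq:
  assumes "smooth_field_at A p X" "smooth_field_at A p Y"
  shows "lie_bracket A X Y p = nab p (X p) Y - nab p (Y p) X"
  using assms levi_civita smooth_section_at_points[OF assms(1)] by (auto simp: levi_civita_def)

text \<open>Smoothness is read off from torsion-freeness: near \<open>p\<close> the bracket is a
  difference of covariant derivatives, and the connection axioms keep these smooth.\<close>

lemma lie_bracket_field:
  assumes "smooth_field_at A p X" "smooth_field_at A p Y"
  shows "smooth_field_at A p (lie_bracket A X Y)"
proof (rule smooth_section_at_cong[OF atlas])
  show "smooth_field_at A p (\<lambda>q. cov nab X Y q - cov nab Y X q)"
    using assms by (intro smooth_section_at_diff atlas cov_section)
  show "\<forall>\<^sub>F q in nhds p. cov nab X Y q - cov nab Y X q = lie_bracket A X Y q"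
    using smooth_section_at_eventually[OF assms(1)] smooth_section_at_eventually[OF assms(2)]
    by eventually_elim (simp add: lie_bracket_eq cov_def)
qed

lemma metric_compatible:
  assumes "smooth_field_at A p X" "smooth_field_at A p Y" "v \<in> tangent_space A p"
  shows "v (\<lambda>q. g q (X q) (Y q)) = g p (nab p v X) (Y p) + g p (X p) (nab p v Y)"
  using assms levi_civita smooth_section_at_points[OF assms(1)] by (auto simp: levi_civita_def)

text \<open>The tangent vectors that satisfy the expansion form a subspace. It contains the basis,
  hence its span, hence the tangent space.\<close>

lemma orthonormal_basis_expand:
  assumes p: "p \<in> points A" and b: "orthonormal_basis A g p b" and v: "v \<in> tangent_space A p"
  shows "v = (\<Sum>i = 1..DIM('a). g p v (b i) *\<^sub>R b i)"
proof -
  let ?T = "tangent_space A p" and ?E = "\<lambda>v. \<Sum>i = 1..DIM('a). g p v (b i) *\<^sub>R b i"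
  have bT: "b i \<in> ?T" if "i \<in> {1..DIM('a)}" for i
    using b that by (auto simp: orthonormal_basis_def)
  note lin = metric_linear_left[OF p bT]
  have sub: "subspace {v \<in> ?T. v = ?E v}"
  proof (rule subspaceI)
    show "0 \<in> {v \<in> ?T. v = ?E v}"
      by (auto simp: subspace_0[OF subspace_tangent_space]
          linear_on_0[OF lin subspace_0[OF subspace_tangent_space]])
    show "x + y \<in> {v \<in> ?T. v = ?E v}" if "x \<in> {v \<in> ?T. v = ?E v}" "y \<in> {v \<in> ?T. v = ?E v}" for x y
    proof -
      have "?E (x + y) = ?E x + ?E y"
        using that by (simp add: linear_on_add[OF lin] scaleR_add_left sum.distrib)
      then show ?thesis using that by (auto intro: subspace_add subspace_tangent_space)
    qed
    show "c *\<^sub>R x \<in> {v \<in> ?T. v = ?E v}" if "x \<in> {v \<in> ?T. v = ?E v}" for x c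
    proof -
      have "?E (c *\<^sub>R x) = c *\<^sub>R ?E x"
      proof -
        have "x \<in> ?T" using that by simp
        then show ?thesis by (simp add: linear_on_scale[OF lin] scaleR_sum_right)
      qed
      also have "\<dots> = c *\<^sub>R x" using that by simp
      finally show ?thesis using that by (auto intro: subspace_scale subspace_tangent_space)
    qed
  qed
  have "b j \<in> {v \<in> ?T. v = ?E v}" if j: "j \<in> {1..DIM('a)}" for j
  proof -
    have "?E (b j) = (\<Sum>i = 1..DIM('a). if j = i then b i else 0)"
      using b j by (intro sum.cong) (auto simp: orthonormal_basis_def)
    also have "\<dots> = b j" using j by (simp add: sum.delta)
    finally show ?thesis using bT[OF j] by simp
  qed
  then have "span (b ` {1..DIM('a)}) \<subseteq> {v \<in> ?T. v = ?E v}"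
    by (intro span_minimal sub) auto
  then show ?thesis using b v by (auto simp: orthonormal_basis_def)
qed

text \<open>Shows that the description in \<open>metric_trace\<close> has a value: expanding
  \<open>b'\<close> in \<open>b\<close> turns one diagonal sum into the other, because the change of
  basis is an orthogonal matrix.\<close>

lemma metric_trace_eq:
  fixes \<beta> :: "'p tvec \<Rightarrow> 'p tvec \<Rightarrow> 'v::real_vector"
  assumes p: "p \<in> points A" and b: "orthonormal_basis A g p b"
    and left: "\<And>w. w \<in> tangent_space A p \<Longrightarrow> linear_on (tangent_space A p) (\<lambda>u. \<beta> u w)"
    and right: "\<And>u. u \<in> tangent_space A p \<Longrightarrow> linear_on (tangent_space A p) (\<beta> u)"
  shows "metric_trace A g p \<beta> = (\<Sum>i = 1..DIM('a). \<beta> (b i) (b i))"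
proof -
  let ?I = "{1..DIM('a)}"
  note T = subspace_tangent_space
  have "(\<Sum>i\<in>?I. \<beta> (b i) (b i)) = (\<Sum>i\<in>?I. \<beta> (b' i) (b' i))"
    if b': "orthonormal_basis A g p b'" for b'
  proof -
    have bT: "b i \<in> tangent_space A p" "b' i \<in> tangent_space A p" if "i \<in> ?I" for i
      using b b' that by (auto simp: orthonormal_basis_def)
    have 1: "\<beta> (b' i) (b' i) =
        (\<Sum>j\<in>?I. \<Sum>k\<in>?I. (g p (b' i) (b j) * g p (b' i) (b k)) *\<^sub>R \<beta> (b j) (b k))"
      if i: "i \<in> ?I" for i
    proof -
      have e: "b' i = (\<Sum>j\<in>?I. g p (b' i) (b j) *\<^sub>R b j)"
        using orthonormal_basis_expand[OF p b bT(2)[OF i]] .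
      have "\<beta> (b' i) (b' i) = (\<Sum>j\<in>?I. g p (b' i) (b j) *\<^sub>R \<beta> (b j) (b' i))"
        using linear_on_sum[OF T left[OF bT(2)[OF i]] bT(1), of ?I "\<lambda>j. j" "\<lambda>j. g p (b' i) (b j)"] e
        by simp
      also have "\<dots> = (\<Sum>j\<in>?I. g p (b' i) (b j) *\<^sub>R (\<Sum>k\<in>?I. g p (b' i) (b k) *\<^sub>R \<beta> (b j) (b k)))"
      proof (rule sum.cong[OF refl])
        fix j assume j: "j \<in> ?I"
        show "g p (b' i) (b j) *\<^sub>R \<beta> (b j) (b' i) =
            g p (b' i) (b j) *\<^sub>R (\<Sum>k\<in>?I. g p (b' i) (b k) *\<^sub>R \<beta> (b j) (b k))"
          using linear_on_sum[OF T right[OF bT(1)[OF j]] bT(1), of ?I "\<lambda>j. j" "\<lambda>j. g p (b' i) (b j)"] e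
          by simp
      qed
      finally show ?thesis by (simp add: scaleR_sum_right)
    qed
    \<comment> \<open>Orthogonality of the change-of-basis matrix in the other index:
      \<open>b j\<close> is expanded in \<open>b'\<close> and paired with
      \<open>b k\<close>.\<close>
    have 2: "(\<Sum>i\<in>?I. g p (b' i) (b j) * g p (b' i) (b k)) = (if j = k then 1 else 0)"
      if j: "j \<in> ?I" and k: "k \<in> ?I" for j k
    proof -
      have "g p (b j) (b k) = (\<Sum>i\<in>?I. g p (b j) (b' i) *\<^sub>R g p (b' i) (b k))"
        using linear_on_sum[OF T metric_linear_left[OF p bT(1)[OF k]] bT(2), of ?I "\<lambda>j. j"
          "\<lambda>i. g p (b j) (b' i)"] orthonormal_basis_expand[OF p b' bT(1)[OF j]]
        by simp
      also have "\<dots> = (\<Sum>i\<in>?I. g p (b' i) (b j) * g p (b' i) (b k))"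
        by (rule sum.cong) (use metric_commute[OF p bT(1)[OF j] bT(2)] in auto)
      finally show ?thesis using b j k by (auto simp: orthonormal_basis_def)
    qed
    have "(\<Sum>i\<in>?I. \<beta> (b' i) (b' i)) =
        (\<Sum>i\<in>?I. \<Sum>j\<in>?I. \<Sum>k\<in>?I. (g p (b' i) (b j) * g p (b' i) (b k)) *\<^sub>R \<beta> (b j) (b k))"
      by (rule sum.cong[OF refl 1])
    also have "\<dots> = (\<Sum>j\<in>?I. \<Sum>i\<in>?I. \<Sum>k\<in>?I. (g p (b' i) (b j) * g p (b' i) (b k)) *\<^sub>R \<beta> (b j) (b k))"
      by (rule sum.swap)
    also have "\<dots> = (\<Sum>j\<in>?I. \<Sum>k\<in>?I. \<Sum>i\<in>?I. (g p (b' i) (b j) * g p (b' i) (b k)) *\<^sub>R \<beta> (b j) (b k))"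
      by (rule sum.cong[OF refl sum.swap])
    also have "\<dots> = (\<Sum>j\<in>?I. \<Sum>k\<in>?I. (if j = k then 1 else 0) *\<^sub>R \<beta> (b j) (b k))"
    proof (rule sum.cong[OF refl], rule sum.cong[OF refl])
      fix j k assume jk: "j \<in> ?I" "k \<in> ?I"
      show "(\<Sum>i\<in>?I. (g p (b' i) (b j) * g p (b' i) (b k)) *\<^sub>R \<beta> (b j) (b k)) =
          (if j = k then 1 else 0) *\<^sub>R \<beta> (b j) (b k)"
        unfolding 2[OF jk, symmetric] by (rule scaleR_sum_left[symmetric])
    qed
    also have "\<dots> = (\<Sum>j\<in>?I. \<Sum>k\<in>?I. if j = k then \<beta> (b j) (b k) else 0)"
      by (intro sum.cong refl) simp
    also have "\<dots> = (\<Sum>j\<in>?I. \<beta> (b j) (b j))"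
      by (intro sum.cong refl) (simp add: sum.delta)
    finally show ?thesis by simp
  qed
  then show ?thesis unfolding metric_trace_def using b
    by (intro the_equality) blast+
qed

section \<open>Symmetries of the curvature on vector fields\<close>

lemma curvature_field_section:
  assumes "smooth_field_at A p X" "smooth_field_at A p Y" "smooth_field_at A p Z"
  shows "smooth_field_at A p (curvature_field A nab X Y Z)"
  unfolding curvature_field_def[abs_def]
  using assms by (intro smooth_section_at_diff atlas cov_section lie_bracket_field)

lemma curvature_field_skew:
  assumes "smooth_field_at A p X" "smooth_field_at A p Y" "smooth_field_at A p Z"
  shows "curvature_field A nab X Y Z p = - curvature_field A nab Y X Z p"
proof -
  have "nab p ((-1) *\<^sub>R lie_bracket A Y X p) Z = (-1) *\<^sub>R nab p (lie_bracket A Y X p) Z"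
    using smooth_section_at_tangent[OF lie_bracket_field[OF assms(2,1)]]
    by (rule linear_on_scale[OF D_linear_on[OF assms(3)]])
  then show ?thesis
    by (simp add: curvature_field_def cov_def lie_bracket_skew[of A X Y])
qed

text \<open>The operator X Y - Y X - [X,Y] annihilates the function g(Z,W). Evaluating it with
  metric compatibility leaves exactly the two curvature terms.\<close>

lemma curvature_field_skew_metric:
  assumes X: "smooth_field_at A p X" and Y: "smooth_field_at A p Y" and Z: "smooth_field_at A p Z"
    and W: "smooth_field_at A p W"
  shows "g p (curvature_field A nab X Y Z p) (W p) = - g p (curvature_field A nab X Y W p) (Z p)"
proof -
  have p: "p \<in> points A" using X by (rule smooth_section_at_points)
  define z where "z = (\<lambda>q. g q (Z q) (W q))"
  have zs: "smooth_fun_at A p z" unfolding z_def by (rule metric_smooth_at[OF Z W])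
  note t = smooth_section_at_tangent
  \<comment> \<open>The two terms with one derivative on each of \<open>Z\<close> and
    \<open>W\<close> are exchanged when \<open>X\<close> and \<open>Y\<close> are swapped, so they
    drop out of the commutator.\<close>
  have second: "X p (\<lambda>q. Y q z) =
      g p (cov nab X (cov nab Y Z) p) (W p) + g p (cov nab Y Z p) (cov nab X W p)
      + (g p (cov nab X Z p) (cov nab Y W p) + g p (Z p) (cov nab X (cov nab Y W) p))"
    if X: "smooth_field_at A p X" and Y: "smooth_field_at A p Y" for X Y
  proof -
    have v: "X p \<in> tangent_space A p" using t[OF X] .
    have YZ: "smooth_field_at A p (cov nab Y Z)" "smooth_field_at A p (cov nab Y W)"
      using Y Z W by (auto intro: cov_section)
    have "\<forall>\<^sub>F q in nhds p. Y q z = g q (cov nab Y Z q) (W q) + g q (Z q) (cov nab Y W q)"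
      using smooth_section_at_eventually[OF Y] smooth_section_at_eventually[OF Z]
        smooth_section_at_eventually[OF W]
    proof eventually_elim
      case (elim q)
      then show ?case using metric_compatible[of q Z W "Y q"] t[of A A "\<lambda>p. p" q Y]
        by (simp add: z_def cov_def)
    qed
    then have "X p (\<lambda>q. Y q z) =
        X p (\<lambda>q. g q (cov nab Y Z q) (W q) + g q (Z q) (cov nab Y W q))"
      by (rule tangent_cong[OF atlas v])
    also have "\<dots> = X p (\<lambda>q. g q (cov nab Y Z q) (W q)) + X p (\<lambda>q. g q (Z q) (cov nab Y W q))"
      by (rule tangent_add[OF v metric_smooth_at[OF YZ(1) W] metric_smooth_at[OF Z YZ(2)]])
    finally show ?thesis
      using metric_compatible[OF YZ(1) W v] metric_compatible[OF Z YZ(2) v] by (simp add: cov_def)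
  qed
  have br: "smooth_field_at A p (lie_bracket A X Y)" by (rule lie_bracket_field[OF X Y])
  have third: "X p (\<lambda>q. Y q z) - Y p (\<lambda>q. X q z) =
      g p (cov nab (lie_bracket A X Y) Z p) (W p) + g p (Z p) (cov nab (lie_bracket A X Y) W p)"
    using metric_compatible[OF Z W t[OF br]] lie_bracket_apply[OF zs, of X Y]
    by (simp add: z_def cov_def)
  note c = cov_section
  have T: "W p \<in> tangent_space A p" "Z p \<in> tangent_space A p" using t[OF W] t[OF Z] by auto
  have R: "cov nab X (cov nab Y V) p \<in> tangent_space A p" "cov nab Y (cov nab X V) p \<in> tangent_space A p"
     "cov nab X V p \<in> tangent_space A p" "cov nab Y V p \<in> tangent_space A p"
     "cov nab (lie_bracket A X Y) V p \<in> tangent_space A p" if "smooth_field_at A p V" for V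
    using t[OF c[OF X c[OF Y that]]] t[OF c[OF Y c[OF X that]]] t[OF c[OF X that]]
      t[OF c[OF Y that]] t[OF c[OF br that]] by simp_all
  have ex: "g p (curvature_field A nab X Y V p) w = g p (cov nab X (cov nab Y V) p) w
      - g p (cov nab Y (cov nab X V) p) w - g p (cov nab (lie_bracket A X Y) V p) w"
    if "w \<in> tangent_space A p" "smooth_field_at A p V" for w V
    using R[OF that(2)]
    by (simp add: tangent_space_diff curvature_field_def linear_on_diff[OF metric_linear_left[OF p that(1)]])
  show ?thesis
    using second[OF X Y] second[OF Y X] third ex[OF T(1) Z] ex[OF T(2) W]
      R[OF Z] R[OF W] T
    by (simp add: metric_commute[OF p])
qed

text \<open>Torsion-freeness combines the second derivatives in groups of three into nested
  brackets, and the cyclic sum becomes the Jacobi identity.\<close>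

lemma curvature_field_bianchi:
  assumes X: "smooth_field_at A p X" and Y: "smooth_field_at A p Y" and Z: "smooth_field_at A p Z"
  shows "curvature_field A nab X Y Z p + curvature_field A nab Y Z X p
    + curvature_field A nab Z X Y p = 0"
proof -
  have *: "nab p (X p) (cov nab Y Z) - nab p (X p) (cov nab Z Y) - nab p (lie_bracket A Y Z p) X =
      lie_bracket A X (lie_bracket A Y Z) p"
    if X: "smooth_field_at A p X" and Y: "smooth_field_at A p Y" and Z: "smooth_field_at A p Z"
    for X Y Z
  proof -
    have v: "X p \<in> tangent_space A p" using smooth_section_at_tangent[OF X] .
    have "nab p (X p) (cov nab Y Z) - nab p (X p) (cov nab Z Y) =
        nab p (X p) (\<lambda>q. cov nab Y Z q - cov nab Z Y q)"
      by (rule D_diff[symmetric]) (use v X Y Z in \<open>auto intro: cov_section\<close>)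
    also have "\<dots> = nab p (X p) (lie_bracket A Y Z)"
    proof (rule D_cong[OF _ v])
      show "smooth_field_at A p (\<lambda>q. cov nab Y Z q - cov nab Z Y q)"
        using Y Z by (intro smooth_section_at_diff atlas cov_section)
      show "\<forall>\<^sub>F q in nhds p. cov nab Y Z q - cov nab Z Y q = lie_bracket A Y Z q"
        using smooth_section_at_eventually[OF Y] smooth_section_at_eventually[OF Z]
        by eventually_elim (simp add: lie_bracket_eq cov_def)
    qed
    finally show ?thesis using lie_bracket_eq[OF X lie_bracket_field[OF Y Z]] by simp
  qed
  show ?thesis
    using lie_bracket_jacobi[OF atlas X Y Z] *[OF X Y Z] *[OF Y Z X] *[OF Z X Y]
    by (simp add: curvature_field_def cov_def algebra_simps)
qed

lemma curvature_field_pair: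
  assumes X: "smooth_field_at A p X" and Y: "smooth_field_at A p Y" and Z: "smooth_field_at A p Z"
    and W: "smooth_field_at A p W"
  shows "g p (curvature_field A nab X Y Z p) (W p) = g p (curvature_field A nab Z W X p) (Y p)"
proof -
  define r where "r = (\<lambda>X Y Z W. g p (curvature_field A nab X Y Z p) (W p))"
  define F where "F = {X. smooth_field_at A p X}"
  have p: "p \<in> points A" using X by (rule smooth_section_at_points)
  have RT: "curvature_field A nab X Y Z p \<in> tangent_space A p" "X p \<in> tangent_space A p"
    if "X \<in> F" "Y \<in> F" "Z \<in> F" for X Y Z
    using smooth_section_at_tangent[OF curvature_field_section[of p X Y Z]] that
      smooth_section_at_tangent[of A A "\<lambda>p. p" p X]
    by (auto simp: F_def)
  have 1: "r X Y Z W = - r Y X Z W" if f: "X \<in> F" "Y \<in> F" "Z \<in> F" "W \<in> F" for X Y Z W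
    using curvature_field_skew[of p X Y Z] f RT[of Y X Z] RT[of W W W]
      linear_on_scale[OF metric_linear_left[OF p, of "W p"] RT(1), of Y X Z "-1"]
    by (simp add: r_def F_def)
  have 2: "r X Y Z W = - r X Y W Z" if "X \<in> F" "Y \<in> F" "Z \<in> F" "W \<in> F" for X Y Z W
    using curvature_field_skew_metric[of p X Y Z W] that by (simp add: r_def F_def)
  have 3: "r X Y Z W + r Y Z X W + r Z X Y W = 0" if f: "X \<in> F" "Y \<in> F" "Z \<in> F" "W \<in> F" for X Y Z W
  proof -
    have "r X Y Z W + r Y Z X W + r Z X Y W =
        g p (curvature_field A nab X Y Z p + curvature_field A nab Y Z X p
          + curvature_field A nab Z X Y p) (W p)"
      using f RT
      by (simp add: tangent_space_add r_def linear_on_add[OF metric_linear_left[OF p]])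
    also have "\<dots> = 0"
      using curvature_field_bianchi[of p X Y Z] f RT[of W W W]
        linear_on_0[OF metric_linear_left[OF p RT(2)[of W W W]]] by (auto simp: F_def)
    finally show ?thesis .
  qed
  have f: "X \<in> F" "Y \<in> F" "Z \<in> F" "W \<in> F" using X Y Z W by (auto simp: F_def)
  \<comment> \<open>The four Bianchi identities whose arguments are the cyclic shifts of X, Y, Z, W,
    together with the two skew symmetries, form a linear system that implies the pair
    symmetry.\<close>
  have "r X Y Z W = r Z W X Y"
    using 3[OF f] 3[OF f(2,3,4,1)] 3[OF f(3,4,1,2)] 3[OF f(4,1,2,3)]
      2[OF f(2,3,4,1)] 2[OF f(3,4,2,1)] 1[OF f(4,2,3,1)] 1[OF f(4,1,3,2)] 2[OF f(1,4,3,2)]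
      1[OF f(1,3,4,2)] 2[OF f(3,1,4,2)] 1[OF f(4,1,2,3)] 2[OF f(1,2,4,3)] 2[OF f(2,4,1,3)]
    by linarith
  then show ?thesis by (simp add: r_def)
qed

end

text \<open>Without an extension of a vector the condition defining \<open>curvature\<close> would
  be vacuous and describe no value. Extensions also provide enough fields to test an equation of
  vectors against the metric. At image points they come from
  \<open>extendable_image\<close>.\<close>

definition extendable_at ::
  "('p::topological_space, 'a::euclidean_space) chart set \<Rightarrow> 'p \<Rightarrow> bool" where
  "extendable_at A p \<longleftrightarrow> (\<forall>w\<in>tangent_space A p. \<exists>W. smooth_field_at A p W \<and> W p = w)"

context riemannian
begin

text \<open>
  The pair symmetry of the curvature makes every argument tensorial, as the last one is; no frame
  near the point is needed, only extensions of tangent vectors at the point.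
\<close>

lemma curvature_field_tensorial:
  assumes ext: "extendable_at A p"
    and X: "smooth_field_at A p X" "smooth_field_at A p X'" "X p = X' p"
    and Y: "smooth_field_at A p Y" "smooth_field_at A p Y'" "Y p = Y' p"
    and Z: "smooth_field_at A p Z" "smooth_field_at A p Z'" "Z p = Z' p"
  shows "curvature_field A nab X Y Z p = curvature_field A nab X' Y' Z' p"
proof -
  have p: "p \<in> points A" using X(1) by (rule smooth_section_at_points)
  note RT = smooth_section_at_tangent[OF curvature_field_section]
  have last: "curvature_field A nab X Y Z p = curvature_field A nab X Y Z' p"
    if "smooth_field_at A p X" "smooth_field_at A p Y" "smooth_field_at A p Z"
      "smooth_field_at A p Z'" "Z p = Z' p" for X Y Z Z'
  proof (rule metric_eqI[OF p RT RT])
    fix w assume "w \<in> tangent_space A p"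
    then obtain W where W: "smooth_field_at A p W" "W p = w"
      using ext by (auto simp: extendable_at_def)
    show "g p (curvature_field A nab X Y Z p) w = g p (curvature_field A nab X Y Z' p) w"
      using curvature_field_skew_metric[OF that(1,2,3) W(1)]
        curvature_field_skew_metric[OF that(1,2,4) W(1)] that(5) W(2) by simp
  qed (use that in auto)
  have "curvature_field A nab X Y Z p = curvature_field A nab X' Y' Z p"
  proof (rule metric_eqI[OF p RT RT])
    fix w assume "w \<in> tangent_space A p"
    then obtain W where W: "smooth_field_at A p W" "W p = w"
      using ext by (auto simp: extendable_at_def)
    show "g p (curvature_field A nab X Y Z p) w = g p (curvature_field A nab X' Y' Z p) w"
      using curvature_field_pair[OF X(1) Y(1) Z(1) W(1)] curvature_field_pair[OF X(2) Y(2) Z(1) W(1)]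
        last[OF Z(1) W(1) X] Y(3) W(2) by simp
  qed (use X Y Z in auto)
  then show ?thesis using last[OF X(2) Y(2) Z] by simp
qed

lemma curvature_eq:
  assumes ext: "extendable_at A p"
    and X: "smooth_field_at A p X" and Y: "smooth_field_at A p Y" and Z: "smooth_field_at A p Z"
  shows "curvature A nab p (X p) (Y p) (Z p) = curvature_field A nab X Y Z p"
  unfolding curvature_def curvature_field_def[symmetric]
proof (rule the_equality, intro allI impI; (elim conjE)?)
  fix X' Y' Z'
  assume "smooth_field_at A p X'" "smooth_field_at A p Y'" "smooth_field_at A p Z'"
    "X' p = X p" "Y' p = Y p" "Z' p = Z p"
  then show "curvature_field A nab X Y Z p = curvature_field A nab X' Y' Z' p"
    using X Y Z by (intro curvature_field_tensorial[OF ext]) simp_all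
qed (use X Y Z in blast)

lemma
  assumes ext: "extendable_at A p" and p: "p \<in> points A"
    and T: "x \<in> tangent_space A p" "y \<in> tangent_space A p" "z \<in> tangent_space A p"
  shows curvature_tangent: "curvature A nab p x y z \<in> tangent_space A p"
    and curvature_skew: "curvature A nab p x y z = - curvature A nab p y x z"
    and curvature_skew_metric: "w \<in> tangent_space A p \<Longrightarrow>
      g p (curvature A nab p x y z) w = - g p (curvature A nab p x y w) z"
    and curvature_pair: "w \<in> tangent_space A p \<Longrightarrow>
      g p (curvature A nab p x y z) w = g p (curvature A nab p z w x) y"
proof -
  obtain X Y Z where F: "smooth_field_at A p X" "smooth_field_at A p Y" "smooth_field_at A p Z"
    and v: "X p = x" "Y p = y" "Z p = z"
    using ext T by (metis extendable_at_def)
  note c = curvature_eq[OF ext]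
  show "curvature A nab p x y z \<in> tangent_space A p"
    using smooth_section_at_tangent[OF curvature_field_section[OF F]] c[OF F] v by simp
  show "curvature A nab p x y z = - curvature A nab p y x z"
    using curvature_field_skew[OF F] c[OF F] c[OF F(2,1,3)] v by simp
  assume "w \<in> tangent_space A p"
  then obtain W where W: "smooth_field_at A p W" "W p = w"
    using ext by (auto simp: extendable_at_def)
  show "g p (curvature A nab p x y z) w = - g p (curvature A nab p x y w) z"
    using curvature_field_skew_metric[OF F W(1)] c[OF F] c[OF F(1,2) W(1)] v W(2) by simp
  show "g p (curvature A nab p x y z) w = g p (curvature A nab p z w x) y"
    using curvature_field_pair[OF F W(1)] c[OF F] c[OF F(3) W(1) F(1)] v W(2) by simp
qed

text \<open>A weak test for linearity: nondegeneracy of the metric reduces it to the scalar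
  functions g(F z, w).\<close>

lemma linear_on_metricI:
  assumes p: "p \<in> points A" and F: "\<And>z. z \<in> tangent_space A p \<Longrightarrow> F z \<in> tangent_space A p"
    and G: "\<And>w. w \<in> tangent_space A p \<Longrightarrow> linear_on (tangent_space A p) (G w)"
    and eq: "\<And>z w. z \<in> tangent_space A p \<Longrightarrow> w \<in> tangent_space A p \<Longrightarrow> g p (F z) w = G w z"
  shows "linear_on (tangent_space A p) F"
  unfolding linear_on_def
proof (intro ballI allI)
  fix u v a b assume uv: "u \<in> tangent_space A p" "v \<in> tangent_space A p"
  then have 1: "a *\<^sub>R u + b *\<^sub>R v \<in> tangent_space A p" "a *\<^sub>R F u + b *\<^sub>R F v \<in> tangent_space A p"
    using F by (auto intro: tangent_space_add tangent_space_scale)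
  show "F (a *\<^sub>R u + b *\<^sub>R v) = a *\<^sub>R F u + b *\<^sub>R F v"
  proof (rule metric_eqI[OF p F[OF 1(1)] 1(2)])
    fix w assume w: "w \<in> tangent_space A p"
    show "g p (F (a *\<^sub>R u + b *\<^sub>R v)) w = g p (a *\<^sub>R F u + b *\<^sub>R F v) w"
      using metric_linear_left[OF p w] G[OF w] eq[OF 1(1) w] eq[OF uv(1) w] eq[OF uv(2) w] uv F
      by (auto simp: linear_on_def)
  qed
qed

text \<open>The symmetries move the varying argument into the second slot of the metric, where
  linearity is known. Skewness in the last two arguments does this for the third slot, pair symmetry
  for the second, and both together for the first.\<close>

lemma
  assumes ext: "extendable_at A p" and p: "p \<in> points A"
    and T: "x \<in> tangent_space A p" "y \<in> tangent_space A p"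
  shows curvature_linear_3: "linear_on (tangent_space A p) (\<lambda>z. curvature A nab p x y z)"
    and curvature_linear_2: "linear_on (tangent_space A p) (\<lambda>z. curvature A nab p x z y)"
    and curvature_linear_1: "linear_on (tangent_space A p) (\<lambda>z. curvature A nab p z x y)"
proof -
  have neg: "linear_on S f \<Longrightarrow> linear_on S (\<lambda>z. - f z)" for S and f :: "'p tvec \<Rightarrow> real"
    by (auto simp: linear_on_def)
  note t = curvature_tangent[OF ext p] and r = metric_linear_right[OF p]
  note s34 = curvature_skew_metric[OF ext p] and pair = curvature_pair[OF ext p]
  show "linear_on (tangent_space A p) (\<lambda>z. curvature A nab p x y z)"
    by (rule linear_on_metricI[OF p _ neg[OF r] s34]) (use t T in auto)
  show "linear_on (tangent_space A p) (\<lambda>z. curvature A nab p x z y)"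
    by (rule linear_on_metricI[OF p _ r pair]) (use t T in auto)
  show "linear_on (tangent_space A p) (\<lambda>z. curvature A nab p z x y)"
  proof (rule linear_on_metricI[OF p])
    fix z w assume zw: "z \<in> tangent_space A p" "w \<in> tangent_space A p"
    have "g p (curvature A nab p z x y) w = g p (curvature A nab p y w z) x"
      by (rule pair) (use T zw in auto)
    also have "\<dots> = - g p (curvature A nab p y w x) z"
      by (rule s34) (use T zw in auto)
    finally show "g p (curvature A nab p z x y) w = - g p (curvature A nab p y w x) z" .
  qed (use t T in \<open>auto intro: neg[OF r]\<close>)
qed

end

text \<open>The last clause is locality. It is needed because a field equals its expansion in a
  frame only near the point.\<close>

definition tensorial_at ::
  "('p::topological_space, 'a::euclidean_space) chart set \<Rightarrow> 'p \<Rightarrow>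
    (('p \<Rightarrow> 'p tvec) \<Rightarrow> 'v::real_vector) \<Rightarrow> bool" where
  "tensorial_at A p F \<longleftrightarrow>
    (\<forall>X Y. smooth_field_at A p X \<and> smooth_field_at A p Y \<longrightarrow> F (\<lambda>q. X q + Y q) = F X + F Y) \<and>
    (\<forall>f X. smooth_fun_at A p f \<and> smooth_field_at A p X \<longrightarrow> F (\<lambda>q. f q *\<^sub>R X q) = f p *\<^sub>R F X) \<and>
    (\<forall>X Y. smooth_field_at A p X \<and> (\<forall>\<^sub>F q in nhds p. X q = Y q) \<longrightarrow> F X = F Y)"

locale framed = riemannian A g nab
  for A :: "('p::{t2_space,second_countable_topology}, 'a::euclidean_space) chart set" and g nab +
  fixes U :: "'p set" and e :: "nat \<Rightarrow> 'p \<Rightarrow> 'p tvec"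
  assumes frame: "orthonormal_frame A g U e"
begin

lemma frame_points: "p \<in> U \<Longrightarrow> p \<in> points A"
  and frame_basis: "p \<in> U \<Longrightarrow> orthonormal_basis A g p (\<lambda>i. e i p)"
  and frame_open: "open U"
  using frame by (auto simp: orthonormal_frame_def)

lemma frame_field: "p \<in> U \<Longrightarrow> i \<in> {1..DIM('a)} \<Longrightarrow> smooth_field_at A p (e i)"
  using frame smooth_section_atI[of A A "\<lambda>p. p" U "e i" p] by (auto simp: orthonormal_frame_def)

lemma frame_tangent: "p \<in> U \<Longrightarrow> i \<in> {1..DIM('a)} \<Longrightarrow> e i p \<in> tangent_space A p"
  using smooth_section_at_tangent[OF frame_field] .

lemma constant_extension:
  assumes "p \<in> U" "w \<in> tangent_space A p"
  shows "smooth_field_at A p (\<lambda>q. \<Sum>i = 1..DIM('a). g p w (e i p) *\<^sub>R e i q)"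
    and "(\<Sum>i = 1..DIM('a). g p w (e i p) *\<^sub>R e i p) = w"
proof -
  have "smooth_field_at A p (e 1)" by (rule frame_field[OF assms(1)]) (simp add: Suc_leI)
  then show "smooth_field_at A p (\<lambda>q. \<Sum>i = 1..DIM('a). g p w (e i p) *\<^sub>R e i q)"
    by (rule smooth_section_at_sum[OF atlas])
      (intro smooth_section_at_scale_const atlas frame_field assms)
  show "(\<Sum>i = 1..DIM('a). g p w (e i p) *\<^sub>R e i p) = w"
    using orthonormal_basis_expand[OF frame_points frame_basis assms(2)] assms(1) by simp
qed

text \<open>Near \<open>p\<close> the field is its frame expansion, whose coefficients g(X, e_i) are
  smooth; additivity and homogeneity then evaluate \<open>F\<close>. The right-hand side involves
  \<open>X\<close> only through \<open>X p\<close>, which is the point of the lemma.\<close>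

lemma tensorial_frame:
  assumes p: "p \<in> U" and F: "tensorial_at A p F" and X: "smooth_field_at A p X"
  shows "F X = (\<Sum>i = 1..DIM('a). g p (X p) (e i p) *\<^sub>R F (e i))"
proof -
  have add: "F (\<lambda>q. X q + Y q) = F X + F Y" if "smooth_field_at A p X" "smooth_field_at A p Y" for X Y
    using F that by (auto simp: tensorial_at_def)
  have scale: "F (\<lambda>q. f q *\<^sub>R X q) = f p *\<^sub>R F X" if "smooth_fun_at A p f" "smooth_field_at A p X" for f X
    using F that by (auto simp: tensorial_at_def)
  have zero: "F (\<lambda>q. 0) = 0"
    using scale[OF smooth_fun_at_const[OF atlas frame_points[OF p], of 0] X] by simp
  let ?c = "\<lambda>i q. g q (X q) (e i q)"
  have c: "smooth_field_at A p (\<lambda>q. ?c i q *\<^sub>R e i q)"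
    and c': "F (\<lambda>q. ?c i q *\<^sub>R e i q) = ?c i p *\<^sub>R F (e i)" if "i \<in> {1..DIM('a)}" for i
    using that X frame_field[OF p that]
    by (auto intro!: smooth_section_at_scale atlas metric_smooth_at scale)
  have sum: "F (\<lambda>q. \<Sum>i\<in>I. ?c i q *\<^sub>R e i q) = (\<Sum>i\<in>I. ?c i p *\<^sub>R F (e i))"
    if "finite I" "I \<subseteq> {1..DIM('a)}" for I
    using that
  proof (induction I rule: finite_induct)
    case (insert i I)
    have "smooth_field_at A p (\<lambda>q. \<Sum>i\<in>I. ?c i q *\<^sub>R e i q)"
      by (rule smooth_section_at_sum[OF atlas X]) (use insert c in auto)
    then show ?case using insert add[OF c[of i]] c'[of i] by simp
  qed (simp add: zero)
  have "\<forall>\<^sub>F q in nhds p. X q = (\<Sum>i = 1..DIM('a). ?c i q *\<^sub>R e i q)"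
    using eventually_nhds_mem[OF frame_open p] smooth_section_at_eventually[OF X]
    by eventually_elim
      (rule orthonormal_basis_expand[OF frame_points frame_basis smooth_section_at_tangent])
  then have "F X = F (\<lambda>q. \<Sum>i = 1..DIM('a). ?c i q *\<^sub>R e i q)"
    using F X by (auto simp: tensorial_at_def)
  then show ?thesis using sum[of "{1..DIM('a)}"] by simp
qed

lemma the_tensorial:
  assumes p: "p \<in> U" and F: "tensorial_at A p F" and X: "smooth_field_at A p X"
  shows "(THE z. \<forall>Y. smooth_field_at A p Y \<and> Y p = X p \<longrightarrow> z = F Y) = F X"
proof (rule the_equality)
  show "\<forall>Y. smooth_field_at A p Y \<and> Y p = X p \<longrightarrow> F X = F Y"
    using tensorial_frame[OF p F] X by auto
qed (use X in auto)

text \<open>Turns a trace of a form given by a description over extensions into a sum over the frame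
  fields themselves. It serves both the tension field and the rough Laplacian.\<close>

lemma metric_trace_tensorial:
  assumes p: "p \<in> U" and F: "\<And>v. v \<in> tangent_space A p \<Longrightarrow> tensorial_at A p (F v)"
    and lin: "\<And>Y. smooth_field_at A p Y \<Longrightarrow> linear_on (tangent_space A p) (\<lambda>v. F v Y)"
  shows "metric_trace A g p (\<lambda>v w. THE z. \<forall>Y. smooth_field_at A p Y \<and> Y p = w \<longrightarrow> z = F v Y) =
    (\<Sum>i = 1..DIM('a). F (e i p) (e i))"
proof -
  let ?\<beta> = "\<lambda>v w. THE z. \<forall>Y. smooth_field_at A p Y \<and> Y p = w \<longrightarrow> z = F v Y"
  let ?E = "\<lambda>w q. \<Sum>i = 1..DIM('a). g p w (e i p) *\<^sub>R e i q"
  \<comment> \<open>The chosen extension of \<open>w\<close> does not involve \<open>v\<close>, so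
    linearity in \<open>v\<close> can be taken from \<open>lin\<close> with a fixed field.\<close>
  have E: "?\<beta> v w = F v (?E w)" if "v \<in> tangent_space A p" "w \<in> tangent_space A p" for v w
    using the_tensorial[OF p F[OF that(1)] constant_extension(1)[OF p that(2)]]
      constant_extension(2)[OF p that(2)] by simp
  have E': "?\<beta> v w = (\<Sum>i = 1..DIM('a). g p w (e i p) *\<^sub>R F v (e i))"
    if "v \<in> tangent_space A p" "w \<in> tangent_space A p" for v w
    using tensorial_frame[OF p F[OF that(1)] constant_extension(1)[OF p that(2)]]
      constant_extension(2)[OF p that(2)] E[OF that] by simp
  note T = tangent_space_add tangent_space_scale
  have "metric_trace A g p ?\<beta> = (\<Sum>i = 1..DIM('a). ?\<beta> (e i p) (e i p))"
  proof (rule metric_trace_eq[OF frame_points[OF p] frame_basis[OF p]])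
    fix w assume w: "w \<in> tangent_space A p"
    show "linear_on (tangent_space A p) (\<lambda>u. ?\<beta> u w)"
      using lin[OF constant_extension(1)[OF p w]] E[OF _ w]
      by (simp add: linear_on_def T)
    show "linear_on (tangent_space A p) (?\<beta> w)"
      using E'[OF w] metric_linear_left[OF frame_points[OF p] frame_tangent[OF p]]
      by (simp add: linear_on_def T scaleR_add_left sum.distrib scaleR_sum_right)
  qed
  also have "\<dots> = (\<Sum>i = 1..DIM('a). F (e i p) (e i))"
    by (rule sum.cong[OF refl], rule the_tensorial[OF p F frame_field[OF p]])
      (auto intro: frame_tangent[OF p])
  finally show ?thesis .
qed

end

section \<open>Coordinate vector fields\<close>

text \<open>The partial derivative of a chart, along any vector \<open>b\<close> of the model space.
  The value 0 on functions that are not smooth near \<open>q\<close> is what membership in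
  \<open>tangent_space\<close> requires.\<close>

definition coordinate_field ::
  "('p::topological_space, 'a::euclidean_space) chart set \<Rightarrow> ('p, 'a) chart \<Rightarrow> 'a \<Rightarrow> 'p \<Rightarrow> 'p tvec" where
  "coordinate_field A c b q =
    (\<lambda>f. if smooth_fun_at A q f then frechet_derivative (f \<circ> chart_inv c) (at (snd c q)) b else 0)"

lemma smooth_fun_at_chart_derivative:
  assumes "c \<in> A" "q \<in> fst c" "smooth_fun_at A q f"
  shows "(f \<circ> chart_inv c has_derivative frechet_derivative (f \<circ> chart_inv c) (at (snd c q)))
    (at (snd c q))"
proof -
  obtain W where "q \<in> W" "smooth_fun A W f" using assms by (auto simp: smooth_fun_at_def)
  then have "(f \<circ> chart_inv c) differentiable (at (snd c q))"
    using assms(1,2)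
    by (intro smooth_euclidean_differentiable[of "snd c ` (fst c \<inter> W)"]) (auto simp: smooth_fun_def)
  then show ?thesis by (simp add: frechet_derivative_works)
qed

lemma coordinate_field_tangent:
  assumes A: "smooth_atlas A" and c: "c \<in> A" and q: "q \<in> fst c"
  shows "coordinate_field A c b q \<in> tangent_space A q"
proof -
  note d = smooth_fun_at_chart_derivative[OF c q]
  let ?d = "\<lambda>f. frechet_derivative (f \<circ> chart_inv c) (at (snd c q)) b"
  have add: "?d (\<lambda>q. f q + f' q) = ?d f + ?d f'"
    and mult: "?d (\<lambda>q. f q * f' q) = ?d f * f' q + f q * ?d f'"
    and cmult: "?d (\<lambda>q. a * f q) = a * ?d f"
    if f: "smooth_fun_at A q f" "smooth_fun_at A q f'" for f f' :: "'a \<Rightarrow> real" and a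
  proof -
    show "?d (\<lambda>q. f q + f' q) = ?d f + ?d f'"
      using frechet_derivative_at[OF has_derivative_add[OF d[OF f(1)] d[OF f(2)]], symmetric]
      by (simp add: o_def)
    show "?d (\<lambda>q. f q * f' q) = ?d f * f' q + f q * ?d f'"
      using frechet_derivative_at[OF has_derivative_mult[OF d[OF f(1)] d[OF f(2)]], symmetric]
      by (simp add: o_def chart_inv_apply[OF A c q])
    show "?d (\<lambda>q. a * f q) = a * ?d f"
      using frechet_derivative_at[OF has_derivative_mult_right[OF d[OF f(1)], of a], symmetric]
      by (simp add: o_def)
  qed
  then show ?thesis
    by (auto simp: tangent_space_def coordinate_field_def
        smooth_fun_at_add[OF A] smooth_fun_at_mult[OF A] smooth_fun_at_cmult[OF A])
qed

lemma coordinate_field_smooth: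
  assumes A: "smooth_atlas A" and c: "c \<in> A"
  shows "smooth_field A (fst c) (coordinate_field A c b)"
  unfolding smooth_section_def
proof (intro conjI ballI allI impI)
  show "open (fst c)" "fst c \<subseteq> points A" using chart_open[OF A c] chart_subset_points[OF c] by simp_all
  show "coordinate_field A c b p \<in> tangent_space A p" if "p \<in> fst c" for p
    by (rule coordinate_field_tangent[OF A c that])
  fix Q f assume f: "smooth_fun A Q f"
  let ?h = "\<lambda>x. frechet_derivative (f \<circ> chart_inv c) (at x) b"
  have o: "open (fst c \<inter> Q)" using f chart_open[OF A c] by (auto simp: smooth_fun_def)
  have "smooth_fun A (fst c \<inter> Q) (\<lambda>q. ?h (snd c q))"
    unfolding smooth_fun_def
  proof (intro conjI ballI)
    show "open (fst c \<inter> Q)" by (rule o)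
    show "fst c \<inter> Q \<subseteq> points A" using chart_subset_points[OF c] by auto
    fix d assume d: "d \<in> A"
    let ?S = "snd d ` (fst d \<inter> (fst c \<inter> Q))"
    have S: "open ?S" by (rule chart_image_open[OF A d o])
    have "smooth_euclidean (snd d ` (fst d \<inter> fst c)) (snd c \<circ> chart_inv d)"
      using A c d unfolding smooth_atlas_def by blast
    then have 1: "smooth_euclidean ?S (snd c \<circ> chart_inv d)"
      by (rule smooth_euclidean_subset) auto
    have "smooth_euclidean (snd c ` (fst c \<inter> Q)) (f \<circ> chart_inv c)"
      using f c unfolding smooth_fun_def by blast
    then have 2: "smooth_euclidean (snd c ` (fst c \<inter> Q)) ?h"
      by (rule smooth_euclidean_derivative)
    have "(snd c \<circ> chart_inv d) ` ?S \<subseteq> snd c ` (fst c \<inter> Q)"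
      by (auto simp: chart_inv_apply[OF A d])
    from smooth_euclidean_compose[OF S 1 2 this]
    show "smooth_euclidean ?S ((\<lambda>q. ?h (snd c q)) \<circ> chart_inv d)" by (simp add: o_def)
  qed
  then show "smooth_fun A (fst c \<inter> (\<lambda>p. p) -` Q) (\<lambda>p. coordinate_field A c b p f)"
    by (simp add: vimage_def, elim smooth_fun_cong[OF A])
      (use f in \<open>auto simp: coordinate_field_def intro: smooth_fun_atI\<close>)
qed

lemma smooth_fun_at_coordinate:
  "smooth_atlas A \<Longrightarrow> c \<in> A \<Longrightarrow> q \<in> fst c \<Longrightarrow> smooth_fun_at A q (\<lambda>q. snd c q \<bullet> b)"
  by (auto intro: smooth_fun_atI smooth_fun_coordinate)

lemma coordinate_field_coordinate:
  assumes A: "smooth_atlas A" and c: "c \<in> A" and q: "q \<in> fst c"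
  shows "coordinate_field A c b q (\<lambda>q. snd c q \<bullet> b') = b \<bullet> b'"
proof -
  have o: "open (snd c ` fst c)" using chart_image_open[OF A c chart_open[OF A c]] by simp
  have "frechet_derivative ((\<lambda>q. snd c q \<bullet> b') \<circ> chart_inv c) (at (snd c q)) =
      frechet_derivative (\<lambda>x. x \<bullet> b') (at (snd c q))"
    by (rule frechet_derivative_cong_open[OF o]) (use q in \<open>auto simp: chart_inv_apply[OF A c]\<close>)
  also have "\<dots> = (\<lambda>x. x \<bullet> b')"
    by (rule frechet_derivative_at[symmetric])
      (rule bounded_linear_imp_has_derivative[OF bounded_linear_inner_left])
  finally show ?thesis by (simp add: coordinate_field_def smooth_fun_at_coordinate[OF A c q])
qed

lemma sum_scaleR_fun_apply: "(\<Sum>i\<in>I. a i *\<^sub>R f i) x = (\<Sum>i\<in>I. a i *\<^sub>R f i x)"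
  by (induction I rule: infinite_finite_induct) (auto simp: plus_fun_apply scaleR_fun_def)

text \<open>
  That the coordinate fields span the tangent spaces is obtained from an a priori bound on the
  dimension, which a submersion onto the manifold provides; this avoids Taylor's formula.
\<close>

lemma coordinate_expand:
  fixes A :: "('p::{t2_space,second_countable_topology}, 'a::euclidean_space) chart set"
  assumes A: "smooth_atlas A" and c: "c \<in> A" and q: "q \<in> fst c"
    and S: "finite S" "card S \<le> DIM('a)" "tangent_space A q \<subseteq> span S"
    and v: "v \<in> tangent_space A q"
  shows "v = (\<Sum>b\<in>Basis. v (\<lambda>q. snd c q \<bullet> b) *\<^sub>R coordinate_field A c b q)"
proof -
  let ?E = "\<lambda>b. coordinate_field A c b q" and ?y = "\<lambda>b q. snd c q \<bullet> b"
  have Ey: "?E b (?y b') = (if b = b' then 1 else 0)" if "b \<in> Basis" "b' \<in> Basis" for b b'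
    using that by (simp add: coordinate_field_coordinate[OF A c q] inner_Basis)
  have inj: "inj_on ?E Basis"
  proof (rule inj_onI)
    fix b b' :: 'a assume b: "b \<in> Basis" "b' \<in> Basis" "?E b = ?E b'"
    then have "?E b (?y b) = ?E b' (?y b)" by simp
    then show "b = b'" using b(1,2) Ey by (auto split: if_splits)
  qed
  have ind: "independent (?E ` Basis)"
  proof
    assume "dependent (?E ` Basis)"
    then obtain u b where u: "b \<in> Basis" "u (?E b) \<noteq> 0" "(\<Sum>v\<in>?E ` Basis. u v *\<^sub>R v) = 0"
      by (auto simp: dependent_finite)
    have "0 = (\<Sum>b'\<in>Basis. u (?E b') *\<^sub>R ?E b') (?y b)"
      using u(3) by (simp add: sum.reindex[OF inj] o_def)
    also have "\<dots> = (\<Sum>b'\<in>Basis. if b' = b then u (?E b') else 0)"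
      unfolding sum_scaleR_fun_apply by (rule sum.cong) (use u(1) Ey in auto)
    also have "\<dots> = u (?E b)" using u(1) by simp
    finally show False using u(2) by simp
  qed
  \<comment> \<open>Otherwise \<open>v\<close> and the coordinate fields would be
    \<open>DIM('a) + 1\<close> independent vectors in a span of at most \<open>DIM('a)\<close>
    vectors.\<close>
  have "v \<in> span (?E ` Basis)"
  proof (rule ccontr)
    assume not: "v \<notin> span (?E ` Basis)"
    then have "independent (insert v (?E ` Basis))"
      using ind by (simp add: independent_insert)
    moreover have "insert v (?E ` Basis) \<subseteq> span S"
      using S(3) v coordinate_field_tangent[OF A c q] by auto
    ultimately have "card (insert v (?E ` Basis)) \<le> card S"
      using independent_span_bound[OF S(1)] by blast
    moreover have "v \<notin> ?E ` Basis" using not span_base[of v "?E ` Basis"] by blast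
    ultimately show False using S(2) by (simp add: card_image[OF inj])
  qed
  moreover have "span (?E ` Basis) \<subseteq> {v. v = (\<Sum>b\<in>Basis. v (?y b) *\<^sub>R ?E b)}"
  proof (rule span_minimal)
    show "?E ` Basis \<subseteq> {v. v = (\<Sum>b\<in>Basis. v (?y b) *\<^sub>R ?E b)}"
    proof clarify
      fix b' :: 'a assume b': "b' \<in> Basis"
      have "(\<Sum>b\<in>Basis. ?E b' (?y b) *\<^sub>R ?E b) = (\<Sum>b\<in>Basis. if b' = b then ?E b else 0)"
        by (rule sum.cong) (use b' Ey in auto)
      also have "\<dots> = ?E b'" using b' by simp
      finally show "?E b' = (\<Sum>b\<in>Basis. ?E b' (?y b) *\<^sub>R ?E b)" by simp
    qed
    show "subspace {v. v = (\<Sum>b\<in>Basis. v (?y b) *\<^sub>R ?E b)}"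
    proof (rule subspaceI; unfold mem_Collect_eq)
      show "0 = (\<Sum>b\<in>Basis. 0 (?y b) *\<^sub>R ?E b)" by simp
    next
      fix x y
      assume xy: "x = (\<Sum>b\<in>Basis. x (?y b) *\<^sub>R ?E b)" "y = (\<Sum>b\<in>Basis. y (?y b) *\<^sub>R ?E b)"
      have "(\<Sum>b\<in>Basis. (x + y) (?y b) *\<^sub>R ?E b) =
          (\<Sum>b\<in>Basis. x (?y b) *\<^sub>R ?E b) + (\<Sum>b\<in>Basis. y (?y b) *\<^sub>R ?E b)"
        by (simp only: plus_fun_apply scaleR_add_left sum.distrib)
      also have "\<dots> = x + y" by (simp only: xy[symmetric])
      finally show "x + y = (\<Sum>b\<in>Basis. (x + y) (?y b) *\<^sub>R ?E b)" ..
    next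
      fix a x
      assume x: "x = (\<Sum>b\<in>Basis. x (?y b) *\<^sub>R ?E b)"
      have "(\<Sum>b\<in>Basis. (a *\<^sub>R x) (?y b) *\<^sub>R ?E b) = a *\<^sub>R (\<Sum>b\<in>Basis. x (?y b) *\<^sub>R ?E b)"
        by (simp only: scaleR_fun_def[of a x] scaleR_sum_right scaleR_scaleR real_scaleR_def)
      also have "\<dots> = a *\<^sub>R x" by (simp only: x[symmetric])
      finally show "a *\<^sub>R x = (\<Sum>b\<in>Basis. (a *\<^sub>R x) (?y b) *\<^sub>R ?E b)" ..
    qed
  qed
  ultimately show ?thesis by auto
qed

section \<open>Riemannian submersions\<close>

lemma (in riemannian) metric_definite:
  assumes "p \<in> points A" "v \<in> tangent_space A p" "g p v v = 0"
  shows "v = 0"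
proof (rule ccontr)
  assume "v \<noteq> 0"
  then have "g p v v > 0"
    using riemannian assms(1,2) unfolding riemannian_manifold_def by blast
  then show False using assms(3) by simp
qed

section \<open>Set-up: a Riemannian submersion with an adapted orthonormal frame\<close>

locale submersion = M: framed A g nabM U e + N: riemannian B h nabN
  for A :: "('p::{t2_space,second_countable_topology}, 'a::euclidean_space) chart set"
    and g nabM U e
    and B :: "('q::{t2_space,second_countable_topology}, 'b::euclidean_space) chart set"
    and h nabN +
  fixes \<phi> :: "'p \<Rightarrow> 'q" and D :: "('p, 'q) connection"
  assumes submersion: "riemannian_submersion A g B h \<phi>"
    and pullback: "pullback_connection A B \<phi> nabN D"
    and dim: "DIM('b) < DIM('a)"
    and frame_horizontal: "\<And>i p. i \<in> {1..DIM('b)} \<Longrightarrow> p \<in> U \<Longrightarrow> e i p \<in> horizontal_space A g B \<phi> p"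
    and frame_vertical: "\<And>s p. s \<in> {DIM('b)+1..DIM('a)} \<Longrightarrow> p \<in> U \<Longrightarrow> e s p \<in> vertical_space A B \<phi> p"

sublocale submersion \<subseteq> connection A B \<phi> D
  using pullback M.atlas N.atlas by unfold_locales (auto simp: pullback_connection_def)

context submersion
begin

abbreviation d\<phi> :: "'p \<Rightarrow> 'p tvec \<Rightarrow> 'q tvec" where
  "d\<phi> \<equiv> differential B \<phi>"

lemma smooth: "smooth_map A B \<phi>"
  using submersion by (auto simp: riemannian_submersion_def)

lemma image_points: "p \<in> points A \<Longrightarrow> \<phi> p \<in> points B"
  using smooth by (auto simp: smooth_map_def)

lemma differential_in_tangent:
  "p \<in> points A \<Longrightarrow> v \<in> tangent_space A p \<Longrightarrow> d\<phi> p v \<in> tangent_space B (\<phi> p)"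
  by (rule differential_tangent[OF atlas atlas' smooth])

lemma differential_section:
  "smooth_field_at A p Y \<Longrightarrow> smooth_section_at A B \<phi> p (\<lambda>q. d\<phi> q (Y q))"
  by (rule smooth_section_at_differential[OF atlas atlas' smooth])

text \<open>The only link between \<open>D\<close> and the connection of the target.
  \<open>D_expand\<close> reduces general sections to it.\<close>

lemma D_field_compose:
  "p \<in> points A \<Longrightarrow> v \<in> tangent_space A p \<Longrightarrow> smooth_field_at B (\<phi> p) Z \<Longrightarrow>
    D p v (\<lambda>q. Z (\<phi> q)) = nabN (\<phi> p) (d\<phi> p v) Z"
  using pullback by (auto simp: pullback_connection_def)

section \<open>The vertical and horizontal distributions\<close>

lemma subspace_vertical: "subspace (vertical_space A B \<phi> p)"
  by (rule subspaceI)
    (auto simp: vertical_space_def tangent_space_zero tangent_space_add tangent_space_scale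
      linear_0[OF linear_differential] linear_add[OF linear_differential]
      linear_scale[OF linear_differential])

lemma subspace_horizontal:
  assumes p: "p \<in> points A"
  shows "subspace (horizontal_space A g B \<phi> p)"
proof (rule subspaceI)
  have lin: "linear_on (tangent_space A p) (g p u)" if "u \<in> vertical_space A B \<phi> p" for u
    using that by (intro M.metric_linear_right p) (auto simp: vertical_space_def)
  show "0 \<in> horizontal_space A g B \<phi> p"
    using linear_on_0[OF lin tangent_space_zero]
    by (auto simp: horizontal_space_def tangent_space_zero)
  show "x + y \<in> horizontal_space A g B \<phi> p"
    if "x \<in> horizontal_space A g B \<phi> p" "y \<in> horizontal_space A g B \<phi> p" for x y
    using that linear_on_add[OF lin, of _ x y]
    by (auto simp: horizontal_space_def tangent_space_add)
  show "c *\<^sub>R x \<in> horizontal_space A g B \<phi> p" if "x \<in> horizontal_space A g B \<phi> p" for c x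
    using that linear_on_scale[OF lin, of _ x c]
    by (auto simp: horizontal_space_def tangent_space_scale)
qed

lemma vertical_tangent: "v \<in> vertical_space A B \<phi> p \<Longrightarrow> v \<in> tangent_space A p"
  and horizontal_tangent: "w \<in> horizontal_space A g B \<phi> p \<Longrightarrow> w \<in> tangent_space A p"
  and differential_vertical: "v \<in> vertical_space A B \<phi> p \<Longrightarrow> d\<phi> p v = 0"
  and vertical_horizontal: "v \<in> vertical_space A B \<phi> p \<Longrightarrow> w \<in> horizontal_space A g B \<phi> p \<Longrightarrow> g p v w = 0"
  by (auto simp: vertical_space_def horizontal_space_def)

lemma horizontal_vertical_zero:
  assumes "p \<in> points A" "v \<in> vertical_space A B \<phi> p" "v \<in> horizontal_space A g B \<phi> p"
  shows "v = 0"
  by (rule M.metric_definite[OF assms(1) vertical_tangent[OF assms(2)]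
        vertical_horizontal[OF assms(2,3)]])

lemma split_sum: "(\<Sum>i = 1..DIM('a). f i) = (\<Sum>i = 1..DIM('b). f i) + (\<Sum>i = DIM('b)+1..DIM('a). f i)"
  for f :: "nat \<Rightarrow> 'v::comm_monoid_add"
  using sum.ub_add_nat[of 1 "DIM('b)" f "DIM('a) - DIM('b)"] dim by simp

text \<open>The adapted frame supplies the orthogonal splitting explicitly. Since its coefficients
  are smooth functions along smooth fields, horizontal and vertical parts of smooth fields are
  smooth.\<close>

lemma frame_parts:
  assumes p: "p \<in> U" and v: "v \<in> tangent_space A p"
  shows "v = (\<Sum>i = 1..DIM('b). g p v (e i p) *\<^sub>R e i p) + (\<Sum>s = DIM('b)+1..DIM('a). g p v (e s p) *\<^sub>R e s p)"
    and "(\<Sum>i = 1..DIM('b). g p v (e i p) *\<^sub>R e i p) \<in> horizontal_space A g B \<phi> p"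
    and "(\<Sum>s = DIM('b)+1..DIM('a). g p v (e s p) *\<^sub>R e s p) \<in> vertical_space A B \<phi> p"
proof -
  show "v = (\<Sum>i = 1..DIM('b). g p v (e i p) *\<^sub>R e i p) + (\<Sum>s = DIM('b)+1..DIM('a). g p v (e s p) *\<^sub>R e s p)"
    using M.orthonormal_basis_expand[OF M.frame_points[OF p] M.frame_basis[OF p] v]
    by (simp only: split_sum)
  show "(\<Sum>i = 1..DIM('b). g p v (e i p) *\<^sub>R e i p) \<in> horizontal_space A g B \<phi> p"
    by (intro subspace_sum subspace_scale subspace_horizontal M.frame_points p frame_horizontal)
  show "(\<Sum>s = DIM('b)+1..DIM('a). g p v (e s p) *\<^sub>R e s p) \<in> vertical_space A B \<phi> p"
    by (intro subspace_sum subspace_scale subspace_vertical p frame_vertical)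
qed

lemma horizontal_part_eqI:
  assumes "p \<in> points A" "v \<in> horizontal_space A g B \<phi> p" "X p - v \<in> vertical_space A B \<phi> p"
  shows "horizontal_part A g B \<phi> X p = v"
  unfolding horizontal_part_def
proof (rule the_equality)
  fix w assume w: "w \<in> horizontal_space A g B \<phi> p \<and> X p - w \<in> vertical_space A B \<phi> p"
  have "w - v \<in> horizontal_space A g B \<phi> p"
    by (rule subspace_diff[OF subspace_horizontal]) (use w assms in auto)
  moreover have "(X p - v) - (X p - w) \<in> vertical_space A B \<phi> p"
    by (rule subspace_diff[OF subspace_vertical]) (use w assms in auto)
  ultimately show "w = v" using horizontal_vertical_zero[OF assms(1), of "w - v"] by simp
qed (use assms in auto)

lemma vertical_part_eqI:
  assumes "p \<in> points A" "v \<in> vertical_space A B \<phi> p" "X p - v \<in> horizontal_space A g B \<phi> p"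
  shows "vertical_part A g B \<phi> X p = v"
  unfolding vertical_part_def
proof (rule the_equality)
  fix w assume w: "w \<in> vertical_space A B \<phi> p \<and> X p - w \<in> horizontal_space A g B \<phi> p"
  have "w - v \<in> vertical_space A B \<phi> p"
    by (rule subspace_diff[OF subspace_vertical]) (use w assms in auto)
  moreover have "(X p - v) - (X p - w) \<in> horizontal_space A g B \<phi> p"
    by (rule subspace_diff[OF subspace_horizontal]) (use w assms in auto)
  ultimately show "w = v" using horizontal_vertical_zero[OF assms(1), of "w - v"] by simp
qed (use assms in auto)

lemma
  assumes p: "p \<in> U" and X: "X p \<in> tangent_space A p"
  shows horizontal_part_frame:
      "horizontal_part A g B \<phi> X p = (\<Sum>i = 1..DIM('b). g p (X p) (e i p) *\<^sub>R e i p)"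
    and vertical_part_frame:
      "vertical_part A g B \<phi> X p = (\<Sum>s = DIM('b)+1..DIM('a). g p (X p) (e s p) *\<^sub>R e s p)"
    and horizontal_part_horizontal: "horizontal_part A g B \<phi> X p \<in> horizontal_space A g B \<phi> p"
    and vertical_part_vertical: "vertical_part A g B \<phi> X p \<in> vertical_space A B \<phi> p"
    and horizontal_vertical_part: "horizontal_part A g B \<phi> X p + vertical_part A g B \<phi> X p = X p"
    and differential_horizontal_part: "d\<phi> p (horizontal_part A g B \<phi> X p) = d\<phi> p (X p)"
proof -
  let ?H = "\<Sum>i = 1..DIM('b). g p (X p) (e i p) *\<^sub>R e i p"
    and ?V = "\<Sum>s = DIM('b)+1..DIM('a). g p (X p) (e s p) *\<^sub>R e s p"
  note f = frame_parts[OF p X]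
  have "a - b = c \<and> a - c = b" if "a = b + c" for a b c :: "'p tvec" using that by simp
  from this[OF f(1)] have sub: "X p - ?H = ?V" "X p - ?V = ?H" by blast+
  show H: "horizontal_part A g B \<phi> X p = ?H"
    by (rule horizontal_part_eqI[OF M.frame_points[OF p] f(2)]) (use sub f(3) in simp)
  show V: "vertical_part A g B \<phi> X p = ?V"
    by (rule vertical_part_eqI[OF M.frame_points[OF p] f(3)]) (use sub f(2) in simp)
  show "horizontal_part A g B \<phi> X p \<in> horizontal_space A g B \<phi> p"
    "vertical_part A g B \<phi> X p \<in> vertical_space A B \<phi> p"
    unfolding H V by (rule f)+
  show "horizontal_part A g B \<phi> X p + vertical_part A g B \<phi> X p = X p"
    unfolding H V by (rule f(1)[symmetric])
  have "d\<phi> p (X p - ?H) = 0" unfolding sub by (rule differential_vertical[OF f(3)])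
  then show "d\<phi> p (horizontal_part A g B \<phi> X p) = d\<phi> p (X p)"
    unfolding H by (simp add: linear_diff[OF linear_differential])
qed

lemma
  assumes p: "p \<in> U" and X: "smooth_field_at A p X"
  shows horizontal_part_field: "smooth_field_at A p (horizontal_part A g B \<phi> X)"
    and vertical_part_field: "smooth_field_at A p (vertical_part A g B \<phi> X)"
proof -
  have ev: "\<forall>\<^sub>F q in nhds p. q \<in> U \<and> X q \<in> tangent_space A q"
    using eventually_nhds_mem[OF M.frame_open p] smooth_section_at_eventually[OF X]
    by eventually_elim (use smooth_section_at_tangent in blast)
  have tm: "smooth_field_at A p (\<lambda>q. g q (X q) (e i q) *\<^sub>R e i q)" if "i \<in> {1..DIM('a)}" for i
    using that by (intro smooth_section_at_scale atlas M.metric_smooth_at X M.frame_field p)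
  have "smooth_field_at A p (\<lambda>q. \<Sum>i = 1..DIM('b). g q (X q) (e i q) *\<^sub>R e i q)"
    by (rule smooth_section_at_sum[OF atlas X]) (use dim in \<open>auto intro: tm\<close>)
  then show "smooth_field_at A p (horizontal_part A g B \<phi> X)"
    by (rule smooth_section_at_cong[OF atlas])
      (use ev p in \<open>auto elim!: eventually_mono simp: horizontal_part_frame\<close>)
  have "smooth_field_at A p (\<lambda>q. \<Sum>s = DIM('b)+1..DIM('a). g q (X q) (e s q) *\<^sub>R e s q)"
    by (rule smooth_section_at_sum[OF atlas X]) (auto intro: tm)
  then show "smooth_field_at A p (vertical_part A g B \<phi> X)"
    by (rule smooth_section_at_cong[OF atlas])
      (use ev p in \<open>auto elim!: eventually_mono simp: vertical_part_frame\<close>)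
qed

text \<open>The isometry condition with only one horizontal argument: the vertical part of
  \<open>u\<close> is killed by the differential on the left and orthogonal to \<open>w\<close> on
  the right. This form is applied to covariant derivatives, which need not be horizontal.\<close>

lemma metric_horizontal:
  assumes p: "p \<in> U" and u: "u \<in> tangent_space A p" and w: "w \<in> horizontal_space A g B \<phi> p"
  shows "h (\<phi> p) (d\<phi> p u) (d\<phi> p w) = g p u w"
proof -
  let ?H = "\<Sum>i = 1..DIM('b). g p u (e i p) *\<^sub>R e i p"
    and ?V = "\<Sum>s = DIM('b)+1..DIM('a). g p u (e s p) *\<^sub>R e s p"
  note f = frame_parts[OF p u]
  have "d\<phi> p u = d\<phi> p ?H"
    by (subst f(1)) (simp only: linear_add[OF linear_differential] differential_vertical[OF f(3)] add_0_right)
  moreover have "g p u w = g p ?H w + g p ?V w"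
    by (subst f(1)) (rule linear_on_add[OF M.metric_linear_left[OF M.frame_points[OF p]
        horizontal_tangent[OF w]] horizontal_tangent[OF f(2)] vertical_tangent[OF f(3)]])
  then have "g p u w = g p ?H w" by (simp only: vertical_horizontal[OF f(3) w] add_0_right)
  ultimately show ?thesis
    using submersion M.frame_points[OF p] f(2) w by (auto simp: riemannian_submersion_def)
qed

text \<open>Has three uses: the dimension bound that makes coordinate fields span, the basis in
  which the Ricci trace is computed, and enough test vectors in \<open>D_horizontal\<close>.\<close>

lemma image_basis:
  assumes p: "p \<in> U"
  shows "orthonormal_basis B h (\<phi> p) (\<lambda>i. d\<phi> p (e i p))"
  unfolding orthonormal_basis_def
proof (intro conjI ballI subsetI)
  have ba: "i \<in> {1..DIM('a)}" if "i \<in> {1..DIM('b)}" for i using that dim by auto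
  show "d\<phi> p (e i p) \<in> tangent_space B (\<phi> p)" if "i \<in> {1..DIM('b)}" for i
    by (intro differential_in_tangent M.frame_points M.frame_tangent p ba that)
  show "h (\<phi> p) (d\<phi> p (e i p)) (d\<phi> p (e j p)) = (if i = j then 1 else 0)"
    if ij: "i \<in> {1..DIM('b)}" "j \<in> {1..DIM('b)}" for i j
    using metric_horizontal[OF p M.frame_tangent[OF p ba[OF ij(1)]] frame_horizontal[OF ij(2) p]]
      M.frame_basis[OF p] ba[OF ij(1)] ba[OF ij(2)]
    by (auto simp: orthonormal_basis_def)
  fix w assume "w \<in> tangent_space B (\<phi> p)"
  moreover have "d\<phi> p ` tangent_space A p = tangent_space B (\<phi> p)"
    using submersion M.frame_points[OF p] by (auto simp: riemannian_submersion_def)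
  ultimately obtain v where v: "v \<in> tangent_space A p" "w = d\<phi> p v" by blast
  note f = frame_parts[OF p v(1)]
  have "w = d\<phi> p (\<Sum>i = 1..DIM('b). g p v (e i p) *\<^sub>R e i p)"
    unfolding v(2)
    by (subst f(1)) (simp only: linear_add[OF linear_differential] differential_vertical[OF f(3)] add_0_right)
  also have "\<dots> = (\<Sum>i = 1..DIM('b). g p v (e i p) *\<^sub>R d\<phi> p (e i p))"
    by (simp add: linear_sum[OF linear_differential] linear_scale[OF linear_differential])
  also have "\<dots> \<in> span ((\<lambda>i. d\<phi> p (e i p)) ` {1..DIM('b)})"
    by (intro span_sum span_scale span_base) auto
  finally show "w \<in> span ((\<lambda>i. d\<phi> p (e i p)) ` {1..DIM('b)})" .
qed

section \<open>The pull-back connection in coordinates of the target\<close>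

lemma image_coordinate_expand:
  assumes p: "p \<in> U" and c: "c \<in> B" "\<phi> p \<in> fst c" and v: "v \<in> tangent_space B (\<phi> p)"
  shows "v = (\<Sum>b\<in>Basis. v (\<lambda>q. snd c q \<bullet> b) *\<^sub>R coordinate_field B c b (\<phi> p))"
proof (rule coordinate_expand[OF atlas' c, of "(\<lambda>i. d\<phi> p (e i p)) ` {1..DIM('b)}"])
  show "card ((\<lambda>i. d\<phi> p (e i p)) ` {1..DIM('b)}) \<le> DIM('b)"
    using card_image_le[of "{1..DIM('b)}"] by fastforce
  show "tangent_space B (\<phi> p) \<subseteq> span ((\<lambda>i. d\<phi> p (e i p)) ` {1..DIM('b)})"
    using image_basis[OF p] by (simp add: orthonormal_basis_def)
qed (use v in auto)

lemma chart_at_image: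
  assumes "p \<in> points A"
  obtains c where "c \<in> B" "\<phi> p \<in> fst c"
  using image_points[OF assms] by (auto simp: points_def)

lemma coordinate_field_at: "c \<in> B \<Longrightarrow> q \<in> fst c \<Longrightarrow> smooth_field_at B q (coordinate_field B c b)"
  by (rule smooth_section_atI[OF coordinate_field_smooth[OF atlas']])

lemma coordinate_section:
  "p \<in> points A \<Longrightarrow> c \<in> B \<Longrightarrow> \<phi> p \<in> fst c \<Longrightarrow>
    smooth_section_at A B \<phi> p (\<lambda>q. coordinate_field B c b (\<phi> q))"
  by (rule smooth_section_at_field_compose[OF atlas atlas' smooth, of _ "coordinate_field B c b"])
    (auto intro: coordinate_field_at)

lemma extendable_image:
  assumes p: "p \<in> U"
  shows "extendable_at B (\<phi> p)"
  unfolding extendable_at_def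
proof
  fix w assume w: "w \<in> tangent_space B (\<phi> p)"
  obtain c where c: "c \<in> B" "\<phi> p \<in> fst c" using chart_at_image[OF M.frame_points[OF p]] .
  let ?W = "\<lambda>q. \<Sum>b\<in>Basis. w (\<lambda>q. snd c q \<bullet> b) *\<^sub>R coordinate_field B c b q"
  have "smooth_field_at B (\<phi> p) ?W"
    by (rule smooth_section_at_sum[OF atlas' coordinate_field_at[OF c, of 0]])
      (intro smooth_section_at_scale_const atlas' coordinate_field_at c)
  moreover have "?W (\<phi> p) = w" by (rule image_coordinate_expand[OF p c w, symmetric])
  ultimately show "\<exists>W. smooth_field_at B (\<phi> p) W \<and> W (\<phi> p) = w" by blast
qed

lemma section_expand:
  assumes p: "p \<in> U" and c: "c \<in> B" "\<phi> p \<in> fst c" and V: "smooth_section_at A B \<phi> p V"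
  shows "\<forall>\<^sub>F q in nhds p. V q =
    (\<Sum>b\<in>Basis. V q (\<lambda>q. snd c q \<bullet> b) *\<^sub>R coordinate_field B c b (\<phi> q))"
proof -
  have "open (points A \<inter> \<phi> -` fst c)"
    by (rule smooth_map_open_vimage[OF atlas smooth chart_open[OF atlas' c(1)]])
  then have "\<forall>\<^sub>F q in nhds p. q \<in> points A \<inter> \<phi> -` fst c"
    by (rule eventually_nhds_mem) (use c M.frame_points[OF p] in auto)
  then show ?thesis
    using eventually_nhds_mem[OF M.frame_open p] smooth_section_at_eventually[OF V]
  proof eventually_elim
    case (elim q)
    then show ?case
      by (intro image_coordinate_expand c(1) smooth_section_at_tangent) auto
  qed
qed

lemma section_coordinate_smooth:
  assumes "c \<in> B" "\<phi> p \<in> fst c" "smooth_section_at A B \<phi> p V"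
  shows "smooth_fun_at A p (\<lambda>q. V q (\<lambda>q. snd c q \<bullet> b))"
  by (rule smooth_section_at_apply[OF assms(3) smooth_fun_at_coordinate[OF atlas' assms(1,2)]])

text \<open>Near \<open>p\<close> a section is a combination of coordinate fields composed with
  \<phi>, with smooth coefficients. The product rule differentiates the coefficients, and on the
  composed fields \<open>D\<close> is prescribed.\<close>

lemma D_expand:
  assumes p: "p \<in> U" and c: "c \<in> B" "\<phi> p \<in> fst c" and V: "smooth_section_at A B \<phi> p V"
    and v: "v \<in> tangent_space A p"
  shows "D p v V = (\<Sum>b\<in>Basis. v (\<lambda>q. V q (\<lambda>q. snd c q \<bullet> b)) *\<^sub>R coordinate_field B c b (\<phi> p)
    + V p (\<lambda>q. snd c q \<bullet> b) *\<^sub>R nabN (\<phi> p) (d\<phi> p v) (coordinate_field B c b))"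
proof -
  have pA: "p \<in> points A" by (rule M.frame_points[OF p])
  let ?a = "\<lambda>b q. V q (\<lambda>q. snd c q \<bullet> b)" and ?E = "\<lambda>b. coordinate_field B c b"
  note E = coordinate_section[OF pA c]
  have sec: "smooth_section_at A B \<phi> p (\<lambda>q. ?a b q *\<^sub>R ?E b (\<phi> q))" for b
    by (rule smooth_section_at_scale[OF atlas section_coordinate_smooth[OF c V] E])
  have "D p v V = D p v (\<lambda>q. \<Sum>b\<in>Basis. ?a b q *\<^sub>R ?E b (\<phi> q))"
    by (rule D_cong[OF V v section_expand[OF p c V]])
  also have "\<dots> = (\<Sum>b\<in>Basis. D p v (\<lambda>q. ?a b q *\<^sub>R ?E b (\<phi> q)))"
    by (rule D_sum[OF v V sec])
  also have "\<dots> = (\<Sum>b\<in>Basis. v (?a b) *\<^sub>R ?E b (\<phi> p) + ?a b p *\<^sub>R nabN (\<phi> p) (d\<phi> p v) (?E b))"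
    by (simp add: D_scale[OF E v section_coordinate_smooth[OF c V]]
        D_field_compose[OF pA v coordinate_field_at[OF c]])
  finally show ?thesis .
qed

text \<open>The bracket of coordinate fields is in the span of these fields and annihilates coordinates.\<close>

lemma coordinate_connection_commute:
  assumes p: "p \<in> U" and c: "c \<in> B" "\<phi> p \<in> fst c"
  shows "nabN (\<phi> p) (coordinate_field B c b (\<phi> p)) (coordinate_field B c b') =
    nabN (\<phi> p) (coordinate_field B c b' (\<phi> p)) (coordinate_field B c b)"
proof -
  let ?E = "\<lambda>b. coordinate_field B c b"
  note E = coordinate_field_at[OF c]
  have q: "\<phi> p \<in> points B" by (rule image_points[OF M.frame_points[OF p]])
  have zero: "?E b (\<phi> p) (\<lambda>q. ?E b' q (\<lambda>q. snd c q \<bullet> k)) = 0" for b b' k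
  proof -
    have "\<forall>\<^sub>F q in nhds (\<phi> p). ?E b' q (\<lambda>q. snd c q \<bullet> k) = b' \<bullet> k"
      using eventually_nhds_mem[OF chart_open[OF atlas' c(1)] c(2)]
      by eventually_elim (rule coordinate_field_coordinate[OF atlas' c(1)])
    then have "?E b (\<phi> p) (\<lambda>q. ?E b' q (\<lambda>q. snd c q \<bullet> k)) = ?E b (\<phi> p) (\<lambda>q. b' \<bullet> k)"
      by (rule tangent_cong[OF atlas' smooth_section_at_tangent[OF E]])
    then show ?thesis using tangent_const[OF atlas' q smooth_section_at_tangent[OF E]] by simp
  qed
  have "lie_bracket B (?E b) (?E b') (\<phi> p) (\<lambda>q. snd c q \<bullet> k) = 0" for k
    by (simp only: lie_bracket_apply[OF smooth_fun_at_coordinate[OF atlas' c]] zero diff_self)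
  then have "lie_bracket B (?E b) (?E b') (\<phi> p) = 0"
    using image_coordinate_expand[OF p c smooth_section_at_tangent[OF
        N.lie_bracket_field[OF E[of b] E[of b']]]]
    by simp
  then show ?thesis using N.lie_bracket_eq[OF E E, of b b'] by simp
qed

lemma differential_at: "smooth_fun_at B (\<phi> p) f \<Longrightarrow> d\<phi> p v f = v (\<lambda>q. f (\<phi> q))"
  by (rule differential_apply)

lemma differential_coordinate:
  assumes "p \<in> points A" "c \<in> B" "\<phi> p \<in> fst c"
  shows "d\<phi> p v (\<lambda>q. snd c q \<bullet> b) = v (\<lambda>q. snd c (\<phi> q) \<bullet> b)"
  by (rule differential_at[OF smooth_fun_at_coordinate[OF atlas' assms(2,3)]])

text \<open>In coordinates the terms with \<open>nabN\<close> form a double sum that is symmetric in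
  the two fields, because coordinate fields have vanishing bracket. The difference leaves X(Y f) -
  Y(X f) for the coordinate functions f of \<phi>, the coefficients of the bracket.\<close>

lemma D_torsion_free:
  assumes p: "p \<in> U" and X: "smooth_field_at A p X" and Y: "smooth_field_at A p Y"
  shows "D p (X p) (\<lambda>q. d\<phi> q (Y q)) - D p (Y p) (\<lambda>q. d\<phi> q (X q)) = d\<phi> p (lie_bracket A X Y p)"
proof -
  have pA: "p \<in> points A" by (rule M.frame_points[OF p])
  obtain c where c: "c \<in> B" "\<phi> p \<in> fst c" using chart_at_image[OF pA] .
  let ?E = "\<lambda>b. coordinate_field B c b" and ?y = "\<lambda>b q. snd c q \<bullet> b"
  let ?f = "\<lambda>b q. snd c (\<phi> q) \<bullet> b"
  have f: "smooth_fun_at A p (?f b)" for b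
    by (rule smooth_fun_at_compose[OF atlas atlas' smooth pA smooth_fun_at_coordinate[OF atlas' c]])
  note t = smooth_section_at_tangent
  note dt = differential_in_tangent[OF pA]
  have ex: "D p (X p) (\<lambda>q. d\<phi> q (Y q)) = (\<Sum>b\<in>Basis. X p (\<lambda>q. Y q (?f b)) *\<^sub>R ?E b (\<phi> p))
      + (\<Sum>b\<in>Basis. \<Sum>b'\<in>Basis. (Y p (?f b) * X p (?f b')) *\<^sub>R nabN (\<phi> p) (?E b' (\<phi> p)) (?E b))"
    if X: "smooth_field_at A p X" and Y: "smooth_field_at A p Y" for X Y
  proof -
    have "open (points A \<inter> \<phi> -` fst c)"
      by (rule smooth_map_open_vimage[OF atlas smooth chart_open[OF atlas' c(1)]])
    then have "\<forall>\<^sub>F q in nhds p. q \<in> points A \<inter> \<phi> -` fst c"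
      by (rule eventually_nhds_mem) (use c pA in auto)
    then have "\<forall>\<^sub>F q in nhds p. d\<phi> q (Y q) (?y b) = Y q (?f b)" for b
      by eventually_elim (rule differential_coordinate, use c in auto)
    then have 1: "X p (\<lambda>q. d\<phi> q (Y q) (?y b)) = X p (\<lambda>q. Y q (?f b))" for b
      by (rule tangent_cong[OF atlas t[OF X]])
    have "nabN (\<phi> p) (\<Sum>b'\<in>Basis. d\<phi> p (X p) (?y b') *\<^sub>R ?E b' (\<phi> p)) (?E b) =
        (\<Sum>b'\<in>Basis. d\<phi> p (X p) (?y b') *\<^sub>R nabN (\<phi> p) (?E b' (\<phi> p)) (?E b))" for b
      by (rule linear_on_sum[OF subspace_tangent_space N.D_linear_on[OF coordinate_field_at[OF c]]])
        (rule t[OF coordinate_field_at[OF c]])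
    then have 2: "nabN (\<phi> p) (d\<phi> p (X p)) (?E b) =
        (\<Sum>b'\<in>Basis. X p (?f b') *\<^sub>R nabN (\<phi> p) (?E b' (\<phi> p)) (?E b))" for b
      unfolding image_coordinate_expand[OF p c dt[OF t[OF X]], symmetric]
      unfolding differential_coordinate[OF pA c] .
    show ?thesis
      unfolding D_expand[OF p c differential_section[OF Y] t[OF X]] 1 2
        differential_coordinate[OF pA c]
      by (simp only: sum.distrib scaleR_sum_right scaleR_scaleR)
  qed
  have "(\<Sum>b\<in>Basis. \<Sum>b'\<in>Basis. (Y p (?f b) * X p (?f b')) *\<^sub>R nabN (\<phi> p) (?E b' (\<phi> p)) (?E b)) =
      (\<Sum>b\<in>Basis. \<Sum>b'\<in>Basis. (X p (?f b) * Y p (?f b')) *\<^sub>R nabN (\<phi> p) (?E b' (\<phi> p)) (?E b))"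
    by (subst sum.swap)
      (simp only: coordinate_connection_commute[OF p c] mult.commute)
  then have "D p (X p) (\<lambda>q. d\<phi> q (Y q)) - D p (Y p) (\<lambda>q. d\<phi> q (X q)) =
      (\<Sum>b\<in>Basis. X p (\<lambda>q. Y q (?f b)) *\<^sub>R ?E b (\<phi> p))
      - (\<Sum>b\<in>Basis. Y p (\<lambda>q. X q (?f b)) *\<^sub>R ?E b (\<phi> p))"
    unfolding ex[OF X Y] ex[OF Y X] by simp
  also have "\<dots> = (\<Sum>b\<in>Basis. lie_bracket A X Y p (?f b) *\<^sub>R ?E b (\<phi> p))"
    by (simp only: lie_bracket_apply[OF f] scaleR_diff_left sum_subtractf)
  also have "\<dots> = d\<phi> p (lie_bracket A X Y p)"
    using image_coordinate_expand[OF p c dt[OF t[OF M.lie_bracket_field[OF X Y]]]]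
    unfolding differential_coordinate[OF pA c] by (rule sym)
  finally show ?thesis .
qed

text \<open>If the metric rule holds for every composed coordinate field against \<open>W\<close>,
  then the product rule gives it for every \<open>V\<close> against \<open>W\<close>. Smoothness is
  part of the conclusion because \<open>D_metric\<close> applies the lemma twice and the second
  application requires it.\<close>

lemma D_metric_reduction:
  assumes p: "p \<in> U" and c: "c \<in> B" "\<phi> p \<in> fst c"
    and V: "smooth_section_at A B \<phi> p V" and W: "smooth_section_at A B \<phi> p W"
    and v: "v \<in> tangent_space A p"
    and smooth': "\<And>b. smooth_fun_at A p (\<lambda>q. h (\<phi> q) (coordinate_field B c b (\<phi> q)) (W q))"
    and base: "\<And>b. v (\<lambda>q. h (\<phi> q) (coordinate_field B c b (\<phi> q)) (W q)) =
      h (\<phi> p) (D p v (\<lambda>q. coordinate_field B c b (\<phi> q))) (W p)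
      + h (\<phi> p) (coordinate_field B c b (\<phi> p)) (D p v W)"
  shows "smooth_fun_at A p (\<lambda>q. h (\<phi> q) (V q) (W q))"
    and "v (\<lambda>q. h (\<phi> q) (V q) (W q)) = h (\<phi> p) (D p v V) (W p) + h (\<phi> p) (V p) (D p v W)"
proof -
  have pA: "p \<in> points A" by (rule M.frame_points[OF p])
  have q: "\<phi> p \<in> points B" by (rule image_points[OF pA])
  let ?a = "\<lambda>b q. V q (\<lambda>q. snd c q \<bullet> b)" and ?E = "\<lambda>b. coordinate_field B c b"
  let ?h = "\<lambda>b q. h (\<phi> q) (?E b (\<phi> q)) (W q)"
  note t = smooth_section_at_tangent
  have "open (points A \<inter> \<phi> -` fst c)"
    by (rule smooth_map_open_vimage[OF atlas smooth chart_open[OF atlas' c(1)]])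
  then have near: "\<forall>\<^sub>F q in nhds p. q \<in> points A \<inter> \<phi> -` fst c"
    by (rule eventually_nhds_mem) (use c pA in auto)
  have ev: "\<forall>\<^sub>F q in nhds p. (\<Sum>b\<in>Basis. ?a b q * ?h b q) = h (\<phi> q) (V q) (W q)"
    using near section_expand[OF p c V] smooth_section_at_eventually[OF W]
  proof eventually_elim
    case (elim q)
    then have "\<phi> q \<in> points B" "W q \<in> tangent_space B (\<phi> q)"
      and E: "?E b (\<phi> q) \<in> tangent_space B (\<phi> q)" for b
      using t[of A B \<phi> q W] t[OF coordinate_field_at[OF c(1)]] image_points by auto
    from linear_on_sum[OF subspace_tangent_space N.metric_linear_left[OF this(1,2)] E]
    have "h (\<phi> q) (\<Sum>b\<in>Basis. ?a b q *\<^sub>R ?E b (\<phi> q)) (W q) = (\<Sum>b\<in>Basis. ?a b q *\<^sub>R ?h b q)" .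
    then show ?case using elim(2) by simp
  qed
  have a: "smooth_fun_at A p (?a b)" for b by (rule section_coordinate_smooth[OF c V])
  note ah = smooth_fun_at_mult[OF atlas a smooth']
  show "smooth_fun_at A p (\<lambda>q. h (\<phi> q) (V q) (W q))"
    by (rule smooth_fun_at_cong[OF atlas smooth_fun_at_sum[OF atlas pA ah] ev])
  have E: "?E b (\<phi> p) \<in> tangent_space B (\<phi> p)" for b by (rule t[OF coordinate_field_at[OF c]])
  have DE: "D p v (\<lambda>q. ?E b (\<phi> q)) \<in> tangent_space B (\<phi> p)" for b
    by (rule D_tangent[OF coordinate_section[OF pA c] v])
  note lW = N.metric_linear_left[OF q t[OF W]] and lDW = N.metric_linear_left[OF q D_tangent[OF W v]]
  note S = subspace_tangent_space
  have 1: "h (\<phi> p) (V p) (D p v W) = (\<Sum>b\<in>Basis. ?a b p * h (\<phi> p) (?E b (\<phi> p)) (D p v W))"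
    using linear_on_sum[where I = Basis and x = "\<lambda>b. ?E b (\<phi> p)" and c = "\<lambda>b. ?a b p",
        OF S lDW E]
      eventually_nhds_x_imp_x[OF section_expand[OF p c V]] by simp
  have "h (\<phi> p) (D p v V) (W p) = (\<Sum>b\<in>Basis. v (?a b) * ?h b p
      + ?a b p * h (\<phi> p) (D p v (\<lambda>q. ?E b (\<phi> q))) (W p))"
  proof -
    have "D p v V = (\<Sum>b\<in>Basis. v (?a b) *\<^sub>R ?E b (\<phi> p)) + (\<Sum>b\<in>Basis. ?a b p *\<^sub>R D p v (\<lambda>q. ?E b (\<phi> q)))"
      unfolding D_expand[OF p c V v] D_field_compose[OF pA v coordinate_field_at[OF c]]
      by (rule sum.distrib)
    moreover have "(\<Sum>b\<in>Basis. v (?a b) *\<^sub>R ?E b (\<phi> p)) \<in> tangent_space B (\<phi> p)"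
      "(\<Sum>b\<in>Basis. ?a b p *\<^sub>R D p v (\<lambda>q. ?E b (\<phi> q))) \<in> tangent_space B (\<phi> p)"
      by (intro tangent_space_sum tangent_space_scale E DE)+
    ultimately show ?thesis
      using linear_on_add[OF lW, of "\<Sum>b\<in>Basis. v (?a b) *\<^sub>R ?E b (\<phi> p)"]
        linear_on_sum[where I = Basis and x = "\<lambda>b. ?E b (\<phi> p)" and c = "\<lambda>b. v (?a b)",
          OF S lW E]
        linear_on_sum[where I = Basis and x = "\<lambda>b. D p v (\<lambda>q. ?E b (\<phi> q))" and c = "\<lambda>b. ?a b p",
          OF S lW DE]
      by (simp add: sum.distrib)
  qed
  moreover have "v (\<lambda>q. h (\<phi> q) (V q) (W q)) = (\<Sum>b\<in>Basis. v (\<lambda>q. ?a b q * ?h b q))"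
    unfolding tangent_cong[OF atlas v ev, symmetric] by (rule tangent_sum[OF atlas pA v ah])
  moreover have "v (\<lambda>q. ?a b q * ?h b q) = v (?a b) * ?h b p
      + ?a b p * (h (\<phi> p) (D p v (\<lambda>q. ?E b (\<phi> q))) (W p) + h (\<phi> p) (?E b (\<phi> p)) (D p v W))" for b
    unfolding tangent_mult[OF v a smooth'] base ..
  ultimately show "v (\<lambda>q. h (\<phi> q) (V q) (W q)) = h (\<phi> p) (D p v V) (W p) + h (\<phi> p) (V p) (D p v W)"
    using 1 by (simp add: sum.distrib distrib_left)
qed

lemma D_metric:
  assumes p: "p \<in> U" and V: "smooth_section_at A B \<phi> p V" and W: "smooth_section_at A B \<phi> p W"
    and v: "v \<in> tangent_space A p"
  shows "v (\<lambda>q. h (\<phi> q) (V q) (W q)) = h (\<phi> p) (D p v V) (W p) + h (\<phi> p) (V p) (D p v W)"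
proof -
  have pA: "p \<in> points A" by (rule M.frame_points[OF p])
  have q: "\<phi> p \<in> points B" by (rule image_points[OF pA])
  obtain c where c: "c \<in> B" "\<phi> p \<in> fst c" using chart_at_image[OF pA] .
  let ?E = "\<lambda>b. coordinate_field B c b"
  note t = smooth_section_at_tangent
  note E = coordinate_field_at[OF c] and sE = coordinate_section[OF pA c]
  have s: "smooth_fun_at A p (\<lambda>q. h (\<phi> q) (?E b (\<phi> q)) (?E b' (\<phi> q)))" for b b'
    by (rule smooth_fun_at_compose[OF atlas atlas' smooth pA N.metric_smooth_at[OF E E]])
  \<comment> \<open>The base case: for two composed fields the function is h(E, E') o \<phi>, and
    its derivative along \<open>v\<close> is that of h(E, E') along the image of \<open>v\<close>,
    where the metric compatibility of the target applies.\<close>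
  have b: "v (\<lambda>q. h (\<phi> q) (?E b (\<phi> q)) (?E b' (\<phi> q))) =
      h (\<phi> p) (D p v (\<lambda>q. ?E b (\<phi> q))) (?E b' (\<phi> p)) + h (\<phi> p) (?E b (\<phi> p)) (D p v (\<lambda>q. ?E b' (\<phi> q)))"
    for b b'
    using N.metric_compatible[OF E E differential_in_tangent[OF pA v], of b b']
    unfolding differential_at[OF N.metric_smooth_at[OF E E]] D_field_compose[OF pA v E] .
  \<comment> \<open>The first pass replaces one coordinate field by \<open>W\<close>. After an
    exchange of the arguments by symmetry of \<open>h\<close>, the second pass replaces the other by
    \<open>V\<close>.\<close>
  note step1 = D_metric_reduction[OF p c W sE v s b]
  have sym: "\<forall>\<^sub>F q in nhds p. h (\<phi> q) (W q) (?E b (\<phi> q)) = h (\<phi> q) (?E b (\<phi> q)) (W q)" for b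
    using smooth_section_at_eventually[OF W] smooth_section_at_eventually[OF sE[of b]]
    by eventually_elim
      (rule N.metric_commute, auto intro: image_points smooth_section_at_points t)
  show ?thesis
  proof (rule D_metric_reduction(2)[OF p c V W v])
    show "smooth_fun_at A p (\<lambda>q. h (\<phi> q) (?E b (\<phi> q)) (W q))" for b
      by (rule smooth_fun_at_cong[OF atlas step1(1) sym])
    show "v (\<lambda>q. h (\<phi> q) (?E b (\<phi> q)) (W q)) =
        h (\<phi> p) (D p v (\<lambda>q. ?E b (\<phi> q))) (W p) + h (\<phi> p) (?E b (\<phi> p)) (D p v W)" for b
      unfolding tangent_cong[OF atlas v sym, symmetric] step1(2)
      using N.metric_commute[OF q t[OF W] D_tangent[OF sE v], of b]
        N.metric_commute[OF q t[OF sE] D_tangent[OF W v], of b] by simp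
  qed
qed

text \<open>
  On horizontal fields the second fundamental form is symmetric in its arguments and, paired with
  a horizontal field, skew in the last two; hence it vanishes.
\<close>

lemma D_horizontal:
  assumes p: "p \<in> U" and X: "smooth_field_at A p X" and Y: "smooth_field_at A p Y"
    and XH: "\<forall>\<^sub>F q in nhds p. X q \<in> horizontal_space A g B \<phi> q"
    and YH: "\<forall>\<^sub>F q in nhds p. Y q \<in> horizontal_space A g B \<phi> q"
  shows "D p (X p) (\<lambda>q. d\<phi> q (Y q)) = d\<phi> p (nabM p (X p) Y)"
proof -
  have pA: "p \<in> points A" by (rule M.frame_points[OF p])
  have q: "\<phi> p \<in> points B" by (rule image_points[OF pA])
  define T where "T = (\<lambda>X Y. D p (X p) (\<lambda>q. d\<phi> q (Y q)) - d\<phi> p (nabM p (X p) Y))"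
  define F where "F = {X. smooth_field_at A p X \<and> (\<forall>\<^sub>F q in nhds p. X q \<in> horizontal_space A g B \<phi> q)}"
  note t = smooth_section_at_tangent
  have Ff: "smooth_field_at A p X" "X p \<in> tangent_space A p" "X p \<in> horizontal_space A g B \<phi> p"
    "\<forall>\<^sub>F q in nhds p. X q \<in> horizontal_space A g B \<phi> q" if "X \<in> F" for X
    using that t[of A A "\<lambda>p. p" p X] eventually_nhds_x_imp_x[of _ p] by (auto simp: F_def)
  have dT: "d\<phi> p (X p) \<in> tangent_space B (\<phi> p)" if "X \<in> F" for X
    by (rule differential_in_tangent[OF pA Ff(2)[OF that]])
  have TT: "D p (X p) (\<lambda>q. d\<phi> q (Y q)) \<in> tangent_space B (\<phi> p)"
    "nabM p (X p) Y \<in> tangent_space A p"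
    "d\<phi> p (nabM p (X p) Y) \<in> tangent_space B (\<phi> p)"
    "T X Y \<in> tangent_space B (\<phi> p)" if "X \<in> F" "Y \<in> F" for X Y
  proof -
    show 1: "D p (X p) (\<lambda>q. d\<phi> q (Y q)) \<in> tangent_space B (\<phi> p)"
      by (rule D_tangent[OF differential_section]) (use Ff that in auto)
    show 2: "nabM p (X p) Y \<in> tangent_space A p"
      by (rule M.D_tangent) (use Ff that in auto)
    show 3: "d\<phi> p (nabM p (X p) Y) \<in> tangent_space B (\<phi> p)"
      by (rule differential_in_tangent[OF pA 2])
    show "T X Y \<in> tangent_space B (\<phi> p)" unfolding T_def by (rule tangent_space_diff[OF 1 3])
  qed
  have sym: "T X Y = T Y X" if "X \<in> F" "Y \<in> F" for X Y
    using D_torsion_free[OF p Ff(1)[OF that(1)] Ff(1)[OF that(2)]]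
      M.lie_bracket_eq[OF Ff(1)[OF that(1)] Ff(1)[OF that(2)]]
    by (simp add: T_def linear_diff[OF linear_differential] algebra_simps)
  have skew: "h (\<phi> p) (T X Y) (d\<phi> p (Z p)) = - h (\<phi> p) (T X Z) (d\<phi> p (Y p))"
    if F: "X \<in> F" "Y \<in> F" "Z \<in> F" for X Y Z
  proof -
    \<comment> \<open>The equality of the two inner products holds near \<open>p\<close>, not only
      at \<open>p\<close>, so it may be differentiated: by \<open>D_metric\<close> on one side and
      by metric compatibility of M on the other.\<close>
    have ev: "\<forall>\<^sub>F q in nhds p. h (\<phi> q) (d\<phi> q (Y q)) (d\<phi> q (Z q)) = g q (Y q) (Z q)"
      using eventually_nhds_mem[OF M.frame_open p] Ff(4)[OF F(2)] Ff(4)[OF F(3)]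
      by eventually_elim (rule metric_horizontal, auto intro: horizontal_tangent)
    have ev': "X p (\<lambda>q. h (\<phi> q) (d\<phi> q (Y q)) (d\<phi> q (Z q))) = X p (\<lambda>q. g q (Y q) (Z q))"
      by (rule tangent_cong[OF atlas Ff(2)[OF F(1)] ev])
    have "h (\<phi> p) (D p (X p) (\<lambda>q. d\<phi> q (Y q))) (d\<phi> p (Z p))
        + h (\<phi> p) (d\<phi> p (Y p)) (D p (X p) (\<lambda>q. d\<phi> q (Z q))) =
      g p (nabM p (X p) Y) (Z p) + g p (Y p) (nabM p (X p) Z)"
      using D_metric[OF p differential_section[OF Ff(1)[OF F(2)]]
          differential_section[OF Ff(1)[OF F(3)]] Ff(2)[OF F(1)]]
        M.metric_compatible[OF Ff(1)[OF F(2)] Ff(1)[OF F(3)] Ff(2)[OF F(1)]] ev' by simp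
    \<comment> \<open>The derivatives on the left may have vertical parts; only the second argument
      has to be horizontal here.\<close>
    moreover have "g p (nabM p (X p) Y) (Z p) = h (\<phi> p) (d\<phi> p (nabM p (X p) Y)) (d\<phi> p (Z p))"
      "g p (nabM p (X p) Z) (Y p) = h (\<phi> p) (d\<phi> p (nabM p (X p) Z)) (d\<phi> p (Y p))"
      using metric_horizontal[OF p TT(2)[OF F(1,2)] Ff(3)[OF F(3)]]
        metric_horizontal[OF p TT(2)[OF F(1,3)] Ff(3)[OF F(2)]] by simp_all
    moreover have "g p (Y p) (nabM p (X p) Z) = g p (nabM p (X p) Z) (Y p)"
      by (rule M.metric_commute[OF pA Ff(2)[OF F(2)] TT(2)[OF F(1,3)]])
    moreover have "h (\<phi> p) (d\<phi> p (Y p)) (D p (X p) (\<lambda>q. d\<phi> q (Z q))) =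
        h (\<phi> p) (D p (X p) (\<lambda>q. d\<phi> q (Z q))) (d\<phi> p (Y p))"
      by (rule N.metric_commute[OF q dT[OF F(2)] TT(1)[OF F(1,3)]])
    ultimately show ?thesis
      using linear_on_diff[OF N.metric_linear_left[OF q dT[OF F(3)]] TT(1)[OF F(1,2)] TT(3)[OF F(1,2)]]
        linear_on_diff[OF N.metric_linear_left[OF q dT[OF F(2)]] TT(1)[OF F(1,3)] TT(3)[OF F(1,3)]]
      by (simp add: T_def)
  qed
  \<comment> \<open>Exchanging the last two and the first two arguments alternately returns to the
    start after six moves, of which three change the sign. So the value equals its own
    negative.\<close>
  have zero: "h (\<phi> p) (T X Y) (d\<phi> p (Z p)) = 0" if F: "X \<in> F" "Y \<in> F" "Z \<in> F" for X Y Z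
  proof -
    have sym': "h (\<phi> p) (T X Y) w = h (\<phi> p) (T Y X) w" if "X \<in> F" "Y \<in> F" for X Y w
      by (simp only: sym[OF that])
    show ?thesis
      using skew[OF F] sym'[OF F(1,3), of "d\<phi> p (Y p)"] skew[OF F(3,1,2)]
        sym'[OF F(3,2), of "d\<phi> p (X p)"] skew[OF F(2,3,1)] sym'[OF F(2,1), of "d\<phi> p (Z p)"]
      by linarith
  qed
  have XY: "X \<in> F" "Y \<in> F" using assms by (auto simp: F_def)
  have eF: "e i \<in> F" if "i \<in> {1..DIM('b)}" for i
  proof -
    have "\<forall>\<^sub>F q in nhds p. e i q \<in> horizontal_space A g B \<phi> q"
      using eventually_nhds_mem[OF M.frame_open p] by eventually_elim (rule frame_horizontal[OF that])
    moreover have "smooth_field_at A p (e i)" by (rule M.frame_field[OF p]) (use that dim in auto)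
    ultimately show ?thesis by (simp add: F_def)
  qed
  \<comment> \<open>The images of the horizontal frame fields are an orthonormal basis, so vanishing
    against them is enough.\<close>
  have "T X Y = (\<Sum>i = 1..DIM('b). h (\<phi> p) (T X Y) (d\<phi> p (e i p)) *\<^sub>R d\<phi> p (e i p))"
    by (rule N.orthonormal_basis_expand[OF q image_basis[OF p] TT(4)[OF XY]])
  also have "\<dots> = 0" by (rule sum.neutral) (use zero[OF XY eF] in auto)
  finally show ?thesis by (simp add: T_def)
qed

text \<open>Torsion-freeness, with one term absent because \<open>d\<phi>(V)\<close> is the zero
  section near \<open>p\<close>. Verticality at \<open>p\<close> alone would not do, since this
  section is differentiated.\<close>

lemma D_vertical:
  assumes p: "p \<in> U" and V: "smooth_field_at A p V" and Y: "smooth_field_at A p Y"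
    and vert: "\<forall>\<^sub>F q in nhds p. V q \<in> vertical_space A B \<phi> q"
  shows "D p (V p) (\<lambda>q. d\<phi> q (Y q)) = d\<phi> p (lie_bracket A V Y p)"
proof -
  have "\<forall>\<^sub>F q in nhds p. d\<phi> q (V q) = 0"
    using vert by eventually_elim (rule differential_vertical)
  then have "D p (Y p) (\<lambda>q. d\<phi> q (V q)) = D p (Y p) (\<lambda>q. 0)"
    by (rule D_cong[OF differential_section[OF V] smooth_section_at_tangent[OF Y]])
  also have "\<dots> = 0"
    by (rule D_zero[OF differential_section[OF V] smooth_section_at_tangent[OF Y]])
  finally show ?thesis using D_torsion_free[OF p V Y] by simp
qed

end

section \<open>The bitension field\<close>

context submersion
begin

text \<open>Both summands produce the same term \<open>v f *\<^sub>R d\<phi> p (X p)\<close> from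
  the product rule, and it cancels in the difference.\<close>

lemma second_fundamental_form_tensorial:
  assumes p: "p \<in> U" and v: "v \<in> tangent_space A p"
  shows "tensorial_at A p (\<lambda>Y. D p v (\<lambda>q. d\<phi> q (Y q)) - d\<phi> p (nabM p v Y))"
  unfolding tensorial_at_def
proof (intro conjI allI impI; elim conjE)
  fix X Y assume X: "smooth_field_at A p X" and Y: "smooth_field_at A p Y"
  show "D p v (\<lambda>q. d\<phi> q (X q + Y q)) - d\<phi> p (nabM p v (\<lambda>q. X q + Y q)) =
      D p v (\<lambda>q. d\<phi> q (X q)) - d\<phi> p (nabM p v X) + (D p v (\<lambda>q. d\<phi> q (Y q)) - d\<phi> p (nabM p v Y))"
    by (simp add: linear_add[OF linear_differential] M.D_add[OF X v Y]
        D_add[OF differential_section[OF X] v differential_section[OF Y]])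
next
  fix f X assume f: "smooth_fun_at A p f" and X: "smooth_field_at A p X"
  show "D p v (\<lambda>q. d\<phi> q (f q *\<^sub>R X q)) - d\<phi> p (nabM p v (\<lambda>q. f q *\<^sub>R X q)) =
      f p *\<^sub>R (D p v (\<lambda>q. d\<phi> q (X q)) - d\<phi> p (nabM p v X))"
    by (simp add: linear_add[OF linear_differential] linear_scale[OF linear_differential]
        M.D_scale[OF X v f] D_scale[OF differential_section[OF X] v f] scaleR_diff_right)
next
  fix X Y assume X: "smooth_field_at A p X" and ev: "\<forall>\<^sub>F q in nhds p. X q = Y q"
  have "\<forall>\<^sub>F q in nhds p. d\<phi> q (X q) = d\<phi> q (Y q)" using ev by eventually_elim simp
  then have "D p v (\<lambda>q. d\<phi> q (X q)) = D p v (\<lambda>q. d\<phi> q (Y q))"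
    by (rule D_cong[OF differential_section[OF X] v])
  then show "D p v (\<lambda>q. d\<phi> q (X q)) - d\<phi> p (nabM p v X) = D p v (\<lambda>q. d\<phi> q (Y q)) - d\<phi> p (nabM p v Y)"
    by (simp only: M.D_cong[OF X v ev])
qed

lemma tension_field_frame:
  assumes p: "p \<in> U"
  shows "tension_field A g B \<phi> nabM D p =
    (\<Sum>i = 1..DIM('a). D p (e i p) (\<lambda>q. d\<phi> q (e i q)) - d\<phi> p (nabM p (e i p) (e i)))"
  unfolding tension_field_def second_fundamental_form_def
proof (rule M.metric_trace_tensorial[OF p,
      where F = "\<lambda>v Y. D p v (\<lambda>q. d\<phi> q (Y q)) - d\<phi> p (nabM p v Y)"])
  fix Y assume Y: "smooth_field_at A p Y"
  show "linear_on (tangent_space A p) (\<lambda>v. D p v (\<lambda>q. d\<phi> q (Y q)) - d\<phi> p (nabM p v Y))"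
    using D_linear_on[OF differential_section[OF Y]] M.D_linear_on[OF Y]
    by (simp add: linear_on_def linear_add[OF linear_differential] linear_scale[OF linear_differential]
        algebra_simps)
qed (rule second_fundamental_form_tensorial[OF p])

text \<open>The correction by the connection of M removes the term
  \<open>v f *\<^sub>R D p (X p) V\<close> that arises when the coefficient of the inner direction
  is differentiated.\<close>

lemma second_covariant_derivative_tensorial:
  assumes p: "p \<in> U" and V: "smooth_section_at A B \<phi> p V" and v: "v \<in> tangent_space A p"
  shows "tensorial_at A p (\<lambda>Y. D p v (cov D Y V) - D p (nabM p v Y) V)"
  unfolding tensorial_at_def
proof (intro conjI allI impI; elim conjE)
  note t = smooth_section_at_tangent and evs = smooth_section_at_eventually
  note lin = D_linear_on[OF V] and tf = smooth_section_at_tangent[of A A "\<lambda>p. p"]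
  fix X Y assume X: "smooth_field_at A p X" and Y: "smooth_field_at A p Y"
  have sec: "smooth_section_at A B \<phi> p (\<lambda>q. cov D X V q + cov D Y V q)"
    by (intro smooth_section_at_add atlas cov_section X Y V)
  have "\<forall>\<^sub>F q in nhds p. cov D X V q + cov D Y V q = cov D (\<lambda>q. X q + Y q) V q"
    using evs[OF X] evs[OF Y] evs[OF V]
    by eventually_elim (simp add: cov_def linear_on_add[OF D_linear_on tf tf])
  from D_cong[OF sec v this] D_add[OF cov_section[OF X V] v cov_section[OF Y V]]
  have "D p v (cov D (\<lambda>q. X q + Y q) V) = D p v (cov D X V) + D p v (cov D Y V)" by simp
  moreover have "D p (nabM p v (\<lambda>q. X q + Y q)) V = D p (nabM p v X) V + D p (nabM p v Y) V"
    by (simp add: M.D_add[OF X v Y] linear_on_add[OF lin M.D_tangent[OF X v] M.D_tangent[OF Y v]])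
  ultimately show "D p v (cov D (\<lambda>q. X q + Y q) V) - D p (nabM p v (\<lambda>q. X q + Y q)) V =
      D p v (cov D X V) - D p (nabM p v X) V + (D p v (cov D Y V) - D p (nabM p v Y) V)"
    by simp
next
  note t = smooth_section_at_tangent and evs = smooth_section_at_eventually
  note lin = D_linear_on[OF V] and tf = smooth_section_at_tangent[of A A "\<lambda>p. p"]
  fix f X assume f: "smooth_fun_at A p f" and X: "smooth_field_at A p X"
  have sec: "smooth_section_at A B \<phi> p (\<lambda>q. f q *\<^sub>R cov D X V q)"
    by (intro smooth_section_at_scale atlas cov_section X f V)
  have "\<forall>\<^sub>F q in nhds p. f q *\<^sub>R cov D X V q = cov D (\<lambda>q. f q *\<^sub>R X q) V q"
    using evs[OF X] evs[OF V]
    by eventually_elim (simp add: cov_def linear_on_scale[OF D_linear_on tf])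
  from D_cong[OF sec v this] D_scale[OF cov_section[OF X V] v f]
  have "D p v (cov D (\<lambda>q. f q *\<^sub>R X q) V) = v f *\<^sub>R D p (X p) V + f p *\<^sub>R D p v (cov D X V)"
    by (simp add: cov_def)
  moreover have "D p (nabM p v (\<lambda>q. f q *\<^sub>R X q)) V = v f *\<^sub>R D p (X p) V + f p *\<^sub>R D p (nabM p v X) V"
    using lin t[OF X] M.D_tangent[OF X v] by (simp add: M.D_scale[OF X v f] linear_on_def)
  ultimately show "D p v (cov D (\<lambda>q. f q *\<^sub>R X q) V) - D p (nabM p v (\<lambda>q. f q *\<^sub>R X q)) V =
      f p *\<^sub>R (D p v (cov D X V) - D p (nabM p v X) V)"
    by (simp add: scaleR_diff_right)
next
  fix X Y assume X: "smooth_field_at A p X" and ev: "\<forall>\<^sub>F q in nhds p. X q = Y q"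
  have "\<forall>\<^sub>F q in nhds p. cov D X V q = cov D Y V q" using ev by eventually_elim (simp add: cov_def)
  then have "D p v (cov D X V) = D p v (cov D Y V)" by (rule D_cong[OF cov_section[OF X V] v])
  then show "D p v (cov D X V) - D p (nabM p v X) V = D p v (cov D Y V) - D p (nabM p v Y) V"
    by (simp only: M.D_cong[OF X v ev])
qed

lemma rough_laplacian_frame:
  assumes p: "p \<in> U" and V: "smooth_section_at A B \<phi> p V"
  shows "rough_laplacian A g nabM D V p =
    - (\<Sum>i = 1..DIM('a). D p (e i p) (cov D (e i) V) - D p (nabM p (e i p) (e i)) V)"
proof -
  have "metric_trace A g p (second_covariant_derivative A nabM D V p) =
      (\<Sum>i = 1..DIM('a). D p (e i p) (cov D (e i) V) - D p (nabM p (e i p) (e i)) V)"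
    unfolding second_covariant_derivative_def
  proof (rule M.metric_trace_tensorial[OF p,
        where F = "\<lambda>v Y. D p v (cov D Y V) - D p (nabM p v Y) V"])
    fix Y assume Y: "smooth_field_at A p Y"
    have "linear_on (tangent_space A p) (\<lambda>v. D p (nabM p v Y) V)"
      using M.D_linear_on[OF Y] D_linear_on[OF V] M.D_tangent[OF Y] by (simp add: linear_on_def)
    then show "linear_on (tangent_space A p) (\<lambda>v. D p v (cov D Y V) - D p (nabM p v Y) V)"
      using D_linear_on[OF cov_section[OF Y V]] by (simp add: linear_on_def algebra_simps)
  qed (rule second_covariant_derivative_tensorial[OF p V])
  then show ?thesis by (simp only: rough_laplacian_def)
qed

lemma frame_index: "i \<in> {1..DIM('b)} \<Longrightarrow> i \<in> {1..DIM('a)}" "s \<in> {DIM('b)+1..DIM('a)} \<Longrightarrow> s \<in> {1..DIM('a)}"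
  using dim by auto

lemma eventually_frame: "p \<in> U \<Longrightarrow> (\<And>q. q \<in> U \<Longrightarrow> P q) \<Longrightarrow> \<forall>\<^sub>F q in nhds p. P q"
  using eventually_nhds_mem[OF M.frame_open] by (rule eventually_mono)

section \<open>Second derivatives of the image of a horizontal field\<close>

lemma cov_frame_field:
  assumes "p \<in> U" "i \<in> {1..DIM('a)}" "smooth_field_at A p Y"
  shows "smooth_field_at A p (cov nabM (e i) Y)"
  by (rule M.cov_section[OF M.frame_field[OF assms(1,2)] assms(3)])

text \<open>Linearity in the direction separates the two parts of the derivative of
  \<open>e i\<close> along itself; the vertical one gives the bracket. The horizontal one has its
  own conclusion because it is treated differently later: converted term by term for horizontal
  \<open>e i\<close>, but first summed into the mean curvature for vertical
  \<open>e i\<close>.\<close>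

lemma cov_part:
  assumes p: "p \<in> U" and i: "i \<in> {1..DIM('a)}" and Y: "smooth_field_at A p Y"
    and H: "\<And>q. q \<in> U \<Longrightarrow> smooth_field_at A q Y \<and> Y q \<in> horizontal_space A g B \<phi> q"
  defines "Z \<equiv> cov nabM (e i) (e i)"
  shows "D p (nabM p (e i p) (e i)) (\<lambda>q. d\<phi> q (Y q)) =
    D p (horizontal_part A g B \<phi> Z p) (\<lambda>q. d\<phi> q (Y q))
    - d\<phi> p (lie_bracket A Y (vertical_part A g B \<phi> Z) p)"
    and "D p (horizontal_part A g B \<phi> Z p) (\<lambda>q. d\<phi> q (Y q)) =
      d\<phi> p (cov nabM (horizontal_part A g B \<phi> Z) Y p)"
proof -
  have Zq: "smooth_field_at A q Z" if "q \<in> U" for q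
    unfolding Z_def by (rule cov_frame_field[OF that i M.frame_field[OF that i]])
  have T: "Z q \<in> tangent_space A q" if "q \<in> U" for q
    by (rule smooth_section_at_tangent[OF Zq[OF that]])
  have "D p (nabM p (e i p) (e i)) (\<lambda>q. d\<phi> q (Y q)) =
      D p (horizontal_part A g B \<phi> Z p + vertical_part A g B \<phi> Z p) (\<lambda>q. d\<phi> q (Y q))"
    by (simp only: horizontal_vertical_part[where X = Z, OF p T[OF p]]) (simp only: Z_def cov_def)
  also have "\<dots> = D p (horizontal_part A g B \<phi> Z p) (\<lambda>q. d\<phi> q (Y q))
      + D p (vertical_part A g B \<phi> Z p) (\<lambda>q. d\<phi> q (Y q))"
    by (rule linear_on_add[OF D_linear_on[OF differential_section[OF Y]]
          horizontal_tangent[OF horizontal_part_horizontal[where X = Z, OF p T[OF p]]]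
          vertical_tangent[OF vertical_part_vertical[where X = Z, OF p T[OF p]]]])
  also have "D p (vertical_part A g B \<phi> Z p) (\<lambda>q. d\<phi> q (Y q)) =
      d\<phi> p (lie_bracket A (vertical_part A g B \<phi> Z) Y p)"
    by (rule D_vertical[OF p vertical_part_field[OF p Zq[OF p]] Y],
        rule eventually_frame[OF p], rule vertical_part_vertical) (use T in auto)
  also have "\<dots> = - d\<phi> p (lie_bracket A Y (vertical_part A g B \<phi> Z) p)"
    by (subst lie_bracket_skew) (rule linear_neg[OF linear_differential])
  finally show "D p (nabM p (e i p) (e i)) (\<lambda>q. d\<phi> q (Y q)) =
    D p (horizontal_part A g B \<phi> Z p) (\<lambda>q. d\<phi> q (Y q))
    - d\<phi> p (lie_bracket A Y (vertical_part A g B \<phi> Z) p)" by simp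
  have "\<forall>\<^sub>F q in nhds p. horizontal_part A g B \<phi> Z q \<in> horizontal_space A g B \<phi> q"
    by (rule eventually_frame[OF p], rule horizontal_part_horizontal) (use T in auto)
  moreover have "\<forall>\<^sub>F q in nhds p. Y q \<in> horizontal_space A g B \<phi> q"
    by (rule eventually_frame[OF p]) (use H in blast)
  ultimately show "D p (horizontal_part A g B \<phi> Z p) (\<lambda>q. d\<phi> q (Y q)) =
      d\<phi> p (cov nabM (horizontal_part A g B \<phi> Z) Y p)"
    unfolding cov_def by (rule D_horizontal[OF p horizontal_part_field[OF p Zq[OF p]] Y])
qed

text \<open>\<open>D_horizontal\<close> is used twice. Between the two uses the derivative of
  \<open>Y\<close>, which need not be horizontal, is replaced by its horizontal part; this has the
  same image and meets the hypothesis again.\<close>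

lemma second_derivative_horizontal:
  assumes p: "p \<in> U" and i: "i \<in> {1..DIM('b)}"
    and H: "\<And>q. q \<in> U \<Longrightarrow> smooth_field_at A q Y \<and> Y q \<in> horizontal_space A g B \<phi> q"
  shows "D p (e i p) (cov D (e i) (\<lambda>q. d\<phi> q (Y q))) =
    d\<phi> p (cov nabM (e i) (horizontal_part A g B \<phi> (cov nabM (e i) Y)) p)"
proof -
  let ?Z = "cov nabM (e i) Y"
  note i' = frame_index(1)[OF i]
  have Y: "smooth_field_at A q Y" if "q \<in> U" for q using H that by blast
  have Zq: "smooth_field_at A q ?Z" if "q \<in> U" for q
    by (rule cov_frame_field[OF that i' Y[OF that]])
  have T: "?Z q \<in> tangent_space A q" if "q \<in> U" for q
    by (rule smooth_section_at_tangent[OF Zq[OF that]])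
  have eH: "\<forall>\<^sub>F q in nhds p. e i q \<in> horizontal_space A g B \<phi> q" if "p \<in> U" for p
    by (rule eventually_frame[OF that]) (rule frame_horizontal[OF i])
  have YH: "\<forall>\<^sub>F q in nhds p. Y q \<in> horizontal_space A g B \<phi> q" if "p \<in> U" for p
    by (rule eventually_frame[OF that]) (use H in blast)
  have ZH: "\<forall>\<^sub>F q in nhds p. horizontal_part A g B \<phi> ?Z q \<in> horizontal_space A g B \<phi> q"
    by (rule eventually_frame[OF p], rule horizontal_part_horizontal) (use T in auto)
  have "cov D (e i) (\<lambda>q. d\<phi> q (Y q)) q = d\<phi> q (horizontal_part A g B \<phi> ?Z q)" if q: "q \<in> U" for q
    using D_horizontal[OF q M.frame_field[OF q i'] Y[OF q] eH[OF q] YH[OF q]]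
      differential_horizontal_part[where X = ?Z, OF q T[OF q]]
    by (simp only: cov_def[of D] cov_def[of nabM, THEN fun_cong])
  then have ev: "\<forall>\<^sub>F q in nhds p. cov D (e i) (\<lambda>q. d\<phi> q (Y q)) q = d\<phi> q (horizontal_part A g B \<phi> ?Z q)"
    by (rule eventually_frame[OF p])
  have "D p (e i p) (cov D (e i) (\<lambda>q. d\<phi> q (Y q))) =
      D p (e i p) (\<lambda>q. d\<phi> q (horizontal_part A g B \<phi> ?Z q))"
    by (rule D_cong[OF cov_section[OF M.frame_field[OF p i'] differential_section[OF Y[OF p]]]
          M.frame_tangent[OF p i'] ev])
  also have "\<dots> = d\<phi> p (cov nabM (e i) (horizontal_part A g B \<phi> ?Z) p)"
    unfolding cov_def[of nabM "e i" "horizontal_part A g B \<phi> ?Z"]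
    by (rule D_horizontal[OF p M.frame_field[OF p i'] horizontal_part_field[OF p Zq[OF p]] eH[OF p] ZH])
  finally show ?thesis .
qed

text \<open>\<open>D_vertical\<close> is used twice, with no projection in between. Moving
  \<open>e s\<close> to the right of each bracket costs two signs, which cancel.\<close>

lemma second_derivative_vertical:
  assumes p: "p \<in> U" and s: "s \<in> {DIM('b)+1..DIM('a)}" and Y: "\<And>q. q \<in> U \<Longrightarrow> smooth_field_at A q Y"
  shows "D p (e s p) (cov D (e s) (\<lambda>q. d\<phi> q (Y q))) =
    d\<phi> p (lie_bracket A (lie_bracket A Y (e s)) (e s) p)"
proof -
  note s' = frame_index(2)[OF s]
  let ?L = "lie_bracket A Y (e s)"
  have L: "smooth_field_at A q ?L" if "q \<in> U" for q
    by (rule M.lie_bracket_field[OF Y[OF that] M.frame_field[OF that s']])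
  have eV: "\<forall>\<^sub>F q in nhds p. e s q \<in> vertical_space A B \<phi> q" if "p \<in> U" for p
    by (rule eventually_frame[OF that]) (rule frame_vertical[OF s])
  have "cov D (e s) (\<lambda>q. d\<phi> q (Y q)) q = - 1 *\<^sub>R d\<phi> q (?L q)" if q: "q \<in> U" for q
    using D_vertical[OF q M.frame_field[OF q s'] Y[OF q] eV[OF q]]
    by (simp add: cov_def lie_bracket_skew[of A "e s" Y] linear_neg[OF linear_differential])
  then have ev: "\<forall>\<^sub>F q in nhds p. cov D (e s) (\<lambda>q. d\<phi> q (Y q)) q = - 1 *\<^sub>R d\<phi> q (?L q)"
    by (rule eventually_frame[OF p])
  note dL = differential_section[OF L[OF p]] and v = M.frame_tangent[OF p s']
  have "D p (e s p) (cov D (e s) (\<lambda>q. d\<phi> q (Y q))) = D p (e s p) (\<lambda>q. - 1 *\<^sub>R d\<phi> q (?L q))"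
    by (rule D_cong[OF cov_section[OF M.frame_field[OF p s'] differential_section[OF Y[OF p]]] v ev])
  also have "\<dots> = - D p (e s p) (\<lambda>q. d\<phi> q (?L q))"
    by (subst D_scale_const[OF dL v]) simp
  also have "\<dots> = - d\<phi> p (lie_bracket A (e s) ?L p)"
    by (simp only: D_vertical[OF p M.frame_field[OF p s'] L[OF p] eV[OF p]])
  also have "\<dots> = d\<phi> p (lie_bracket A ?L (e s) p)"
    by (simp only: lie_bracket_skew[of A "e s" ?L] linear_neg[OF linear_differential] minus_minus)
  finally show ?thesis .
qed

text \<open>Vertical frame fields have zero image and contribute nothing. The minus sign comes from
  exchanging the first two arguments: the bitension field has \<open>w\<close> in the second slot,
  the Ricci operator in the first.\<close>

lemma curvature_trace:
  assumes p: "p \<in> U" and w: "w \<in> tangent_space B (\<phi> p)"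
  shows "metric_trace A g p (\<lambda>u v. curvature B nabN (\<phi> p) (d\<phi> p u) w (d\<phi> p v)) =
    - ricci_operator B h nabN (\<phi> p) w"
proof -
  let ?R = "curvature B nabN (\<phi> p)"
  have pA: "p \<in> points A" by (rule M.frame_points[OF p])
  have q: "\<phi> p \<in> points B" by (rule image_points[OF pA])
  note ext = extendable_image[OF p] and dT = differential_in_tangent[OF pA]
  note lin1 = N.curvature_linear_1[OF ext q] and lin2 = N.curvature_linear_2[OF ext q]
    and lin3 = N.curvature_linear_3[OF ext q]
  have de: "d\<phi> p (e i p) \<in> tangent_space B (\<phi> p)" if "i \<in> {1..DIM('a)}" for i
    by (rule dT[OF M.frame_tangent[OF p that]])
  have comp: "linear_on (tangent_space A p) (\<lambda>u. F (d\<phi> p u))"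
    if "linear_on (tangent_space B (\<phi> p)) F" for F :: "'q tvec \<Rightarrow> 'q tvec"
    using that dT
    by (simp add: linear_on_def linear_add[OF linear_differential] linear_scale[OF linear_differential])
  have "metric_trace A g p (\<lambda>u v. ?R (d\<phi> p u) w (d\<phi> p v)) =
      (\<Sum>i = 1..DIM('a). ?R (d\<phi> p (e i p)) w (d\<phi> p (e i p)))"
    by (rule M.metric_trace_eq[OF pA M.frame_basis[OF p]])
      (intro comp lin1 lin3 w dT, assumption)+
  also have "\<dots> = (\<Sum>i = 1..DIM('b). ?R (d\<phi> p (e i p)) w (d\<phi> p (e i p)))
      + (\<Sum>s = DIM('b)+1..DIM('a). ?R (d\<phi> p (e s p)) w (d\<phi> p (e s p)))"
    by (rule split_sum)
  also have "(\<Sum>s = DIM('b)+1..DIM('a). ?R (d\<phi> p (e s p)) w (d\<phi> p (e s p))) = 0"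
  proof (rule sum.neutral, rule ballI)
    fix s assume s: "s \<in> {DIM('b)+1..DIM('a)}"
    have "d\<phi> p (e s p) = 0" by (rule differential_vertical[OF frame_vertical[OF s p]])
    then show "?R (d\<phi> p (e s p)) w (d\<phi> p (e s p)) = 0"
      using linear_on_0[OF lin3[OF tangent_space_zero w] tangent_space_zero] by simp
  qed
  also have "(\<Sum>i = 1..DIM('b). ?R (d\<phi> p (e i p)) w (d\<phi> p (e i p))) =
      (\<Sum>i = 1..DIM('b). - ?R w (d\<phi> p (e i p)) (d\<phi> p (e i p)))"
    by (rule sum.cong[OF refl], rule N.curvature_skew[OF ext q])
      (use w de frame_index(1) in blast)+
  also have "\<dots> = - (\<Sum>i = 1..DIM('b). ?R w (d\<phi> p (e i p)) (d\<phi> p (e i p)))"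
    by (rule sum_negf)
  also have "(\<Sum>i = 1..DIM('b). ?R w (d\<phi> p (e i p)) (d\<phi> p (e i p))) = ricci_operator B h nabN (\<phi> p) w"
    unfolding ricci_operator_def
    by (rule N.metric_trace_eq[OF q image_basis[OF p], symmetric])
      (intro lin2 lin3 w, assumption)+
  finally show ?thesis by (simp only: add_0_right)
qed

text \<open>Needed to pull the constant factor of the tension field out of the curvature
  term.\<close>

lemma ricci_operator_linear:
  assumes p: "p \<in> U"
  shows "linear_on (tangent_space B (\<phi> p)) (ricci_operator B h nabN (\<phi> p))"
proof -
  have q: "\<phi> p \<in> points B" by (rule image_points[OF M.frame_points[OF p]])
  note ext = extendable_image[OF p]
  have T: "d\<phi> p (e i p) \<in> tangent_space B (\<phi> p)" if "i \<in> {1..DIM('b)}" for i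
    using image_basis[OF p] that by (simp add: orthonormal_basis_def)
  have eq: "ricci_operator B h nabN (\<phi> p) w =
      (\<Sum>i = 1..DIM('b). curvature B nabN (\<phi> p) w (d\<phi> p (e i p)) (d\<phi> p (e i p)))"
    if "w \<in> tangent_space B (\<phi> p)" for w
    unfolding ricci_operator_def
    by (rule N.metric_trace_eq[OF q image_basis[OF p]])
      (intro N.curvature_linear_2[OF ext q] N.curvature_linear_3[OF ext q] that, assumption)+
  have "(\<Sum>i = 1..DIM('b). curvature B nabN (\<phi> p) (a *\<^sub>R u + b *\<^sub>R v) (d\<phi> p (e i p)) (d\<phi> p (e i p))) =
      a *\<^sub>R (\<Sum>i = 1..DIM('b). curvature B nabN (\<phi> p) u (d\<phi> p (e i p)) (d\<phi> p (e i p)))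
      + b *\<^sub>R (\<Sum>i = 1..DIM('b). curvature B nabN (\<phi> p) v (d\<phi> p (e i p)) (d\<phi> p (e i p)))"
    if "u \<in> tangent_space B (\<phi> p)" "v \<in> tangent_space B (\<phi> p)" for u v a b
    unfolding scaleR_sum_right sum.distrib[symmetric]
    by (rule sum.cong[OF refl])
      (use that N.curvature_linear_1[OF ext q T T] in \<open>simp add: linear_on_def\<close>)
  then show ?thesis
    by (simp add: linear_on_def eq tangent_space_add tangent_space_scale)
qed

section \<open>The mean curvature of the fibers and the assembly of the formula\<close>

context
  fixes \<mu> :: "'p \<Rightarrow> 'p tvec"
  assumes mu: "\<And>p. p \<in> U \<Longrightarrow> \<mu> p = (1 / real (DIM('a) - DIM('b))) *\<^sub>R
    (\<Sum>s = DIM('b)+1..DIM('a). horizontal_part A g B \<phi> (cov nabM (e s) (e s)) p)"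
begin

lemma mean_curvature_sum:
  "p \<in> U \<Longrightarrow> (\<Sum>s = DIM('b)+1..DIM('a). horizontal_part A g B \<phi> (cov nabM (e s) (e s)) p) =
    real (DIM('a) - DIM('b)) *\<^sub>R \<mu> p"
  using dim by (simp add: mu)

lemma frame_derivative_field:
  "p \<in> U \<Longrightarrow> i \<in> {1..DIM('a)} \<Longrightarrow> smooth_field_at A p (cov nabM (e i) (e i))"
  by (rule cov_frame_field[OF _ _ M.frame_field])

lemma frame_derivative_tangent:
  "p \<in> U \<Longrightarrow> i \<in> {1..DIM('a)} \<Longrightarrow> cov nabM (e i) (e i) p \<in> tangent_space A p"
  by (rule smooth_section_at_tangent[OF frame_derivative_field])

lemma mean_curvature_horizontal: "p \<in> U \<Longrightarrow> \<mu> p \<in> horizontal_space A g B \<phi> p"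
  unfolding mu
  by (intro subspace_scale subspace_sum subspace_horizontal M.frame_points
      horizontal_part_horizontal frame_derivative_tangent frame_index(2))

lemma mean_curvature_field:
  assumes p: "p \<in> U"
  shows "smooth_field_at A p \<mu>"
proof (rule smooth_section_at_cong[OF atlas])
  show "smooth_field_at A p (\<lambda>q. (1 / real (DIM('a) - DIM('b))) *\<^sub>R
      (\<Sum>s = DIM('b)+1..DIM('a). horizontal_part A g B \<phi> (cov nabM (e s) (e s)) q))"
    by (rule smooth_section_at_scale_const[OF atlas smooth_section_at_sum[OF atlas M.frame_field[OF p, of 1]]])
      (use dim in \<open>auto intro!: horizontal_part_field[OF p] frame_derivative_field p\<close>)
qed (rule eventually_frame[OF p mu[symmetric]])

text \<open>Horizontal frame fields contribute nothing by \<open>D_horizontal\<close>. For vertical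
  ones \<open>d\<phi>(e s)\<close> vanishes near \<open>p\<close>, so only the term with the
  connection of M survives, and the differential sees its horizontal part alone.\<close>

lemma tension_field_eq:
  assumes p: "p \<in> U"
  shows "tension_field A g B \<phi> nabM D p = (- real (DIM('a) - DIM('b))) *\<^sub>R d\<phi> p (\<mu> p)"
proof -
  let ?B = "\<lambda>i. D p (e i p) (\<lambda>q. d\<phi> q (e i q)) - d\<phi> p (nabM p (e i p) (e i))"
  let ?H = "\<lambda>s. horizontal_part A g B \<phi> (cov nabM (e s) (e s)) p"
  have "tension_field A g B \<phi> nabM D p = (\<Sum>i = 1..DIM('b). ?B i) + (\<Sum>s = DIM('b)+1..DIM('a). ?B s)"
    unfolding tension_field_frame[OF p] by (rule split_sum)
  also have "(\<Sum>i = 1..DIM('b). ?B i) = 0"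
  proof (rule sum.neutral, rule ballI)
    fix i assume i: "i \<in> {1..DIM('b)}"
    have e: "smooth_field_at A p (e i)" by (rule M.frame_field[OF p frame_index(1)[OF i]])
    have "\<forall>\<^sub>F q in nhds p. e i q \<in> horizontal_space A g B \<phi> q"
      by (rule eventually_frame[OF p frame_horizontal[OF i]])
    from D_horizontal[OF p e e this this] show "?B i = 0" by simp
  qed
  also have "(\<Sum>s = DIM('b)+1..DIM('a). ?B s) = (\<Sum>s = DIM('b)+1..DIM('a). (-1) *\<^sub>R d\<phi> p (?H s))"
  proof (rule sum.cong[OF refl])
    fix s assume s: "s \<in> {DIM('b)+1..DIM('a)}"
    note s' = frame_index(2)[OF s]
    have e: "smooth_field_at A p (e s)" by (rule M.frame_field[OF p s'])
    have "\<forall>\<^sub>F q in nhds p. d\<phi> q (e s q) = 0"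
      by (rule eventually_frame[OF p differential_vertical[OF frame_vertical[OF s]]])
    then have "D p (e s p) (\<lambda>q. d\<phi> q (e s q)) = D p (e s p) (\<lambda>q. 0)"
      by (rule D_cong[OF differential_section[OF e] M.frame_tangent[OF p s']])
    also have "\<dots> = 0" by (rule D_zero[OF differential_section[OF e] M.frame_tangent[OF p s']])
    finally have "?B s = - d\<phi> p (cov nabM (e s) (e s) p)" by (simp add: cov_def)
    also have "d\<phi> p (cov nabM (e s) (e s) p) = d\<phi> p (?H s)"
      by (rule differential_horizontal_part[where X = "cov nabM (e s) (e s)", OF p
            frame_derivative_tangent[OF p s'], symmetric])
    finally show "?B s = (-1) *\<^sub>R d\<phi> p (?H s)" by simp
  qed
  also have "\<dots> = (-1) *\<^sub>R d\<phi> p (\<Sum>s = DIM('b)+1..DIM('a). ?H s)"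
    by (simp only: scaleR_sum_right linear_sum[OF linear_differential])
  finally show ?thesis
    by (simp only: mean_curvature_sum[OF p] linear_scale[OF linear_differential] add_0_left
        scaleR_scaleR mult_minus1)
qed

lemma bitension_field_eq:
  assumes p: "p \<in> U"
  shows "bitension_field A g B \<phi> nabM nabN D p =
    - (real (DIM('a) - DIM('b)) *\<^sub>R d\<phi> p
        ((\<Sum>i = 1..DIM('b).
            cov nabM (e i) (horizontal_part A g B \<phi> (cov nabM (e i) \<mu>)) p
            - cov nabM (horizontal_part A g B \<phi> (cov nabM (e i) (e i))) \<mu> p
            + lie_bracket A \<mu> (vertical_part A g B \<phi> (cov nabM (e i) (e i))) p)
         + (\<Sum>s = DIM('b)+1..DIM('a).
            lie_bracket A (lie_bracket A \<mu> (e s)) (e s) p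
            + lie_bracket A \<mu> (vertical_part A g B \<phi> (cov nabM (e s) (e s))) p)
         - real (DIM('a) - DIM('b)) *\<^sub>R cov nabM \<mu> \<mu> p))
    - real (DIM('a) - DIM('b)) *\<^sub>R ricci_operator B h nabN (\<phi> p) (d\<phi> p (\<mu> p))"
proof -
  define k where "k = real (DIM('a) - DIM('b))"
  define \<tau> where "\<tau> = tension_field A g B \<phi> nabM D"
  let ?V = "\<lambda>q. d\<phi> q (\<mu> q)" and ?Z = "\<lambda>i. cov nabM (e i) (e i)"
  let ?H = "\<lambda>i. horizontal_part A g B \<phi> (?Z i)" and ?W = "\<lambda>i. vertical_part A g B \<phi> (?Z i)"
  let ?a = "\<lambda>i. cov nabM (e i) (horizontal_part A g B \<phi> (cov nabM (e i) \<mu>)) p"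
    and ?h = "\<lambda>i. cov nabM (?H i) \<mu> p" and ?l = "\<lambda>i. lie_bracket A \<mu> (?W i) p"
    and ?b = "\<lambda>s. lie_bracket A (lie_bracket A \<mu> (e s)) (e s) p"
  let ?F = "\<lambda>V i. D p (e i p) (cov D (e i) V) - D p (nabM p (e i p) (e i)) V"
  note lin = linear_add[OF linear_differential] linear_diff[OF linear_differential]
    linear_sum[OF linear_differential] linear_scale[OF linear_differential]
  note muf = mean_curvature_field
  have H: "smooth_field_at A q \<mu> \<and> \<mu> q \<in> horizontal_space A g B \<phi> q" if "q \<in> U" for q
    using muf[OF that] mean_curvature_horizontal[OF that] ..
  have V: "smooth_section_at A B \<phi> q ?V" if "q \<in> U" for q
    by (rule differential_section[OF muf[OF that]])
  have \<tau>: "\<tau> q = (- k) *\<^sub>R ?V q" if "q \<in> U" for q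
    using tension_field_eq[OF that] by (simp only: \<tau>_def k_def)
  have ev: "\<forall>\<^sub>F r in nhds q. (- k) *\<^sub>R ?V r = \<tau> r" if "q \<in> U" for q
    by (rule eventually_frame[OF that \<tau>[symmetric]])
  have sk: "smooth_section_at A B \<phi> q (\<lambda>r. (- k) *\<^sub>R ?V r)" if "q \<in> U" for q
    by (rule smooth_section_at_scale_const[OF atlas V[OF that]])
  \<comment> \<open>\<tau> is known to be a constant multiple of \<open>?V\<close> only on
    \<open>U\<close>, so the constant is taken out through locality; \<open>F\<tau>\<close> repeats
    this for the second derivative.\<close>
  have D\<tau>: "D q v \<tau> = (- k) *\<^sub>R D q v ?V" if "q \<in> U" "v \<in> tangent_space A q" for q v
    using D_cong[OF sk[OF that(1)] that(2) ev[OF that(1)]] D_scale_const[OF V[OF that(1)] that(2)]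
    by metis
  have F\<tau>: "?F \<tau> i = (- k) *\<^sub>R ?F ?V i" if i: "i \<in> {1..DIM('a)}" for i
  proof -
    note c = cov_section[OF M.frame_field[OF p i] V[OF p]] and ei = M.frame_tangent[OF p i]
    have "cov D (e i) \<tau> q = (- k) *\<^sub>R cov D (e i) ?V q" if "q \<in> U" for q
      using D\<tau>[OF that M.frame_tangent[OF that i]] by (simp only: cov_def)
    then have "\<forall>\<^sub>F q in nhds p. (- k) *\<^sub>R cov D (e i) ?V q = cov D (e i) \<tau> q"
      by (intro eventually_frame[OF p]) (rule sym)
    then have "D p (e i p) (cov D (e i) \<tau>) = D p (e i p) (\<lambda>q. (- k) *\<^sub>R cov D (e i) ?V q)"
      by (rule D_cong[OF smooth_section_at_scale_const[OF atlas c] ei, symmetric])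
    also have "\<dots> = (- k) *\<^sub>R D p (e i p) (cov D (e i) ?V)" by (rule D_scale_const[OF c ei])
    finally show ?thesis
      using D\<tau>[OF p M.D_tangent[OF M.frame_field[OF p i] ei]] by (simp only: scaleR_diff_right)
  qed
  have hor: "?F ?V i = d\<phi> p (?a i - ?h i + ?l i)" if i: "i \<in> {1..DIM('b)}" for i
  proof -
    note part = cov_part[OF p frame_index(1)[OF i] muf[OF p]]
    have "D p (e i p) (cov D (e i) ?V) = d\<phi> p (?a i)"
      by (rule second_derivative_horizontal[OF p i]) (rule H)
    moreover have "D p (nabM p (e i p) (e i)) ?V = D p (?H i p) ?V - d\<phi> p (?l i)"
      by (rule part(1)) (rule H)
    moreover have "D p (?H i p) ?V = d\<phi> p (?h i)"
      by (rule part(2)) (rule H)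
    ultimately show ?thesis by (simp add: lin)
  qed
  \<comment> \<open>The derivatives along the horizontal parts are left in terms of
    \<open>D\<close>, to be collected into a single direction.\<close>
  have ver: "?F ?V s = d\<phi> p (?b s + ?l s) - D p (?H s p) ?V" if s: "s \<in> {DIM('b)+1..DIM('a)}" for s
  proof -
    have "D p (e s p) (cov D (e s) ?V) = d\<phi> p (?b s)"
      by (rule second_derivative_vertical[OF p s]) (rule muf)
    moreover have "D p (nabM p (e s p) (e s)) ?V = D p (?H s p) ?V - d\<phi> p (?l s)"
      by (rule cov_part(1)[OF p frame_index(2)[OF s] muf[OF p]]) (rule H)
    ultimately show ?thesis by (simp add: lin)
  qed
  \<comment> \<open>Summing the directions before converting gives
    \<open>k *\<^sub>R \<mu> p\<close>, by the definition of the mean curvature. A single use of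
    \<open>D_horizontal\<close> then yields the derivative of \<mu> along itself, with one factor
    \<open>k\<close> inside the differential.\<close>
  have "(\<Sum>s = DIM('b)+1..DIM('a). D p (?H s p) ?V) = D p (\<Sum>s = DIM('b)+1..DIM('a). 1 *\<^sub>R ?H s p) ?V"
  proof -
    have "D p (\<Sum>s = DIM('b)+1..DIM('a). 1 *\<^sub>R ?H s p) ?V = (\<Sum>s = DIM('b)+1..DIM('a). 1 *\<^sub>R D p (?H s p) ?V)"
      by (rule linear_on_sum[OF subspace_tangent_space D_linear_on[OF V[OF p]]],
          rule horizontal_tangent, rule horizontal_part_horizontal[OF p], rule frame_derivative_tangent[OF p])
        (rule frame_index(2))
    then show ?thesis by simp
  qed
  also have "\<dots> = D p (k *\<^sub>R \<mu> p) ?V"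
    using mean_curvature_sum[OF p] by (simp only: scaleR_one k_def)
  also have "\<dots> = k *\<^sub>R D p (\<mu> p) ?V"
    by (rule linear_on_scale[OF D_linear_on[OF V[OF p]] horizontal_tangent[OF mean_curvature_horizontal[OF p]]])
  also have "D p (\<mu> p) ?V = d\<phi> p (cov nabM \<mu> \<mu> p)"
  proof -
    have "\<forall>\<^sub>F q in nhds p. \<mu> q \<in> horizontal_space A g B \<phi> q"
      by (rule eventually_frame[OF p mean_curvature_horizontal])
    from D_horizontal[OF p muf[OF p] muf[OF p] this this] show ?thesis by (simp only: cov_def)
  qed
  finally have mean: "(\<Sum>s = DIM('b)+1..DIM('a). D p (?H s p) ?V) = k *\<^sub>R d\<phi> p (cov nabM \<mu> \<mu> p)" .
  have hors: "(\<Sum>i = 1..DIM('b). ?F ?V i) = d\<phi> p (\<Sum>i = 1..DIM('b). ?a i - ?h i + ?l i)"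
    unfolding linear_sum[OF linear_differential] by (rule sum.cong[OF refl hor])
  have "(\<Sum>s = DIM('b)+1..DIM('a). ?F ?V s) = (\<Sum>s = DIM('b)+1..DIM('a). d\<phi> p (?b s + ?l s) - D p (?H s p) ?V)"
    by (rule sum.cong[OF refl ver])
  then have vers: "(\<Sum>s = DIM('b)+1..DIM('a). ?F ?V s) =
      d\<phi> p (\<Sum>s = DIM('b)+1..DIM('a). ?b s + ?l s) - k *\<^sub>R d\<phi> p (cov nabM \<mu> \<mu> p)"
    by (simp only: sum_subtractf mean linear_sum[OF linear_differential])
  have laplacian: "(\<Sum>i = 1..DIM('a). ?F ?V i) = d\<phi> p ((\<Sum>i = 1..DIM('b). ?a i - ?h i + ?l i)
      + (\<Sum>s = DIM('b)+1..DIM('a). ?b s + ?l s) - k *\<^sub>R cov nabM \<mu> \<mu> p)"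
    unfolding split_sum hors vers
    by (simp only: linear_add[OF linear_differential] linear_diff[OF linear_differential]
        linear_scale[OF linear_differential] add_diff_eq)
  have "(\<Sum>i = 1..DIM('a). ?F \<tau> i) = (- k) *\<^sub>R (\<Sum>i = 1..DIM('a). ?F ?V i)"
    unfolding scaleR_sum_right by (rule sum.cong[OF refl F\<tau>])
  with rough_laplacian_frame[OF p smooth_section_at_cong[OF atlas sk[OF p] ev[OF p]]]
  have rough: "rough_laplacian A g nabM D \<tau> p = - ((- k) *\<^sub>R (\<Sum>i = 1..DIM('a). ?F ?V i))"
    by (simp only:)
  have \<mu>T: "d\<phi> p (\<mu> p) \<in> tangent_space B (\<phi> p)"
    by (rule smooth_section_at_tangent[OF V[OF p]])
  then have \<tau>T: "\<tau> p \<in> tangent_space B (\<phi> p)"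
    unfolding \<tau>[OF p] by (rule tangent_space_scale)
  have "ricci_operator B h nabN (\<phi> p) (\<tau> p) = (- k) *\<^sub>R ricci_operator B h nabN (\<phi> p) (d\<phi> p (\<mu> p))"
    unfolding \<tau>[OF p] by (rule linear_on_scale[OF ricci_operator_linear[OF p] \<mu>T])
  with curvature_trace[OF p \<tau>T] have trace:
    "metric_trace A g p (\<lambda>u v. curvature B nabN (\<phi> p) (d\<phi> p u) (\<tau> p) (d\<phi> p v)) =
      k *\<^sub>R ricci_operator B h nabN (\<phi> p) (d\<phi> p (\<mu> p))" by simp
  \<comment> \<open>Signs: the minus of the rough Laplacian cancels against the one in the bitension
    field, so the factor \<open>- k\<close> of \<tau> remains in front of the differential. In
    \<open>trace\<close> the minus of \<tau> cancels against the one from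
    \<open>curvature_trace\<close>, and the sign in the bitension field makes the Ricci term
    negative.\<close>
  show ?thesis
    unfolding bitension_field_def \<tau>_def[symmetric] k_def[symmetric] rough trace laplacian
    by simp
qed

end

end

theorem theorem2p1:
  fixes A :: "('p::{t2_space,second_countable_topology}, 'a::euclidean_space) chart set"
    and B :: "('q::{t2_space,second_countable_topology}, 'b::euclidean_space) chart set"
    and g :: "'p metric" and h :: "'q metric"
    and \<phi> :: "'p \<Rightarrow> 'q"
    and nabM :: "('p, 'p) connection" and nabN :: "('q, 'q) connection"
    and D :: "('p, 'q) connection"
    and m n :: nat
    and U :: "'p set" and e :: "nat \<Rightarrow> 'p \<Rightarrow> 'p tvec" and \<mu> :: "'p \<Rightarrow> 'p tvec"
  assumes M: "riemannian_manifold A g" "m = DIM('a)"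
    and N: "riemannian_manifold B h" "n = DIM('b)"
    and mn: "m > n"
    and submersion: "riemannian_submersion A g B h \<phi>"
    and LC_M: "levi_civita A g nabM"
    and LC_N: "levi_civita B h nabN"
    and pullback: "pullback_connection A B \<phi> nabN D"
    and frame: "orthonormal_frame A g U e"
    and frame_horizontal: "\<forall>i\<in>{1..n}. \<forall>p\<in>U. e i p \<in> horizontal_space A g B \<phi> p"
    and frame_vertical: "\<forall>s\<in>{n+1..m}. \<forall>p\<in>U. e s p \<in> vertical_space A B \<phi> p"
    and mu: "\<forall>p\<in>U. \<mu> p =
      (1 / real (m - n)) *\<^sub>R (\<Sum>s = n+1..m. horizontal_part A g B \<phi> (cov nabM (e s) (e s)) p)"
  shows "\<forall>p\<in>U. bitension_field A g B \<phi> nabM nabN D p =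
    - (real (m - n) *\<^sub>R differential B \<phi> p
        ((\<Sum>i = 1..n.
            cov nabM (e i) (horizontal_part A g B \<phi> (cov nabM (e i) \<mu>)) p
            - cov nabM (horizontal_part A g B \<phi> (cov nabM (e i) (e i))) \<mu> p
            + lie_bracket A \<mu> (vertical_part A g B \<phi> (cov nabM (e i) (e i))) p)
         + (\<Sum>s = n+1..m.
            lie_bracket A (lie_bracket A \<mu> (e s)) (e s) p
            + lie_bracket A \<mu> (vertical_part A g B \<phi> (cov nabM (e s) (e s))) p)
         - real (m - n) *\<^sub>R cov nabM \<mu> \<mu> p))
    - real (m - n) *\<^sub>R ricci_operator B h nabN (\<phi> p) (differential B \<phi> p (\<mu> p))"
proof -
  interpret submersion A g nabM U e B h nabN \<phi> D
    using M N mn submersion LC_M LC_N pullback frame frame_horizontal frame_vertical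
    by unfold_locales auto
  show ?thesis
    using bitension_field_eq[of \<mu>] mu unfolding M(2) N(2) by blast
qed

end
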